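(* The plethystic bialgebra with noncommuting variables $\mathcal P^{\diamondsuit}$ is isomorphic to the homotopy cardinality of the incidence bialgebra of the simplicial groupoid $\mathcal B^{\mathsf S^{\mathrm r}}\mathcal T_{\mathsf M^{\mathrm r}}(\mathsf{Sym})$.
   Context: Monads and operads. $\mathbf{Grpd}$ is the category of groupoids. $\mathsf{M}^{\mathrm r}$ is the monad on $\mathbf{Grpd}$ sending a groupoid $A$ to $\bigsqcup_{n\ge 1}A^n$ (nonempty finite tuples, morphisms componentwise), with unit $a\mapsto (a)$ and multiplication $\mu$ given by concatenating a tuple of tuples. $\mathsf{S}^{\mathrm r}$ is the monad sending $A$ to $\bigsqcup_{n\ge1}A^n/\!/\mathfrak S_n$: same objects, and besides componentwise morphisms there is for each $\sigma\in\mathfrak S_n$ an isomorphism $(a_1,\dots,a_n)\to(a_{\sigma(1)},\dots,a_{\sigma(n)})$; unit and multiplication as for $\mathsf M^{\mathrm r}$; the inclusion $\mathsf M^{\mathrm r}\Rightarrow\mathsf S^{\mathrm r}$ is a monad map. For $\mathsf P\in\{\mathsf M^{\mathrm r},\mathsf S^{\mathrm r}\}$, a $\mathsf P$-operad $Q$ consists of groupoids $Q_0$ (colours), $Q_1$ (operations), functors $s\colon Q_1\to \mathsf PQ_0$ (inputs), $t\colon Q_1\to Q_0$ (output), a composition $m\colon \mathsf PQ_1\times_{\mathsf PQ_0}Q_1\to Q_1$ (pullback of $\mathsf Pt$ and $s$; the $Q_1$ factor is the root operation) and units $e\colon Q_0\to Q_1$, satisfying $s m=\mu_{Q_0}\circ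 \mathsf Ps\circ \mathrm{pr}_1$, $t m=t\,\mathrm{pr}_2$, $s e=\eta_{Q_0}$, $t e=\mathrm{id}$ and associativity and unit laws. $\mathsf{Sym}$ is the terminal $\mathsf S^{\mathrm r}$-operad on one colour: $Q_0=1$, $Q_1=\mathsf S^{\mathrm r}1$ (one $n$-ary operation for each $n\ge 1$, automorphism group $\mathfrak S_n$), composition given by $\mu$. $\mathcal T$-construction. (i) For $\mathsf P\in\{\mathsf M^{\mathrm r},\mathsf S^{\mathrm r}\}$ and a category $C$ internal to $\mathbf{Grpd}$ with discrete object groupoid $C_0$, $\mathcal T_{\mathsf P}(C)$ is the $\mathsf P$-operad with colours $C_0$ whose groupoid of operations is the pullback of $\mathsf P(\text{target})\colon\mathsf PC_1\to\mathsf PC_0$ along $C_0\times\mathsf P1\to\mathsf PC_0$, $(c,(\ast,\dots,\ast))\mapsto(c,\dots,c)$: objects are nonempty tuples $(f_1,\dots,f_n)$ of arrows of $C$ with common target $c$ (inputs the sources, output $c$), morphisms are those of $\mathsf PC_1$ between such tuples, composition $(f_1,\dots,f_k)\circ\big((g^1_j)_j,\dots,(g^k_j)_j\big)=(f_1g^1_1,\dots,f_1g^1_{n_1},\dots,f_kg^k_{n_k})$, units identity arrows. (ii) For $\mathsf P'\in\{\mathsf M^{\mathrm r},\mathsf S^{\mathrm r}\}$ and a $\mathsf P'$-operad $Q$ with discrete $Q_0$, $\mathcal T^{\mathsf P'}(Q)$ is the category internal to $\mathbf{Grpd}$ with objects $Q_0$, whose arrows $c\to d$ are operations of $Q$ all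 of whose inputs are $c$ and whose output is $d$ (pullback of $s$ along $Q_0\times\mathsf P'1\to\mathsf P'Q_0$), composition $y\circ x=m((x,\dots,x);y)$ ($x$ once per input of $y$), identities $e$. (iii) $\mathcal T_{\mathsf P}(Q):=\mathcal T_{\mathsf P}(\mathcal T^{\mathsf P'}(Q))$. Bar construction. For $\mathsf P,\mathsf R\in\{\mathsf M^{\mathrm r},\mathsf S^{\mathrm r}\}$ with $\mathsf P=\mathsf R$ or ($\mathsf P=\mathsf M^{\mathrm r}$, $\mathsf R=\mathsf S^{\mathrm r}$), and a $\mathsf P$-operad $Q$, set $Q_n:=\mathsf PQ_{n-1}\times_{\mathsf PQ_0}Q_1$ ($n\ge2$; $n$-level trees). $\mathcal B^{\mathsf R}Q$ is the simplicial groupoid with $\mathcal B^{\mathsf R}_nQ=\mathsf RQ_n$; $d_0$ discards the top (leafward) level keeping outputs ($d_0=\mathsf Rt$ for $n=1$), $d_n$ discards the root level and flattens via $\mathsf P\Rightarrow\mathsf R$ and the multiplication of $\mathsf R$, inner faces compose adjacent levels via $m$, degeneracies insert units. $\mathcal BQ:=\mathcal B^{\mathsf P}Q$. Incidence bialgebra. For a groupoid $G$, $|G|=\sum_{[x]}1/|\mathrm{Aut}(x)|$. For $X=\mathcal B^{\mathsf R}Q$, $\mathbb Q_{\pi_0X_1}$ has basis $\delta_a$; $\Delta(\delta_f)=\sum_{a,b}\frac{|\Phi_{f;a,b}|}{|\mathrm{Aut}(a)||\mathrm{Aut}(b)|}\delta_a\otimes\delta_b$ with $\Phi_{f;a,b}$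 the homotopy fibre over $(a,b)$ of $(d_2,d_0)$ restricted to the homotopy fibre of $d_1\colon X_2\to X_1$ over $f$; $\epsilon(\delta_f)=$ cardinality of the homotopy fibre of $s_0$ over $f$; product $\delta_a\delta_b=\delta_{a+b}$, $+$ being juxtaposition of $\mathsf R$-configurations (unit adjoined). The bialgebra. $W$ is the set of nonempty finite words $\omega=\omega_1\cdots\omega_n$ in positive integers; $\mathbf x_\omega=x_{\omega_1}\cdots x_{\omega_n}$, $\omega!=\omega_1!\cdots\omega_n!$. Elements of the ring $\mathbb Q\langle\langle\mathbf x\rangle\rangle_+$ of power series in noncommuting variables $x_1,x_2,\dots$ without constant term are written $F=\sum_{\omega\in W}F_\omega\mathbf x_\omega/\omega!$. Plethystic substitution: $(G\circledast F)(x_1,x_2,\dots)=G(F_1,F_2,\dots)$ with $F_k(x_1,x_2,\dots)=F(x_k,x_{2k},\dots)$. $\mathcal P^\diamondsuit$ is the polynomial algebra $\mathbb Q[A_\omega:\omega\in W]$, $A_\omega(F)=F_\omega$, with comultiplication determined by $\Delta(A_\omega)(F,G)=A_\omega(G\circledast F)$ and counit $\epsilon(A_\omega)=A_\omega(x_1)$. *)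

theory Defs
  imports
    Complex_Main
    "HOL-Combinatorics.Permutations"
    "HOL-Library.Poly_Mapping"
    "HOL-Library.Product_Plus"
begin

section \<open>Groupoids\<close>

text \<open>
  A groupoid is given by its object and arrow sets and its structure maps, whose values
  outside those sets (or on non-composable pairs) are irrelevant; \<open>gcomp G g f\<close> is \<open>g\<close>
  after \<open>f\<close>.  A functor is given by its action on objects and on arrows.
\<close>

record ('o, 'm) grpd =
  Ob :: "'o set"
  Ar :: "'m set"
  gdom :: "'m \<Rightarrow> 'o"
  gcod :: "'m \<Rightarrow> 'o"
  gid :: "'o \<Rightarrow> 'm"
  gcomp :: "'m \<Rightarrow> 'm \<Rightarrow> 'm"

record ('o, 'm, 'p, 'n) gfun =
  on_ob :: "'o \<Rightarrow> 'p"
  on_ar :: "'m \<Rightarrow> 'n"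

definition idF :: "('o, 'm, 'o, 'm) gfun" where
  "idF = \<lparr>on_ob = (\<lambda>x. x), on_ar = (\<lambda>f. f)\<rparr>"

definition compF ::
  "('p, 'n, 'q, 'l) gfun \<Rightarrow> ('o, 'm, 'p, 'n) gfun \<Rightarrow> ('o, 'm, 'q, 'l) gfun"
  (infixr \<open>\<odot>\<close> 55) where
  "G \<odot> F = \<lparr>on_ob = on_ob G \<circ> on_ob F, on_ar = on_ar G \<circ> on_ar F\<rparr>"

definition pairF ::
  "('o, 'm, 'p, 'n) gfun \<Rightarrow> ('o, 'm, 'q, 'l) gfun \<Rightarrow> ('o, 'm, 'p \<times> 'q, 'n \<times> 'l) gfun" where
  "pairF F G = \<lparr>on_ob = (\<lambda>x. (on_ob F x, on_ob G x)), on_ar = (\<lambda>f. (on_ar F f, on_ar G f))\<rparr>"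

definition pr1 :: "('o \<times> 'p, 'm \<times> 'n, 'o, 'm) gfun" where
  "pr1 = \<lparr>on_ob = fst, on_ar = fst\<rparr>"

definition pr2 :: "('o \<times> 'p, 'm \<times> 'n, 'p, 'n) gfun" where
  "pr2 = \<lparr>on_ob = snd, on_ar = snd\<rparr>"

definition pullback ::
  "('o, 'm) grpd \<Rightarrow> ('p, 'n) grpd \<Rightarrow> ('o, 'm, 'q, 'l) gfun \<Rightarrow> ('p, 'n, 'q, 'l) gfun
    \<Rightarrow> ('o \<times> 'p, 'm \<times> 'n) grpd" where
  "pullback G H F K =
    \<lparr>Ob = {(x, y). x \<in> Ob G \<and> y \<in> Ob H \<and> on_ob F x = on_ob K y},
     Ar = {(f, g). f \<in> Ar G \<and> g \<in> Ar H \<and> on_ar F f = on_ar K g},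
     gdom = (\<lambda>(f, g). (gdom G f, gdom H g)),
     gcod = (\<lambda>(f, g). (gcod G f, gcod H g)),
     gid = (\<lambda>(x, y). (gid G x, gid H y)),
     gcomp = (\<lambda>(f', g') (f, g). (gcomp G f' f, gcomp H g' g))\<rparr>"

definition terminal_grpd :: "(unit, unit) grpd" where
  "terminal_grpd =
    \<lparr>Ob = UNIV, Ar = UNIV, gdom = (\<lambda>_. ()), gcod = (\<lambda>_. ()), gid = (\<lambda>_. ()), gcomp = (\<lambda>_ _. ())\<rparr>"

definition bangF :: "('o, 'm, unit, unit) gfun" where
  "bangF = \<lparr>on_ob = (\<lambda>_. ()), on_ar = (\<lambda>_. ())\<rparr>"

definition prod_grpd ::
  "('o, 'm) grpd \<Rightarrow> ('p, 'n) grpd \<Rightarrow> ('o \<times> 'p, 'm \<times> 'n) grpd" where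
  "prod_grpd G H = pullback G H bangF bangF"

text \<open>Transport of the structure of \<open>G\<close> along an injective relabelling \<open>F\<close> with left inverse \<open>F'\<close>.\<close>

definition relabel ::
  "('o, 'm, 'p, 'n) gfun \<Rightarrow> ('p, 'n, 'o, 'm) gfun \<Rightarrow> ('o, 'm) grpd \<Rightarrow> ('p, 'n) grpd" where
  "relabel F F' G =
    \<lparr>Ob = on_ob F ` Ob G,
     Ar = on_ar F ` Ar G,
     gdom = on_ob F \<circ> gdom G \<circ> on_ar F',
     gcod = on_ob F \<circ> gcod G \<circ> on_ar F',
     gid = on_ar F \<circ> gid G \<circ> on_ob F',
     gcomp = (\<lambda>g f. on_ar F (gcomp G (on_ar F' g) (on_ar F' f)))\<rparr>"

definition hom :: "('o, 'm) grpd \<Rightarrow> 'o \<Rightarrow> 'o \<Rightarrow> 'm set" where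
  "hom G x y = {f \<in> Ar G. gdom G f = x \<and> gcod G f = y}"

definition aut :: "('o, 'm) grpd \<Rightarrow> 'o \<Rightarrow> 'm set" where
  "aut G x = hom G x x"

definition iso_rel :: "('o, 'm) grpd \<Rightarrow> ('o \<times> 'o) set" where
  "iso_rel G = {(x, y). x \<in> Ob G \<and> y \<in> Ob G \<and> hom G x y \<noteq> {}}"

definition pi0 :: "('o, 'm) grpd \<Rightarrow> 'o set set" where
  "pi0 G = Ob G // iso_rel G"

definition iso_class :: "('o, 'm) grpd \<Rightarrow> 'o \<Rightarrow> 'o set" where
  "iso_class G x = iso_rel G `` {x}"

definition rep :: "'o set \<Rightarrow> 'o" where
  "rep C = (SOME x. x \<in> C)"

text \<open>Homotopy cardinality, meaningful for groupoids satisfying \<open>hfinite\<close>.\<close>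

definition hfinite :: "('o, 'm) grpd \<Rightarrow> bool" where
  "hfinite G \<longleftrightarrow> finite (pi0 G) \<and> (\<forall>x\<in>Ob G. finite (aut G x))"

definition hcard :: "('o, 'm) grpd \<Rightarrow> rat" where
  "hcard G = (\<Sum>C\<in>pi0 G. 1 / of_nat (card (aut G (rep C))))"

text \<open>
  Homotopy fibre of \<open>F : G \<rightarrow> H\<close> over \<open>b\<close>: objects are pairs \<open>(x, \<beta>)\<close> with
  \<open>\<beta> : F x \<rightarrow> b\<close>; an arrow is recorded together with its domain and codomain.
\<close>

definition hfib ::
  "('o, 'm) grpd \<Rightarrow> ('p, 'n) grpd \<Rightarrow> ('o, 'm, 'p, 'n) gfun \<Rightarrow> 'p
    \<Rightarrow> ('o \<times> 'n, ('o \<times> 'n) \<times> 'm \<times> ('o \<times> 'n)) grpd" where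
  "hfib G H F b =
    (let obs = {(x, \<beta>). x \<in> Ob G \<and> \<beta> \<in> hom H (on_ob F x) b} in
     \<lparr>Ob = obs,
      Ar = {(u, \<xi>, v). u \<in> obs \<and> v \<in> obs \<and> \<xi> \<in> hom G (fst u) (fst v) \<and>
              gcomp H (snd v) (on_ar F \<xi>) = snd u},
      gdom = (\<lambda>(u, \<xi>, v). u),
      gcod = (\<lambda>(u, \<xi>, v). v),
      gid = (\<lambda>u. (u, gid G (fst u), u)),
      gcomp = (\<lambda>(u', \<xi>', v') (u, \<xi>, v). (u, gcomp G \<xi>' \<xi>, v'))\<rparr>)"

definition hfib_pr :: "('o \<times> 'n, ('o \<times> 'n) \<times> 'm \<times> ('o \<times> 'n), 'o, 'm) gfun" where
  "hfib_pr = \<lparr>on_ob = fst, on_ar = (\<lambda>(u, \<xi>, v). \<xi>)\<rparr>"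


section \<open>The monads $\mathsf{M}^{\mathrm r}$ and $\mathsf{S}^{\mathrm r}$\<close>

datatype monad_kind = Mr | Sr

type_synonym 'm parr = "(nat \<Rightarrow> nat) \<times> 'm list"

text \<open>
  An arrow \<open>(a\<^sub>0, \<dots>, a\<^sub>n\<^sub>-\<^sub>1) \<rightarrow> (b\<^sub>0, \<dots>, b\<^sub>n\<^sub>-\<^sub>1)\<close> is a pair \<open>(\<sigma>, fs)\<close> with
  \<open>fs ! i : a ! \<sigma> i \<rightarrow> b ! i\<close>, i.e. the symmetry
  \<open>(a\<^sub>0, \<dots>, a\<^sub>n\<^sub>-\<^sub>1) \<rightarrow> (a (\<sigma> 0), \<dots>, a (\<sigma> (n-1)))\<close> followed by a componentwise arrow.
  For $\mathsf{M}^{\mathrm r}$ only \<open>\<sigma> = id\<close> is allowed, so that the inclusion of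
  $\mathsf{M}^{\mathrm r}$ into $\mathsf{S}^{\mathrm r}$ is the identity on underlying data;
  likewise \<open>mapP\<close>, \<open>etaP\<close> and \<open>muP\<close> are given by the same formulas for both monads.
\<close>

definition grpdP :: "monad_kind \<Rightarrow> ('o, 'm) grpd \<Rightarrow> ('o list, 'm parr) grpd" where
  "grpdP k G =
    \<lparr>Ob = {xs. xs \<noteq> [] \<and> set xs \<subseteq> Ob G},
     Ar = {(\<sigma>, fs). fs \<noteq> [] \<and> set fs \<subseteq> Ar G \<and> \<sigma> permutes {..<length fs} \<and> (k = Mr \<longrightarrow> \<sigma> = id)},
     gdom = (\<lambda>(\<sigma>, fs). map (\<lambda>j. gdom G (fs ! inv \<sigma> j)) [0..<length fs]),
     gcod = (\<lambda>(\<sigma>, fs). map (gcod G) fs),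
     gid = (\<lambda>xs. (id, map (gid G) xs)),
     gcomp = (\<lambda>(\<tau>, gs) (\<sigma>, fs).
               (\<sigma> \<circ> \<tau>, map (\<lambda>i. gcomp G (gs ! i) (fs ! \<tau> i)) [0..<length gs]))\<rparr>"

definition mapP :: "('o, 'm, 'p, 'n) gfun \<Rightarrow> ('o list, 'm parr, 'p list, 'n parr) gfun" where
  "mapP F = \<lparr>on_ob = map (on_ob F), on_ar = (\<lambda>(\<sigma>, fs). (\<sigma>, map (on_ar F) fs))\<rparr>"

definition etaP :: "('o, 'm, 'o list, 'm parr) gfun" where
  "etaP = \<lparr>on_ob = (\<lambda>x. [x]), on_ar = (\<lambda>f. (id, [f]))\<rparr>"

text \<open>
  In \<open>(\<tau>, [(\<sigma>\<^sub>0, fs\<^sub>0), \<dots>])\<close>, block \<open>i\<close> of the target comes from block \<open>\<tau> i\<close> of the source, so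
  position \<open>j\<close> of target block \<open>i\<close> comes from position \<open>\<sigma>\<^sub>i j\<close> of source block \<open>\<tau> i\<close>.  The list
  \<open>src_positions\<close> enumerates these positions in the concatenated source tuple.
\<close>

definition src_positions :: "'m parr parr \<Rightarrow> nat list" where
  "src_positions = (\<lambda>(\<tau>, ms).
     let source_length = (\<lambda>l. length (snd (ms ! inv \<tau> l)))
     in concat (map (\<lambda>i. map (\<lambda>j. (\<Sum>l<\<tau> i. source_length l) + fst (ms ! i) j)
                           [0..<length (snd (ms ! i))])
                  [0..<length ms]))"

definition mu_ar :: "'m parr parr \<Rightarrow> 'm parr" where
  "mu_ar m = (\<lambda>p. if p < length (src_positions m) then src_positions m ! p else p,
              concat (map snd (snd m)))"

definition muP :: "('o list list, 'm parr parr, 'o list, 'm parr) gfun" where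
  "muP = \<lparr>on_ob = concat, on_ar = mu_ar\<rparr>"

text \<open>The functor $A \times \mathsf{P}1 \to \mathsf{P}A$ repeating a colour.\<close>

definition constP ::
  "('o \<times> unit list, 'm \<times> unit parr, 'o list, 'm parr) gfun" where
  "constP =
    \<lparr>on_ob = (\<lambda>(c, us). map (\<lambda>_. c) us),
     on_ar = (\<lambda>(\<gamma>, (\<sigma>, us)). (\<sigma>, map (\<lambda>_. \<gamma>) us))\<rparr>"


section \<open>Operads\<close>

text \<open>
  Data of a $\mathsf{P}$-operad.  The domain of \<open>opcomp\<close> is the pullback
  \<open>pullback (grpdP k (ops Q)) (ops Q) (mapP (opoutput Q)) (opinputs Q)\<close>, whose second component
  is the root operation; the values of \<open>opcomp\<close> outside it are irrelevant.
\<close>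

record ('c, 'cm, 'q, 'qm) operad =
  colours :: "('c, 'cm) grpd"
  ops :: "('q, 'qm) grpd"
  opinputs :: "('q, 'qm, 'c list, 'cm parr) gfun"
  opoutput :: "('q, 'qm, 'c, 'cm) gfun"
  opcomp :: "('q list \<times> 'q, 'qm parr \<times> 'qm, 'q, 'qm) gfun"
  opunit :: "('c, 'cm, 'q, 'qm) gfun"

definition Sym :: "(unit, unit, unit list, unit parr) operad" where
  "Sym =
    \<lparr>colours = terminal_grpd,
     ops = grpdP Sr terminal_grpd,
     opinputs = idF,
     opoutput = bangF,
     opcomp = muP \<odot> pr1,
     opunit = etaP\<rparr>"


section \<open>The $\mathcal{T}$-construction\<close>

text \<open>
  Data of a category internal to groupoids.  \<open>ccomp\<close> is defined on pairs \<open>(y, x)\<close> with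
  \<open>csource y = ctarget x\<close> and yields \<open>y\<close> after \<open>x\<close>.
\<close>

record ('c, 'cm, 'a, 'am) icat =
  cobj :: "('c, 'cm) grpd"
  carr :: "('a, 'am) grpd"
  csource :: "('a, 'am, 'c, 'cm) gfun"
  ctarget :: "('a, 'am, 'c, 'cm) gfun"
  cident :: "('c, 'cm, 'a, 'am) gfun"
  ccomp :: "('a \<times> 'a, 'am \<times> 'am, 'a, 'am) gfun"

text \<open>
  $\mathcal{T}^{\mathsf{P}'}(Q)$.  An arrow is \<open>(y, (c, us))\<close> with \<open>y\<close> an operation whose tuple of
  inputs is \<open>c\<close> repeated \<open>length us\<close> times.
\<close>

definition T_cat ::
  "monad_kind \<Rightarrow> ('c, 'cm, 'q, 'qm) operad
    \<Rightarrow> ('c, 'cm, 'q \<times> 'c \<times> unit list, 'qm \<times> 'cm \<times> unit parr) icat" where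
  "T_cat k Q =
    \<lparr>cobj = colours Q,
     carr = pullback (ops Q) (prod_grpd (colours Q) (grpdP k terminal_grpd)) (opinputs Q) constP,
     csource = pr1 \<odot> pr2,
     ctarget = opoutput Q \<odot> pr1,
     cident =
       \<lparr>on_ob = (\<lambda>c. (on_ob (opunit Q) c, (c, [()]))),
        on_ar = (\<lambda>\<gamma>. (on_ar (opunit Q) \<gamma>, (\<gamma>, (id, [()]))))\<rparr>,
     ccomp =
       \<lparr>on_ob = (\<lambda>((y, (d, vs)), (x, (c, us))).
          (on_ob (opcomp Q) (map (\<lambda>_. x) vs, y),
           (c, concat (map (\<lambda>_. us) vs)))),
        on_ar = (\<lambda>((\<psi>, (\<delta>, (\<pi>, vs))), (\<phi>, (\<gamma>, s))).
          (on_ar (opcomp Q) ((\<pi>, map (\<lambda>_. \<phi>) vs), \<psi>),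
           (\<gamma>, mu_ar (\<pi>, map (\<lambda>_. s) vs))))\<rparr>\<rparr>"

text \<open>
  $\mathcal{T}_{\mathsf{P}}(C)$.  An operation is \<open>(fs, (c, us))\<close> with \<open>fs\<close> a tuple of arrows all
  of whose targets are \<open>c\<close>.  Its composite with operations \<open>(gs\<^sub>i, \<dots>)\<close> is the concatenation of
  the tuples \<open>[fs ! i \<circ> g. g \<leftarrow> gs\<^sub>i]\<close>.
\<close>

definition T_operad ::
  "monad_kind \<Rightarrow> ('c, 'cm, 'a, 'am) icat
    \<Rightarrow> ('c, 'cm, 'a list \<times> 'c \<times> unit list, 'am parr \<times> 'cm \<times> unit parr) operad" where
  "T_operad k C =
    \<lparr>colours = cobj C,
     ops = pullback (grpdP k (carr C)) (prod_grpd (cobj C) (grpdP k terminal_grpd))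
             (mapP (ctarget C)) constP,
     opinputs = mapP (csource C) \<odot> pr1,
     opoutput = pr1 \<odot> pr2,
     opcomp =
       \<lparr>on_ob = (\<lambda>(bs, (fs, (d, us))).
          (concat (map (\<lambda>(f, (gs, _)). map (\<lambda>g. on_ob (ccomp C) (f, g)) gs) (zip fs bs)),
           (d, concat (map (\<lambda>(gs, (c, vs)). vs) bs)))),
        on_ar = (\<lambda>((\<tau>, bs), ((\<tau>', fs), (\<delta>, us))).
          (mu_ar (\<tau>, map (\<lambda>(f, ((\<sigma>, gs), _)). (\<sigma>, map (\<lambda>g. on_ar (ccomp C) (f, g)) gs)) (zip fs bs)),
           (\<delta>, mu_ar (\<tau>, map (\<lambda>(gs, (\<gamma>, s)). s) bs))))\<rparr>,
     opunit =
       \<lparr>on_ob = (\<lambda>c. ([on_ob (cident C) c], (c, [()]))),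
        on_ar = (\<lambda>\<gamma>. ((id, [on_ar (cident C) \<gamma>]), (\<gamma>, (id, [()]))))\<rparr>\<rparr>"

definition T_op ::
  "monad_kind \<Rightarrow> monad_kind \<Rightarrow> ('c, 'cm, 'q, 'qm) operad
    \<Rightarrow> ('c, 'cm, ('q \<times> 'c \<times> unit list) list \<times> 'c \<times> unit list,
         ('qm \<times> 'cm \<times> unit parr) parr \<times> 'cm \<times> unit parr) operad" where
  "T_op k k' Q = T_operad k (T_cat k' Q)"


section \<open>The two-sided bar construction\<close>

text \<open>
  All groupoids $Q_n$ are realised inside one type of trees: \<open>Col\<close> for $Q_0$, \<open>Op\<close> for $Q_1$, and
  \<open>Graft ts q\<close> for the element \<open>(ts, q)\<close> of $\mathsf{P}Q_{n-1}\times_{\mathsf{P}Q_0}Q_1$, \<open>n \<ge> 2\<close>.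
\<close>

datatype ('c, 'q) tree =
  Col (uncol: 'c) | Op (unop: 'q) | Graft (kids: "('c, 'q) tree list") (root: 'q)

datatype ('cm, 'qm) tree_ar =
  ColA (uncolA: 'cm) | OpA (unopA: 'qm) | GraftA (kidsA: "('cm, 'qm) tree_ar parr") (rootA: 'qm)

definition colF where "colF = \<lparr>on_ob = Col, on_ar = ColA\<rparr>"
definition uncolF where "uncolF = \<lparr>on_ob = uncol, on_ar = uncolA\<rparr>"
definition opF where "opF = \<lparr>on_ob = Op, on_ar = OpA\<rparr>"
definition unopF where "unopF = \<lparr>on_ob = unop, on_ar = unopA\<rparr>"
definition graftF where
  "graftF = \<lparr>on_ob = (\<lambda>(ts, q). Graft ts q), on_ar = (\<lambda>(ms, q). GraftA ms q)\<rparr>"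
definition ungraftF where
  "ungraftF = \<lparr>on_ob = (\<lambda>t. (kids t, root t)), on_ar = (\<lambda>m. (kidsA m, rootA m))\<rparr>"

primrec out_ob :: "('c, 'cm, 'q, 'qm) operad \<Rightarrow> ('c, 'q) tree \<Rightarrow> 'c" where
  "out_ob Q (Col c) = c"
| "out_ob Q (Op q) = on_ob (opoutput Q) q"
| "out_ob Q (Graft ts q) = on_ob (opoutput Q) q"

primrec out_ar :: "('c, 'cm, 'q, 'qm) operad \<Rightarrow> ('cm, 'qm) tree_ar \<Rightarrow> 'cm" where
  "out_ar Q (ColA \<gamma>) = \<gamma>"
| "out_ar Q (OpA \<phi>) = on_ar (opoutput Q) \<phi>"
| "out_ar Q (GraftA ms \<phi>) = on_ar (opoutput Q) \<phi>"

definition outF ::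
  "('c, 'cm, 'q, 'qm) operad \<Rightarrow> (('c, 'q) tree, ('cm, 'qm) tree_ar, 'c, 'cm) gfun" where
  "outF Q = \<lparr>on_ob = out_ob Q, on_ar = out_ar Q\<rparr>"

fun level ::
  "monad_kind \<Rightarrow> ('c, 'cm, 'q, 'qm) operad \<Rightarrow> nat \<Rightarrow> (('c, 'q) tree, ('cm, 'qm) tree_ar) grpd" where
  "level k Q 0 = relabel colF uncolF (colours Q)"
| "level k Q (Suc 0) = relabel opF unopF (ops Q)"
| "level k Q (Suc (Suc n)) =
     relabel graftF ungraftF
       (pullback (grpdP k (level k Q (Suc n))) (ops Q) (mapP (outF Q)) (opinputs Q))"

text \<open>
  \<open>tree_face Q n i : Q\<^sub>n \<rightarrow> Q\<^sub>n\<^sub>-\<^sub>1\<close> for \<open>i < n\<close>: discard the leaf level (\<open>i = 0\<close>), or compose two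
  adjacent levels; for \<open>i = n - 1\<close> these are the root level and the one above it.
\<close>

fun tree_face ::
  "('c, 'cm, 'q, 'qm) operad \<Rightarrow> nat \<Rightarrow> nat
    \<Rightarrow> (('c, 'q) tree, ('cm, 'qm) tree_ar, ('c, 'q) tree, ('cm, 'qm) tree_ar) gfun" where
  "tree_face Q 0 i = idF"
| "tree_face Q (Suc 0) i = colF \<odot> opoutput Q \<odot> unopF"
| "tree_face Q (Suc (Suc 0)) i =
     (if i = 0 then opF \<odot> pr2 \<odot> ungraftF
      else opF \<odot> opcomp Q \<odot> pairF (mapP unopF \<odot> pr1) pr2 \<odot> ungraftF)"
| "tree_face Q (Suc (Suc (Suc n))) i =
     (if i = Suc (Suc n) then
        graftF \<odot> pairF (muP \<odot> mapP (pr1 \<odot> ungraftF) \<odot> pr1)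
                       (opcomp Q \<odot> pairF (mapP (pr2 \<odot> ungraftF) \<odot> pr1) pr2) \<odot> ungraftF
      else graftF \<odot> pairF (mapP (tree_face Q (Suc (Suc n)) i) \<odot> pr1) pr2 \<odot> ungraftF)"

text \<open>\<open>tree_degen Q n i : Q\<^sub>n \<rightarrow> Q\<^sub>n\<^sub>+\<^sub>1\<close> for \<open>i \<le> n\<close>; the units go below the root for \<open>i = n\<close>.\<close>

fun tree_degen ::
  "('c, 'cm, 'q, 'qm) operad \<Rightarrow> nat \<Rightarrow> nat
    \<Rightarrow> (('c, 'q) tree, ('cm, 'qm) tree_ar, ('c, 'q) tree, ('cm, 'qm) tree_ar) gfun" where
  "tree_degen Q 0 i = opF \<odot> opunit Q \<odot> uncolF"
| "tree_degen Q (Suc 0) i =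
     (if i = Suc 0 then graftF \<odot> pairF etaP (opunit Q \<odot> outF Q)
      else graftF \<odot> pairF (mapP (opF \<odot> opunit Q) \<odot> opinputs Q) idF \<odot> unopF)"
| "tree_degen Q (Suc (Suc n)) i =
     (if i = Suc (Suc n) then graftF \<odot> pairF etaP (opunit Q \<odot> outF Q)
      else graftF \<odot> pairF (mapP (tree_degen Q (Suc n) i) \<odot> pr1) pr2 \<odot> ungraftF)"

record ('o, 'm) sgrpd =
  lev :: "nat \<Rightarrow> ('o, 'm) grpd"
  face :: "nat \<Rightarrow> nat \<Rightarrow> ('o, 'm, 'o, 'm) gfun"
  degen :: "nat \<Rightarrow> nat \<Rightarrow> ('o, 'm, 'o, 'm) gfun"

text \<open>
  $\mathcal{B}^{\mathsf{R}}Q$ for a $\mathsf{P}$-operad \<open>Q\<close>, where \<open>k\<close> stands for $\mathsf{P}$ and \<open>r\<close> for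
  $\mathsf{R}$; to be used for \<open>k = r\<close> or \<open>k = Mr\<close>, \<open>r = Sr\<close>.
\<close>

definition bar ::
  "monad_kind \<Rightarrow> monad_kind \<Rightarrow> ('c, 'cm, 'q, 'qm) operad
    \<Rightarrow> (('c, 'q) tree list, ('cm, 'qm) tree_ar parr) sgrpd" where
  "bar r k Q =
    \<lparr>lev = (\<lambda>n. grpdP r (level k Q n)),
     face = (\<lambda>n i.
       if i < n then mapP (tree_face Q n i)
       else if n = Suc 0 then muP \<odot> mapP (mapP colF \<odot> opinputs Q \<odot> unopF)
       else muP \<odot> mapP (pr1 \<odot> ungraftF)),
     degen = (\<lambda>n i. mapP (tree_degen Q n i))\<rparr>"


section \<open>Bialgebras with a chosen basis\<close>

text \<open>
  The underlying vector space is the set of finite rational linear combinations of \<open>basis\<close>; its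
  tensor square has the pairs of basis elements as a basis.
\<close>

record 'b bialg =
  basis :: "'b set"
  mult :: "('b \<Rightarrow>\<^sub>0 rat) \<Rightarrow> ('b \<Rightarrow>\<^sub>0 rat) \<Rightarrow> ('b \<Rightarrow>\<^sub>0 rat)"
  unit_el :: "'b \<Rightarrow>\<^sub>0 rat"
  comult :: "('b \<Rightarrow>\<^sub>0 rat) \<Rightarrow> ('b \<times> 'b \<Rightarrow>\<^sub>0 rat)"
  counit :: "('b \<Rightarrow>\<^sub>0 rat) \<Rightarrow> rat"

definition carrier :: "'b bialg \<Rightarrow> ('b \<Rightarrow>\<^sub>0 rat) set" where
  "carrier B = {v. Poly_Mapping.keys v \<subseteq> basis B}"

definition smul :: "rat \<Rightarrow> ('b \<Rightarrow>\<^sub>0 rat) \<Rightarrow> ('b \<Rightarrow>\<^sub>0 rat)" where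
  "smul c v = Poly_Mapping.map ((*) c) v"

definition lin_ext :: "('b \<Rightarrow> ('d \<Rightarrow>\<^sub>0 rat)) \<Rightarrow> ('b \<Rightarrow>\<^sub>0 rat) \<Rightarrow> ('d \<Rightarrow>\<^sub>0 rat)" where
  "lin_ext h v = (\<Sum>b\<in>Poly_Mapping.keys v. smul (Poly_Mapping.lookup v b) (h b))"

definition tensor :: "('b \<Rightarrow>\<^sub>0 rat) \<Rightarrow> ('d \<Rightarrow>\<^sub>0 rat) \<Rightarrow> ('b \<times> 'd \<Rightarrow>\<^sub>0 rat)" where
  "tensor u v = (\<Sum>a\<in>Poly_Mapping.keys u. \<Sum>b\<in>Poly_Mapping.keys v.
     Poly_Mapping.single (a, b) (Poly_Mapping.lookup u a * Poly_Mapping.lookup v b))"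

definition tensor_map ::
  "(('b \<Rightarrow>\<^sub>0 rat) \<Rightarrow> ('d \<Rightarrow>\<^sub>0 rat)) \<Rightarrow> ('b \<times> 'b \<Rightarrow>\<^sub>0 rat) \<Rightarrow> ('d \<times> 'd \<Rightarrow>\<^sub>0 rat)" where
  "tensor_map \<phi> =
     lin_ext (\<lambda>(a, b). tensor (\<phi> (Poly_Mapping.single a 1)) (\<phi> (Poly_Mapping.single b 1)))"

definition bialg_iso ::
  "'b bialg \<Rightarrow> 'd bialg \<Rightarrow> (('b \<Rightarrow>\<^sub>0 rat) \<Rightarrow> ('d \<Rightarrow>\<^sub>0 rat)) \<Rightarrow> bool" where
  "bialg_iso A B \<phi> \<longleftrightarrow>
     bij_betw \<phi> (carrier A) (carrier B) \<and>
     (\<forall>u\<in>carrier A. \<forall>v\<in>carrier A. \<phi> (u + v) = \<phi> u + \<phi> v) \<and>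
     (\<forall>c. \<forall>v\<in>carrier A. \<phi> (smul c v) = smul c (\<phi> v)) \<and>
     (\<forall>u\<in>carrier A. \<forall>v\<in>carrier A. \<phi> (mult A u v) = mult B (\<phi> u) (\<phi> v)) \<and>
     \<phi> (unit_el A) = unit_el B \<and>
     (\<forall>v\<in>carrier A. comult B (\<phi> v) = tensor_map \<phi> (comult A v)) \<and>
     (\<forall>v\<in>carrier A. counit B (\<phi> v) = counit A v)"


section \<open>The incidence bialgebra\<close>

definition comult_fibre where
  "comult_fibre X f a b =
     hfib (hfib (lev X 2) (lev X 1) (face X 2 1) f)
          (prod_grpd (lev X 1) (lev X 1))
          (pairF (face X 2 2) (face X 2 0) \<odot> hfib_pr)
          (a, b)"

definition counit_fibre where
  "counit_fibre X f = hfib (lev X 0) (lev X 1) (degen X 0 0) f"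

definition comult_coeff :: "('o, 'm) sgrpd \<Rightarrow> 'o set \<Rightarrow> 'o set \<Rightarrow> 'o set \<Rightarrow> rat" where
  "comult_coeff X C A B =
     hcard (comult_fibre X (rep C) (rep A) (rep B)) /
       (of_nat (card (aut (lev X 1) (rep A))) * of_nat (card (aut (lev X 1) (rep B))))"

definition comult_support :: "('o, 'm) sgrpd \<Rightarrow> 'o set \<Rightarrow> ('o set \<times> 'o set) set" where
  "comult_support X C =
     {(A, B). A \<in> pi0 (lev X 1) \<and> B \<in> pi0 (lev X 1) \<and> comult_coeff X C A B \<noteq> 0}"

text \<open>
  The conditions under which all the cardinalities and sums defining the incidence bialgebra are
  finite.
\<close>

definition locally_finite :: "('o, 'm) sgrpd \<Rightarrow> bool" where
  "locally_finite X \<longleftrightarrow>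
     (\<forall>f\<in>Ob (lev X 1). finite (aut (lev X 1) f) \<and> hfinite (counit_fibre X f)) \<and>
     (\<forall>f\<in>Ob (lev X 1). \<forall>a\<in>Ob (lev X 1). \<forall>b\<in>Ob (lev X 1). hfinite (comult_fibre X f a b)) \<and>
     (\<forall>C\<in>pi0 (lev X 1). finite (comult_support X C))"

text \<open>
  The basis element \<open>\<delta>\<^sub>a\<close> is \<open>Some (iso_class (lev X 1) a)\<close>; the adjoined unit is \<open>None\<close>.
  For a bar construction the objects are lists and \<open>@\<close> is juxtaposition of configurations.
\<close>

definition juxt ::
  "('o list, 'm) sgrpd \<Rightarrow> 'o list set option \<Rightarrow> 'o list set option \<Rightarrow> 'o list set option" where
  "juxt X p q =
     (case p of None \<Rightarrow> q
      | Some A \<Rightarrow> (case q of None \<Rightarrow> Some A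
                   | Some B \<Rightarrow> Some (iso_class (lev X 1) (rep A @ rep B))))"

definition incidence_bialgebra :: "('o list, 'm) sgrpd \<Rightarrow> 'o list set option bialg" where
  "incidence_bialgebra X =
    \<lparr>basis = insert None (Some ` pi0 (lev X 1)),
     mult = (\<lambda>u v. lin_ext (\<lambda>p. lin_ext (\<lambda>q. Poly_Mapping.single (juxt X p q) 1) v) u),
     unit_el = Poly_Mapping.single None 1,
     comult = lin_ext (\<lambda>p. case p of
         None \<Rightarrow> Poly_Mapping.single (None, None) 1
       | Some C \<Rightarrow> (\<Sum>(A, B)\<in>comult_support X C.
                      Poly_Mapping.single (Some A, Some B) (comult_coeff X C A B))),
     counit = (\<lambda>v. \<Sum>p\<in>Poly_Mapping.keys v. Poly_Mapping.lookup v p *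
         (case p of None \<Rightarrow> 1 | Some C \<Rightarrow> hcard (counit_fibre X (rep C))))\<rparr>"


section \<open>The plethystic bialgebra with noncommuting variables\<close>

definition words :: "nat list set" where
  "words = {w. w \<noteq> [] \<and> 0 \<notin> set w}"

definition word_fact :: "nat list \<Rightarrow> rat" where
  "word_fact w = prod_list (map fact w)"

text \<open>
  A power series in noncommuting variables is represented by the function giving the coefficient
  of each monomial $\mathbf{x}_\omega$.  These are the plain coefficients, not the
  $F_\omega = \omega!\cdot[\mathbf{x}_\omega]F$, which is \<open>coord \<omega> F\<close>.
\<close>

type_synonym series = "nat list \<Rightarrow> rat"

definition series_plus :: "series set" where
  "series_plus = {F. \<forall>w. w \<notin> words \<longrightarrow> F w = 0}"

definition coord :: "nat list \<Rightarrow> series \<Rightarrow> rat" where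
  "coord w F = word_fact w * F w"

definition series_mult :: "series \<Rightarrow> series \<Rightarrow> series" where
  "series_mult F G = (\<lambda>w. \<Sum>i\<le>length w. F (take i w) * G (drop i w))"

definition series_one :: series where
  "series_one = (\<lambda>w. if w = [] then 1 else 0)"

definition series_var :: "nat \<Rightarrow> series" where
  "series_var i = (\<lambda>w. if w = [i] then 1 else 0)"

definition series_prod :: "series list \<Rightarrow> series" where
  "series_prod Fs = foldr series_mult Fs series_one"

text \<open>$F_k(x_1,x_2,\dots) = F(x_k,x_{2k},\dots)$\<close>

definition dilate :: "nat \<Rightarrow> series \<Rightarrow> series" where
  "dilate k F = (\<lambda>w. if \<forall>i\<in>set w. k dvd i then F (map (\<lambda>i. i div k) w) else 0)"

text \<open>
  \<open>(G \<circledast> F)(x\<^sub>1, x\<^sub>2, \<dots>) = G(F\<^sub>1, F\<^sub>2, \<dots>)\<close>.  For series without constant term only finitely many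
  words contribute to a given coefficient.
\<close>

definition plethysm :: "series \<Rightarrow> series \<Rightarrow> series" (infixl \<open>\<circledast>\<close> 70) where
  "G \<circledast> F = (\<lambda>w. \<Sum>\<eta>\<in>{\<eta>\<in>words. series_prod (map (\<lambda>k. dilate k F) \<eta>) w \<noteq> 0}.
     G \<eta> * series_prod (map (\<lambda>k. dilate k F) \<eta>) w)"

text \<open>
  Monomials in the indeterminates \<open>A\<^sub>\<omega>\<close> are finitely supported exponent functions; polynomials in
  two independent families of indeterminates represent the tensor square.
\<close>

type_synonym mono = "nat list \<Rightarrow>\<^sub>0 nat"

definition monomials :: "mono set" where
  "monomials = {m. Poly_Mapping.keys m \<subseteq> words}"

definition eval_mono :: "mono \<Rightarrow> series \<Rightarrow> rat" where
  "eval_mono m F = (\<Prod>w\<in>Poly_Mapping.keys m. coord w F ^ Poly_Mapping.lookup m w)"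

definition eval_poly :: "(mono \<Rightarrow>\<^sub>0 rat) \<Rightarrow> series \<Rightarrow> rat" where
  "eval_poly p F = (\<Sum>m\<in>Poly_Mapping.keys p. Poly_Mapping.lookup p m * eval_mono m F)"

definition eval_poly2 :: "(mono \<times> mono \<Rightarrow>\<^sub>0 rat) \<Rightarrow> series \<Rightarrow> series \<Rightarrow> rat" where
  "eval_poly2 p F G =
     (\<Sum>(m, n)\<in>Poly_Mapping.keys p. Poly_Mapping.lookup p (m, n) * eval_mono m F * eval_mono n G)"

definition pleth_comult_gen :: "nat list \<Rightarrow> (mono \<times> mono \<Rightarrow>\<^sub>0 rat)" where
  "pleth_comult_gen w =
     (THE p. Poly_Mapping.keys p \<subseteq> monomials \<times> monomials \<and>
        (\<forall>F\<in>series_plus. \<forall>G\<in>series_plus. eval_poly2 p F G = coord w (G \<circledast> F)))"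

text \<open>
  \<open>*\<close> and \<open>1\<close> are those of the (convolution) polynomial ring structure on \<open>\<Rightarrow>\<^sub>0\<close>.  Since
  $\epsilon(A_\omega) = A_\omega(x_1)$, the algebra homomorphism $\epsilon$ is evaluation at $x_1$.
\<close>

definition plethystic_bialgebra :: "mono bialg" where
  "plethystic_bialgebra =
    \<lparr>basis = monomials,
     mult = (*),
     unit_el = 1,
     comult = lin_ext (\<lambda>m. \<Prod>w\<in>Poly_Mapping.keys m. pleth_comult_gen w ^ Poly_Mapping.lookup m w),
     counit = (\<lambda>p. eval_poly p (series_var 1))\<rparr>"

end

theory Submission
  imports Defs
begin

text \<open>
  The operations of \<open>T_op Mr Sr Sym\<close> form a groupoid whose components are the words
  \<open>\<omega>\<close> in positive integers, with automorphism group
  \<open>S(\<omega>\<^sub>1) \<times> S(\<omega>\<^sub>2) \<times> \<dots>\<close>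
  of order \<open>\<omega>!\<close>.  Hence configurations of operations are, up to isomorphism, multisets of words,
  i.e. monomials in the \<open>A\<^sub>\<omega>\<close>.  A two-level tree is a word \<open>\<eta>\<close> at the root with a word
  \<open>\<xi>\<^sub>i\<close> grafted onto each letter \<open>\<eta>\<^sub>i\<close>, and it composes to the concatenation of the words
  \<open>\<eta>\<^sub>i\<xi>\<^sub>i\<close>; this is exactly how \<open>\<omega>\<close> arises in \<open>G(F\<^sub>1, F\<^sub>2, \<dots>)\<close>.
  The homotopy cardinality of the trees over \<open>\<omega>\<close> of a given shape is
  \<open>\<omega>! / (\<eta>! \<xi>\<^sub>1! \<xi>\<^sub>2! \<dots>)\<close>, which is the coefficient of plethystic substitution in
  the normalised coordinates.

  All groupoids involved, homotopy fibres included, are finite on the nose, so a homotopy cardinality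
  is the sum over all objects \<open>x\<close> of \<open>1 / d\<close>, where \<open>d\<close> is the number of arrows with target \<open>x\<close>.
\<close>

section \<open>Groupoids and functors\<close>

text \<open>Counting arrows by their target, not automorphisms, avoids choosing representatives in
  the components of a homotopy fibre: projecting a fibre to its source preserves this number, and it
  is multiplicative for the tuples and pullbacks that occur. Below the outermost \<open>Sr\<close>,
  tuples of operations are ordered and every arrow is an automorphism. A homotopy fibre over a
  configuration thus reduces to a strict fibre, with one tree chosen over each word. The same
  choices appear when a product of polynomials \<Delta>(A_\<omega>) is expanded. Each such
  polynomial is given by a definite description over power series, so its uniqueness must be proved;
  this rests on the independence of characters. The counting formulas also require the faces to be
  functors, so operadic composition is rewritten as a composite of elementary functors. The inputs
  of an operation form an ordered tuple of one colour; such tuples have only identity arrows, so in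
  pullbacks over them the compatibility of arrows comes for free.\<close>

locale groupoid =
  fixes G :: "('o, 'm) grpd"
  assumes dom_ob: "f \<in> Ar G \<Longrightarrow> gdom G f \<in> Ob G"
    and cod_ob: "f \<in> Ar G \<Longrightarrow> gcod G f \<in> Ob G"
    and id_hom: "x \<in> Ob G \<Longrightarrow> gid G x \<in> hom G x x"
    and comp_hom: "f \<in> hom G x y \<Longrightarrow> g \<in> hom G y z \<Longrightarrow> gcomp G g f \<in> hom G x z"
    and comp_id_right: "f \<in> hom G x y \<Longrightarrow> gcomp G f (gid G x) = f"
    and comp_id_left: "f \<in> hom G x y \<Longrightarrow> gcomp G (gid G y) f = f"
    and comp_assoc: "f \<in> hom G x y \<Longrightarrow> g \<in> hom G y z \<Longrightarrow> h \<in> hom G z w \<Longrightarrow>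
      gcomp G h (gcomp G g f) = gcomp G (gcomp G h g) f"
    and ex_inverse: "f \<in> hom G x y \<Longrightarrow>
      \<exists>g\<in>hom G y x. gcomp G g f = gid G x \<and> gcomp G f g = gid G y"
begin

lemma hom_ob: "f \<in> hom G x y \<Longrightarrow> x \<in> Ob G \<and> y \<in> Ob G"
  using dom_ob cod_ob by (auto simp: hom_def)

lemma comp_cancel_left:
  assumes "f \<in> hom G x y" "f' \<in> hom G x y" "g \<in> hom G y z" "gcomp G g f = gcomp G g f'"
  shows "f = f'"
proof -
  obtain h where h: "h \<in> hom G z y" "gcomp G h g = gid G y"
    using ex_inverse[OF assms(3)] by blast
  then show ?thesis
    using comp_assoc[OF assms(1,3) h(1)] comp_assoc[OF assms(2,3) h(1)] assms(4)
      comp_id_left[OF assms(1)] comp_id_left[OF assms(2)] by metis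
qed

lemma comp_cancel_right:
  assumes "g \<in> hom G y z" "g' \<in> hom G y z" "f \<in> hom G x y" "gcomp G g f = gcomp G g' f"
  shows "g = g'"
proof -
  obtain h where h: "h \<in> hom G y x" "gcomp G f h = gid G y"
    using ex_inverse[OF assms(3)] by blast
  then show ?thesis
    using comp_assoc[OF h(1) assms(3,1)] comp_assoc[OF h(1) assms(3,2)] assms(4)
      comp_id_right[OF assms(1)] comp_id_right[OF assms(2)] by metis
qed

text \<open>Supplies preservation of identities for functors: a map that respects composition sends
  an identity to an idempotent.\<close>

lemma idempotent_id:
  assumes "f \<in> hom G x x" "gcomp G f f = f"
  shows "f = gid G x"
  using comp_cancel_left[OF assms(1) id_hom assms(1)] assms comp_id_right[OF assms(1)] hom_ob
  by metis

text \<open>Composition with a fixed arrow \<open>x \<rightarrow> y\<close> is a bijection.\<close>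

lemma card_hom_aut:
  assumes "h \<in> hom G x y"
  shows "card (hom G x y) = card (aut G y)" "card (hom G x y) = card (aut G x)"
    and "finite (hom G x y) = finite (aut G y)"
proof -
  obtain k where k: "k \<in> hom G y x" "gcomp G k h = gid G x" "gcomp G h k = gid G y"
    using ex_inverse[OF assms] by blast
  have 1: "bij_betw (\<lambda>g. gcomp G g h) (hom G y y) (hom G x y)"
  proof (rule bij_betw_imageI)
    show "inj_on (\<lambda>g. gcomp G g h) (hom G y y)"
      using comp_cancel_right[OF _ _ assms] by (auto simp: inj_on_def)
    have "f \<in> (\<lambda>g. gcomp G g h) ` hom G y y" if f: "f \<in> hom G x y" for f
      using comp_assoc[OF assms k(1) f] k comp_id_right[OF f] comp_hom[OF k(1) f] by force
    then show "(\<lambda>g. gcomp G g h) ` hom G y y = hom G x y"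
      using comp_hom[OF assms] by blast
  qed
  have 2: "bij_betw (\<lambda>g. gcomp G h g) (hom G x x) (hom G x y)"
  proof (rule bij_betw_imageI)
    show "inj_on (\<lambda>g. gcomp G h g) (hom G x x)"
      using comp_cancel_left[OF _ _ assms] by (auto simp: inj_on_def)
    have "f \<in> (\<lambda>g. gcomp G h g) ` hom G x x" if f: "f \<in> hom G x y" for f
      using comp_assoc[OF f k(1) assms] k comp_id_left[OF f] comp_hom[OF f k(1)] by force
    then show "(\<lambda>g. gcomp G h g) ` hom G x x = hom G x y"
      using comp_hom[OF _ assms] by blast
  qed
  show "card (hom G x y) = card (aut G y)" "card (hom G x y) = card (aut G x)"
    "finite (hom G x y) = finite (aut G y)"
    using bij_betw_same_card[OF 1] bij_betw_same_card[OF 2] bij_betw_finite[OF 1]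
    by (simp_all add: aut_def)
qed

lemma equiv_iso_rel: "equiv (Ob G) (iso_rel G)"
proof (rule equivI)
  show "iso_rel G \<subseteq> Ob G \<times> Ob G" by (auto simp: iso_rel_def)
  show "refl_on (Ob G) (iso_rel G)" using id_hom by (auto simp: refl_on_def iso_rel_def)
  show "sym (iso_rel G)" using ex_inverse by (fastforce simp: sym_def iso_rel_def)
  show "trans (iso_rel G)" using comp_hom by (fastforce simp: trans_def iso_rel_def)
qed

lemma rep_in: "C \<in> pi0 G \<Longrightarrow> rep C \<in> C"
  unfolding rep_def pi0_def
  using in_quotient_imp_non_empty[OF equiv_iso_rel] by (metis some_in_eq)

lemma pi0_sub: "C \<in> pi0 G \<Longrightarrow> C \<subseteq> Ob G"
  unfolding pi0_def using in_quotient_imp_subset[OF equiv_iso_rel] by auto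

lemma rep_ob: "C \<in> pi0 G \<Longrightarrow> rep C \<in> Ob G"
  using rep_in pi0_sub by blast

lemma pi0_iff:
  assumes "C \<in> pi0 G" "x \<in> C"
  shows "y \<in> C \<longleftrightarrow> hom G x y \<noteq> {}"
proof -
  have "x \<in> Ob G" using assms pi0_sub by blast
  have "y \<in> C \<longleftrightarrow> (x, y) \<in> iso_rel G"
    using assms quotient_eq_iff[OF equiv_iso_rel] in_quotient_imp_closed[OF equiv_iso_rel]
      in_quotient_imp_in_rel[OF equiv_iso_rel] unfolding pi0_def
    by (metis insert_subset empty_subsetI)
  then show ?thesis using \<open>x \<in> Ob G\<close> hom_ob by (auto simp: iso_rel_def)
qed

lemma pi0_eq_iso_class: "C \<in> pi0 G \<Longrightarrow> x \<in> C \<Longrightarrow> C = iso_class G x"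
  using pi0_iff[of C x] pi0_sub[of C] by (auto simp: iso_class_def iso_rel_def)

lemma iso_class_in_pi0: "x \<in> Ob G \<Longrightarrow> iso_class G x \<in> pi0 G"
  unfolding iso_class_def pi0_def by (rule quotientI)

lemma in_iso_class: "x \<in> Ob G \<Longrightarrow> x \<in> iso_class G x"
  unfolding iso_class_def using equiv_class_self[OF equiv_iso_rel] .

lemma hom_sym_ne: "hom G x y \<noteq> {} \<Longrightarrow> hom G y x \<noteq> {}"
  using ex_inverse by blast

end

text \<open>With all sources allowed, this is the size of the component times the order of the
  automorphism group. Positivity also records finiteness, since an infinite set has
  \<open>card\<close> zero.\<close>

definition indeg :: "('o, 'm) grpd \<Rightarrow> 'o \<Rightarrow> nat" where
  "indeg G x = card {f \<in> Ar G. gcod G f = x}"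

lemma indeg_pos_finite: "indeg G x > 0 \<Longrightarrow> finite {f \<in> Ar G. gcod G f = x}"
  unfolding indeg_def by (rule card_ge_0_finite)

lemma indeg_pos_finite_hom: "indeg G y > 0 \<Longrightarrow> finite (hom G x y)"
  by (rule finite_subset[OF _ indeg_pos_finite]) (auto simp: hom_def)

lemma (in groupoid) hfinite:
  assumes "finite (Ob G)" "\<And>x. x \<in> Ob G \<Longrightarrow> indeg G x > 0"
  shows "hfinite G"
  unfolding hfinite_def pi0_def aut_def
  using finite_quotient[OF assms(1)] equiv_type[OF equiv_iso_rel] indeg_pos_finite_hom assms(2)
  by metis

text \<open>An isomorphism class \<open>C\<close> contributes
  \<open>\<bar>C\<bar> / (\<bar>C\<bar> \<cdot> \<bar>Aut\<bar>)\<close>, since each of its objects receives \<open>\<bar>Aut\<bar>\<close> arrows from each object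
  of \<open>C\<close>.\<close>

lemma (in groupoid) hcard_eq_sum:
  assumes fin: "finite (Ob G)" and pos: "\<And>x. x \<in> Ob G \<Longrightarrow> indeg G x > 0"
  shows "hcard G = (\<Sum>x\<in>Ob G. 1 / of_nat (indeg G x))"
proof -
  have finC: "finite C" if "C \<in> pi0 G" for C using pi0_sub[OF that] fin finite_subset by blast
  have deg: "indeg G x = card C * card (aut G (rep C))" if C: "C \<in> pi0 G" "x \<in> C" for C x
  proof -
    have xO: "x \<in> Ob G" using C pi0_sub by blast
    have "{f \<in> Ar G. gcod G f = x} = (\<Union>y\<in>C. hom G y x)"
    proof (rule set_eqI)
      fix f
      have "gdom G f \<in> C" if "f \<in> Ar G" "gcod G f = x"
        using pi0_iff[OF C] hom_sym_ne[of "gdom G f" x] that by (auto simp: hom_def)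
      then show "f \<in> {f \<in> Ar G. gcod G f = x} \<longleftrightarrow> f \<in> (\<Union>y\<in>C. hom G y x)"
        by (auto simp: hom_def)
    qed
    then have "indeg G x = (\<Sum>y\<in>C. card (hom G y x))"
      unfolding indeg_def
      by (simp, subst card_UN_disjoint)
         (use finC[OF C(1)] indeg_pos_finite_hom[OF pos[OF xO]] in \<open>auto simp: hom_def\<close>)
    also have "\<dots> = (\<Sum>y\<in>C. card (aut G (rep C)))"
    proof (rule sum.cong[OF refl])
      fix y assume y: "y \<in> C"
      have "hom G y x \<noteq> {}" using pi0_iff[OF C(1) y] C by blast
      moreover have "hom G (rep C) x \<noteq> {}" using pi0_iff[OF C(1) rep_in[OF C(1)]] C by blast
      ultimately show "card (hom G y x) = card (aut G (rep C))"
        using card_hom_aut by (metis ex_in_conv)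
    qed
    finally show ?thesis by simp
  qed
  have "(\<Sum>x\<in>Ob G. 1 / of_nat (indeg G x)) = (\<Sum>C\<in>pi0 G. \<Sum>x\<in>C. 1 / of_nat (indeg G x) :: rat)"
  proof -
    have "\<Union>(pi0 G) = Ob G" unfolding pi0_def by (rule Union_quotient[OF equiv_iso_rel])
    moreover have "\<forall>A\<in>pi0 G. \<forall>B\<in>pi0 G. A \<noteq> B \<longrightarrow> A \<inter> B = {}"
      unfolding pi0_def using quotient_disj[OF equiv_iso_rel] by blast
    ultimately show ?thesis
      using sum.Union_disjoint[of "pi0 G" "\<lambda>x. 1 / of_nat (indeg G x) :: rat"] finC
      by simp
  qed
  also have "\<dots> = (\<Sum>C\<in>pi0 G. 1 / of_nat (card (aut G (rep C))))"
  proof (rule sum.cong[OF refl])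
    fix C assume C: "C \<in> pi0 G"
    have "card C \<noteq> 0" using rep_in[OF C] finC[OF C] by auto
    then show "(\<Sum>x\<in>C. 1 / of_nat (indeg G x) :: rat) = 1 / of_nat (card (aut G (rep C)))"
      using deg[OF C] by (simp add: field_simps)
  qed
  finally show ?thesis by (simp add: hcard_def)
qed

text \<open>Both groupoids are part of the predicate, so that it passes through composites as a
  single fact. Identities are preserved by cancellation, see \<open>functor_id\<close>.\<close>

definition is_functor :: "('o, 'm) grpd \<Rightarrow> ('p, 'n) grpd \<Rightarrow> ('o, 'm, 'p, 'n) gfun \<Rightarrow> bool" where
  "is_functor G H F \<longleftrightarrow> groupoid G \<and> groupoid H \<and>
     (\<forall>x\<in>Ob G. on_ob F x \<in> Ob H) \<and>
     (\<forall>x y. \<forall>f\<in>hom G x y. on_ar F f \<in> hom H (on_ob F x) (on_ob F y)) \<and>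
     (\<forall>x y z. \<forall>f\<in>hom G x y. \<forall>g\<in>hom G y z.
        on_ar F (gcomp G g f) = gcomp H (on_ar F g) (on_ar F f))"

lemma is_functorI:
  assumes "groupoid G" "groupoid H" "\<And>x. x \<in> Ob G \<Longrightarrow> on_ob F x \<in> Ob H"
    "\<And>x y f. f \<in> hom G x y \<Longrightarrow> on_ar F f \<in> hom H (on_ob F x) (on_ob F y)"
    "\<And>x y z f g. f \<in> hom G x y \<Longrightarrow> g \<in> hom G y z \<Longrightarrow>
       on_ar F (gcomp G g f) = gcomp H (on_ar F g) (on_ar F f)"
  shows "is_functor G H F"
  using assms unfolding is_functor_def by blast

lemma
  assumes "is_functor G H F"
  shows functor_dom: "groupoid G" and functor_cod: "groupoid H"
    and functor_ob: "x \<in> Ob G \<Longrightarrow> on_ob F x \<in> Ob H"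
    and functor_hom: "f \<in> hom G x y \<Longrightarrow> on_ar F f \<in> hom H (on_ob F x) (on_ob F y)"
    and functor_comp: "f \<in> hom G x y \<Longrightarrow> g \<in> hom G y z \<Longrightarrow>
       on_ar F (gcomp G g f) = gcomp H (on_ar F g) (on_ar F f)"
  using assms unfolding is_functor_def by blast+

lemma functor_id:
  assumes F: "is_functor G H F" and x: "x \<in> Ob G"
  shows "on_ar F (gid G x) = gid H (on_ob F x)"
proof -
  interpret G: groupoid G by (rule functor_dom[OF F])
  interpret H: groupoid H by (rule functor_cod[OF F])
  have i: "gid G x \<in> hom G x x" by (rule G.id_hom[OF x])
  show ?thesis
    by (rule H.idempotent_id[OF functor_hom[OF F i]])
       (use functor_comp[OF F i i] G.comp_id_left[OF i] in simp)
qed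

lemma is_functor_compF:
  assumes "is_functor G H F" "is_functor H K E"
  shows "is_functor G K (E \<odot> F)"
  using assms unfolding is_functor_def compF_def by simp metis

lemma is_functor_idF: "groupoid G \<Longrightarrow> is_functor G G idF"
  by (simp add: is_functor_def idF_def)

section \<open>Pullbacks and products of groupoids\<close>

lemma hom_pullback:
  "hom (pullback G H F K) (x, y) (x', y') =
    {(f, g). f \<in> hom G x x' \<and> g \<in> hom H y y' \<and> on_ar F f = on_ar K g}"
  by (auto simp: hom_def pullback_def)

lemma groupoid_pullback:
  assumes F: "is_functor G L F" and K: "is_functor H L K"
  shows "groupoid (pullback G H F K)"
proof -
  interpret G: groupoid G by (rule functor_dom[OF F])
  interpret H: groupoid H by (rule functor_dom[OF K])
  interpret L: groupoid L by (rule functor_cod[OF F])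
  have [simp]: "Ob (pullback G H F K) = {(x, y). x \<in> Ob G \<and> y \<in> Ob H \<and> on_ob F x = on_ob K y}"
    "gid (pullback G H F K) (x, y) = (gid G x, gid H y)"
    "gcomp (pullback G H F K) (f', g') (f, g) = (gcomp G f' f, gcomp H g' g)"
    for x y f' g' f g
    by (simp_all add: pullback_def)
  \<comment> \<open>The arrow set of a pullback asks for agreement on arrows; agreement at the end
    points comes from functoriality.\<close>
  have FK: "on_ob F x = on_ob K y \<and> on_ob F x' = on_ob K y'"
    if "f \<in> hom G x x'" "g \<in> hom H y y'" "on_ar F f = on_ar K g" for f g x y x' y'
    using functor_hom[OF F that(1)] functor_hom[OF K that(2)] that(3) by (auto simp: hom_def)
  show ?thesis
  proof
    fix f assume f: "f \<in> Ar (pullback G H F K)"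
    obtain a b where ab: "f = (a, b)" "a \<in> Ar G" "b \<in> Ar H" "on_ar F a = on_ar K b"
      using f by (auto simp: pullback_def)
    then have "on_ob F (gdom G a) = on_ob K (gdom H b) \<and> on_ob F (gcod G a) = on_ob K (gcod H b)"
      using FK[of a "gdom G a" "gcod G a" b "gdom H b" "gcod H b"] by (simp add: hom_def)
    then show "gdom (pullback G H F K) f \<in> Ob (pullback G H F K)"
      "gcod (pullback G H F K) f \<in> Ob (pullback G H F K)"
      using ab by (auto simp: pullback_def G.dom_ob H.dom_ob G.cod_ob H.cod_ob)
  next
    fix x assume "x \<in> Ob (pullback G H F K)"
    then show "gid (pullback G H F K) x \<in> hom (pullback G H F K) x x"
      by (auto simp: hom_pullback G.id_hom H.id_hom functor_id[OF F] functor_id[OF K])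
  next
    fix f g x y z
    assume "f \<in> hom (pullback G H F K) x y" "g \<in> hom (pullback G H F K) y z"
    then show "gcomp (pullback G H F K) g f \<in> hom (pullback G H F K) x z"
      by (cases x; cases y; cases z)
         (auto simp: hom_pullback functor_comp[OF F] functor_comp[OF K]
           intro: G.comp_hom H.comp_hom)
  next
    fix f x y assume f: "f \<in> hom (pullback G H F K) x y"
    then show "gcomp (pullback G H F K) f (gid (pullback G H F K) x) = f"
      "gcomp (pullback G H F K) (gid (pullback G H F K) y) f = f"
      by (cases x; cases y; auto simp: hom_pullback G.comp_id_right H.comp_id_right
           G.comp_id_left H.comp_id_left)+
    obtain a b x1 x2 y1 y2 where ab: "f = (a, b)" "x = (x1, x2)" "y = (y1, y2)"
      "a \<in> hom G x1 y1" "b \<in> hom H x2 y2" "on_ar F a = on_ar K b"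
      using f by (cases x; cases y) (auto simp: hom_pullback)
    obtain a' where a': "a' \<in> hom G y1 x1" "gcomp G a' a = gid G x1" "gcomp G a a' = gid G y1"
      using G.ex_inverse[OF ab(4)] by blast
    obtain b' where b': "b' \<in> hom H y2 x2" "gcomp H b' b = gid H x2" "gcomp H b b' = gid H y2"
      using H.ex_inverse[OF ab(5)] by blast
    note fk = FK[OF ab(4-6)]
    \<comment> \<open>The componentwise inverses must again lie in the pullback: their images both
      invert \<open>on_ar F a\<close> in L, so cancellation identifies them.\<close>
    have "on_ar F a' = on_ar K b'"
    proof (rule L.comp_cancel_right)
      show "on_ar F a' \<in> hom L (on_ob F y1) (on_ob F x1)" by (rule functor_hom[OF F a'(1)])
      show "on_ar K b' \<in> hom L (on_ob F y1) (on_ob F x1)"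
        using functor_hom[OF K b'(1)] fk by simp
      show "on_ar F a \<in> hom L (on_ob F x1) (on_ob F y1)" by (rule functor_hom[OF F ab(4)])
      show "gcomp L (on_ar F a') (on_ar F a) = gcomp L (on_ar K b') (on_ar F a)"
        using functor_comp[OF F ab(4) a'(1)] functor_comp[OF K ab(5) b'(1)] a'(2) b'(2) ab(6) fk
          functor_id[OF F, of x1] functor_id[OF K, of x2] G.hom_ob[OF ab(4)] H.hom_ob[OF ab(5)]
        by simp
    qed
    then show "\<exists>g\<in>hom (pullback G H F K) y x. gcomp (pullback G H F K) g f = gid (pullback G H F K) x \<and>
        gcomp (pullback G H F K) f g = gid (pullback G H F K) y"
      by (intro bexI[of _ "(a', b')"]) (use ab a' b' in \<open>auto simp: hom_pullback\<close>)
  next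
    fix f g h x y z w
    assume "f \<in> hom (pullback G H F K) x y" "g \<in> hom (pullback G H F K) y z"
      "h \<in> hom (pullback G H F K) z w"
    then show "gcomp (pullback G H F K) h (gcomp (pullback G H F K) g f) =
        gcomp (pullback G H F K) (gcomp (pullback G H F K) h g) f"
      by (cases x; cases y; cases z; cases w; clarsimp simp: hom_pullback)
         (metis G.comp_assoc H.comp_assoc)
  qed
qed

lemma is_functor_pr1:
  assumes "is_functor G L F" "is_functor H L K"
  shows "is_functor (pullback G H F K) G pr1"
  by (rule is_functorI[OF groupoid_pullback[OF assms] functor_dom[OF assms(1)]])
     (auto simp: pr1_def pullback_def hom_def)

lemma is_functor_pr2:
  assumes "is_functor G L F" "is_functor H L K"
  shows "is_functor (pullback G H F K) H pr2"
  by (rule is_functorI[OF groupoid_pullback[OF assms] functor_dom[OF assms(2)]])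
     (auto simp: pr2_def pullback_def hom_def)

lemma is_functor_pairF:
  assumes E: "is_functor M G E" and E': "is_functor M H E'"
    and F: "is_functor G L F" and K: "is_functor H L K"
    and ob: "\<And>x. x \<in> Ob M \<Longrightarrow> on_ob F (on_ob E x) = on_ob K (on_ob E' x)"
    and ar: "\<And>f. f \<in> Ar M \<Longrightarrow> on_ar F (on_ar E f) = on_ar K (on_ar E' f)"
  shows "is_functor M (pullback G H F K) (pairF E E')"
proof (rule is_functorI[OF functor_dom[OF E] groupoid_pullback[OF F K]])
  fix x assume "x \<in> Ob M"
  then show "on_ob (pairF E E') x \<in> Ob (pullback G H F K)"
    using functor_ob[OF E] functor_ob[OF E'] ob by (simp add: pairF_def pullback_def)
next
  fix x y f assume "f \<in> hom M x y"
  then show "on_ar (pairF E E') f \<in> hom (pullback G H F K) (on_ob (pairF E E') x) (on_ob (pairF E E') y)"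
    using functor_hom[OF E] functor_hom[OF E'] ar by (simp add: pairF_def hom_pullback) (simp add: hom_def)
next
  fix x y z f g assume "f \<in> hom M x y" "g \<in> hom M y z"
  then show "on_ar (pairF E E') (gcomp M g f) =
      gcomp (pullback G H F K) (on_ar (pairF E E') g) (on_ar (pairF E E') f)"
    using functor_comp[OF E] functor_comp[OF E'] by (simp add: pairF_def pullback_def)
qed

lemma groupoid_terminal: "groupoid terminal_grpd"
  by standard (auto simp: terminal_grpd_def hom_def)

lemma is_functor_bangF: "groupoid G \<Longrightarrow> is_functor G terminal_grpd bangF"
  by (rule is_functorI[OF _ groupoid_terminal]) (auto simp: bangF_def terminal_grpd_def hom_def)

lemma is_functor_to_terminal: "groupoid G \<Longrightarrow> is_functor G terminal_grpd F"
  by (rule is_functorI[OF _ groupoid_terminal]) (auto simp: terminal_grpd_def hom_def)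

lemma groupoid_prod: "groupoid G \<Longrightarrow> groupoid H \<Longrightarrow> groupoid (prod_grpd G H)"
  unfolding prod_grpd_def by (rule groupoid_pullback[OF is_functor_bangF is_functor_bangF])

lemma hom_prod: "hom (prod_grpd G H) (x, y) (x', y') = hom G x x' \<times> hom H y y'"
  by (auto simp: prod_grpd_def hom_pullback bangF_def)

lemma Ob_prod: "Ob (prod_grpd G H) = Ob G \<times> Ob H"
  by (auto simp: prod_grpd_def pullback_def bangF_def)

lemma is_functor_prod_pr1: "groupoid G \<Longrightarrow> groupoid H \<Longrightarrow> is_functor (prod_grpd G H) G pr1"
  unfolding prod_grpd_def by (rule is_functor_pr1[OF is_functor_bangF is_functor_bangF])

lemma is_functor_prod_pr2: "groupoid G \<Longrightarrow> groupoid H \<Longrightarrow> is_functor (prod_grpd G H) H pr2"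
  unfolding prod_grpd_def by (rule is_functor_pr2[OF is_functor_bangF is_functor_bangF])

lemma is_functor_prod_pairF:
  "is_functor M G E \<Longrightarrow> is_functor M H E' \<Longrightarrow> is_functor M (prod_grpd G H) (pairF E E')"
  unfolding prod_grpd_def
  by (rule is_functor_pairF[OF _ _ is_functor_bangF is_functor_bangF])
     (auto simp: bangF_def dest: functor_cod)

section \<open>Transport of groupoids along relabellings\<close>

locale relabelling =
  fixes F :: "('o, 'm, 'p, 'n) gfun" and F' :: "('p, 'n, 'o, 'm) gfun"
  assumes ob_inv [simp]: "on_ob F' (on_ob F x) = x" and ar_inv [simp]: "on_ar F' (on_ar F f) = f"
begin

lemma ob_inj [simp]: "on_ob F x = on_ob F y \<longleftrightarrow> x = y"
  by (metis ob_inv)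

lemma ar_inj [simp]: "on_ar F f = on_ar F g \<longleftrightarrow> f = g"
  by (metis ar_inv)

lemma hom_relabel: "hom (relabel F F' G) (on_ob F x) (on_ob F y) = on_ar F ` hom G x y"
  by (auto simp: hom_def relabel_def)

lemma hom_relabelE:
  assumes "f \<in> hom (relabel F F' G) x y" "groupoid G"
  obtains a b g where "x = on_ob F a" "y = on_ob F b" "f = on_ar F g" "g \<in> hom G a b"
  using assms by (auto simp: hom_def relabel_def)

lemma groupoid_relabel:
  assumes "groupoid G"
  shows "groupoid (relabel F F' G)"
proof -
  interpret G: groupoid G by fact
  note E = hom_relabelE[OF _ assms]
  have [simp]: "gid (relabel F F' G) (on_ob F x) = on_ar F (gid G x)"
    "gcomp (relabel F F' G) (on_ar F f) (on_ar F g) = on_ar F (gcomp G f g)" for x f g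
    by (simp_all add: relabel_def)
  show ?thesis
  proof
    fix f g h x y z w
    assume f: "f \<in> hom (relabel F F' G) x y" and g: "g \<in> hom (relabel F F' G) y z"
    then show "gcomp (relabel F F' G) g f \<in> hom (relabel F F' G) x z"
      by (elim E) (auto simp: hom_relabel intro: G.comp_hom)
    assume "h \<in> hom (relabel F F' G) z w"
    with f g show "gcomp (relabel F F' G) h (gcomp (relabel F F' G) g f) =
        gcomp (relabel F F' G) (gcomp (relabel F F' G) h g) f"
      by (elim E) (clarsimp, metis G.comp_assoc)
  next
    fix f x y assume f: "f \<in> hom (relabel F F' G) x y"
    then show "gcomp (relabel F F' G) f (gid (relabel F F' G) x) = f"
      "gcomp (relabel F F' G) (gid (relabel F F' G) y) f = f"
      by (auto elim!: E simp: G.comp_id_right G.comp_id_left)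
    show "\<exists>g\<in>hom (relabel F F' G) y x. gcomp (relabel F F' G) g f = gid (relabel F F' G) x \<and>
        gcomp (relabel F F' G) f g = gid (relabel F F' G) y"
      using f by (elim E) (use G.ex_inverse in \<open>force simp: hom_relabel\<close>)
  qed (auto simp: relabel_def hom_def G.dom_ob G.cod_ob dest: G.id_hom)
qed

lemma is_functor_relabel: "groupoid G \<Longrightarrow> is_functor G (relabel F F' G) F"
  by (rule is_functorI[OF _ groupoid_relabel]) (auto simp: hom_relabel, auto simp: relabel_def)

lemma is_functor_unrelabel:
  assumes "groupoid G"
  shows "is_functor (relabel F F' G) G F'"
  by (rule is_functorI[OF groupoid_relabel[OF assms] assms])
     (auto elim!: hom_relabelE[OF _ assms], auto simp: relabel_def)

lemma indeg_relabel: "indeg (relabel F F' G) (on_ob F x) = indeg G x"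
proof -
  have "{f \<in> Ar (relabel F F' G). gcod (relabel F F' G) f = on_ob F x} =
      on_ar F ` {f \<in> Ar G. gcod G f = x}"
    by (auto simp: relabel_def)
  then show ?thesis unfolding indeg_def by (simp add: card_image inj_on_def)
qed

lemma indeg_relabel_ob:
  "x \<in> Ob (relabel F F' G) \<Longrightarrow> indeg (relabel F F' G) x = indeg G (on_ob F' x)"
  using indeg_relabel by (auto simp: relabel_def)

end

section \<open>Homotopy fibres\<close>

lemma Ob_hfib: "Ob (hfib G H F b) = {(x, \<beta>). x \<in> Ob G \<and> \<beta> \<in> hom H (on_ob F x) b}"
  by (simp add: hfib_def Let_def)

lemma hom_hfib: "hom (hfib G H F b) u v =
  {(u, \<xi>, v) | \<xi>. u \<in> Ob (hfib G H F b) \<and> v \<in> Ob (hfib G H F b) \<and> \<xi> \<in> hom G (fst u) (fst v) \<and>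
     gcomp H (snd v) (on_ar F \<xi>) = snd u}"
  by (auto simp: hfib_def Let_def hom_def)

lemma groupoid_hfib:
  assumes F: "is_functor G H F"
  shows "groupoid (hfib G H F b)"
proof -
  interpret G: groupoid G by (rule functor_dom[OF F])
  interpret H: groupoid H by (rule functor_cod[OF F])
  have [simp]: "gid (hfib G H F b) u = (u, gid G (fst u), u)"
    "gcomp (hfib G H F b) (u', \<xi>', v') (u, \<xi>, v) = (u, gcomp G \<xi>' \<xi>, v')" for u v \<xi> u' v' \<xi>'
    by (simp_all add: hfib_def Let_def)
  note [simp] = hom_hfib Ob_hfib
  show ?thesis
  proof
    fix f assume "f \<in> Ar (hfib G H F b)"
    then show "gdom (hfib G H F b) f \<in> Ob (hfib G H F b)" "gcod (hfib G H F b) f \<in> Ob (hfib G H F b)"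
      by (auto simp: hfib_def Let_def)
  next
    fix u assume "u \<in> Ob (hfib G H F b)"
    then show "gid (hfib G H F b) u \<in> hom (hfib G H F b) u u"
      by (auto simp: G.id_hom functor_id[OF F] H.comp_id_right)
  next
    fix f u v assume "f \<in> hom (hfib G H F b) u v"
    then obtain \<xi> where f: "f = (u, \<xi>, v)" "u \<in> Ob (hfib G H F b)" "v \<in> Ob (hfib G H F b)"
      "\<xi> \<in> hom G (fst u) (fst v)" "gcomp H (snd v) (on_ar F \<xi>) = snd u" by auto
    then show "gcomp (hfib G H F b) f (gid (hfib G H F b) u) = f"
      "gcomp (hfib G H F b) (gid (hfib G H F b) v) f = f"
      by (auto simp: G.comp_id_right G.comp_id_left)
    obtain \<zeta> where z: "\<zeta> \<in> hom G (fst v) (fst u)" "gcomp G \<zeta> \<xi> = gid G (fst u)"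
      "gcomp G \<xi> \<zeta> = gid G (fst v)"
      using G.ex_inverse[OF f(4)] by blast
    have vh: "snd v \<in> hom H (on_ob F (fst v)) b" "fst v \<in> Ob G" using f(3) by auto
    have "gcomp H (snd u) (on_ar F \<zeta>) = gcomp H (snd v) (gcomp H (on_ar F \<xi>) (on_ar F \<zeta>))"
      using f(5) H.comp_assoc[OF functor_hom[OF F z(1)] functor_hom[OF F f(4)] vh(1)] by simp
    also have "\<dots> = snd v"
      using functor_comp[OF F z(1) f(4)] z(3) functor_id[OF F vh(2)] H.comp_id_right[OF vh(1)] by simp
    finally show "\<exists>g\<in>hom (hfib G H F b) v u. gcomp (hfib G H F b) g f = gid (hfib G H F b) u \<and>
        gcomp (hfib G H F b) f g = gid (hfib G H F b) v"
      using f z by (intro bexI[of _ "(v, \<zeta>, u)"]) auto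
  next
    fix f g u v w assume "f \<in> hom (hfib G H F b) u v" "g \<in> hom (hfib G H F b) v w"
    then obtain \<xi> \<zeta> where f: "f = (u, \<xi>, v)" "u \<in> Ob (hfib G H F b)" "v \<in> Ob (hfib G H F b)"
      "\<xi> \<in> hom G (fst u) (fst v)" "gcomp H (snd v) (on_ar F \<xi>) = snd u"
      and g: "g = (v, \<zeta>, w)" "w \<in> Ob (hfib G H F b)"
      "\<zeta> \<in> hom G (fst v) (fst w)" "gcomp H (snd w) (on_ar F \<zeta>) = snd v" by auto
    have wh: "snd w \<in> hom H (on_ob F (fst w)) b" using g(2) by auto
    have "gcomp H (snd w) (on_ar F (gcomp G \<zeta> \<xi>)) = snd u"
      using f(5) g(4) functor_comp[OF F f(4) g(3)]
        H.comp_assoc[OF functor_hom[OF F f(4)] functor_hom[OF F g(3)] wh] by simp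
    then show "gcomp (hfib G H F b) g f \<in> hom (hfib G H F b) u w"
      using f g G.comp_hom[OF f(4) g(3)] by auto
    fix h z assume "h \<in> hom (hfib G H F b) w z"
    then show "gcomp (hfib G H F b) h (gcomp (hfib G H F b) g f) =
        gcomp (hfib G H F b) (gcomp (hfib G H F b) h g) f"
      using f g by (clarsimp simp: hom_hfib) (metis G.comp_assoc)
  qed
qed

lemma is_functor_hfib_pr:
  assumes F: "is_functor G H F"
  shows "is_functor (hfib G H F b) G hfib_pr"
  by (rule is_functorI[OF groupoid_hfib[OF F] functor_dom[OF F]])
     (auto simp: hom_hfib hfib_pr_def Ob_hfib, auto simp: hfib_def Let_def)

text \<open>An arrow into \<open>(x, \<beta>)\<close> is determined by its underlying arrow into x:
  the decoration of its source is forced to be the composite with \<open>\<beta>\<close>.\<close>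

lemma indeg_hfib:
  assumes F: "is_functor G H F" and u: "(x, \<beta>) \<in> Ob (hfib G H F b)"
  shows "indeg (hfib G H F b) (x, \<beta>) = indeg G x"
proof -
  interpret G: groupoid G by (rule functor_dom[OF F])
  interpret H: groupoid H by (rule functor_cod[OF F])
  let ?lift = "\<lambda>\<xi>. ((gdom G \<xi>, gcomp H \<beta> (on_ar F \<xi>)), \<xi>, (x, \<beta>))"
  have b: "\<beta> \<in> hom H (on_ob F x) b" using u by (simp add: Ob_hfib)
  have "?lift \<xi> \<in> Ar (hfib G H F b)" if "\<xi> \<in> Ar G" "gcod G \<xi> = x" for \<xi>
  proof -
    have xi: "\<xi> \<in> hom G (gdom G \<xi>) x" using that by (simp add: hom_def)
    show ?thesis
      using H.comp_hom[OF functor_hom[OF F xi] b] xi u that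
      by (auto simp: hfib_def Let_def hom_def dest: G.dom_ob)
  qed
  then have "{f \<in> Ar (hfib G H F b). gcod (hfib G H F b) f = (x, \<beta>)} =
      ?lift ` {\<xi> \<in> Ar G. gcod G \<xi> = x}"
    by (auto simp: hfib_def Let_def hom_def image_iff)
  then show ?thesis unfolding indeg_def by (simp add: card_image inj_on_def)
qed

text \<open>Each x carries one object of the fibre per arrow from its image to b, all with the arrow
  count of x. Any finite S that catches the objects lying over the component of b will do, because
  the others contribute an empty hom set.\<close>

lemma hcard_hfib:
  assumes F: "is_functor G H F" and fin: "finite S"
    and S: "{x \<in> Ob G. hom H (on_ob F x) b \<noteq> {}} \<subseteq> S" "S \<subseteq> Ob G"
    and posG: "\<And>x. x \<in> S \<Longrightarrow> indeg G x > 0" and posH: "indeg H b > 0"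
  shows "finite (Ob (hfib G H F b))" "hfinite (hfib G H F b)"
    "hcard (hfib G H F b) = (\<Sum>x\<in>S. of_nat (card (hom H (on_ob F x) b)) / of_nat (indeg G x))"
proof -
  interpret hfib: groupoid "hfib G H F b" by (rule groupoid_hfib[OF F])
  have eq: "Ob (hfib G H F b) = (SIGMA x:S. hom H (on_ob F x) b)"
    using S by (auto simp: Ob_hfib)
  have finh: "finite (hom H (on_ob F x) b)" for x using indeg_pos_finite_hom[OF posH] .
  show finO: "finite (Ob (hfib G H F b))" using eq fin finh by auto
  have pos: "indeg (hfib G H F b) u > 0" if "u \<in> Ob (hfib G H F b)" for u
    using that indeg_hfib[OF F, of "fst u" "snd u"] posG eq by auto
  show "hfinite (hfib G H F b)" by (rule hfib.hfinite[OF finO pos])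
  have "hcard (hfib G H F b) = (\<Sum>u\<in>Ob (hfib G H F b). 1 / of_nat (indeg (hfib G H F b) u))"
    by (rule hfib.hcard_eq_sum[OF finO pos])
  also have "\<dots> = (\<Sum>(x, \<beta>)\<in>(SIGMA x:S. hom H (on_ob F x) b). 1 / of_nat (indeg G x))"
    by (rule sum.cong) (use eq indeg_hfib[OF F] in auto)
  also have "\<dots> = (\<Sum>x\<in>S. of_nat (card (hom H (on_ob F x) b)) / of_nat (indeg G x))"
    by (subst sum.Sigma[symmetric]) (use fin finh in auto)
  finally show "hcard (hfib G H F b) = (\<Sum>x\<in>S. of_nat (card (hom H (on_ob F x) b)) / of_nat (indeg G x))" .
qed

section \<open>Tuples\<close>

lemma list_eq_iff: "xs = ys \<longleftrightarrow> length xs = length ys \<and> (\<forall>i<length ys. xs ! i = ys ! i)"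
  by (auto intro: nth_equalityI)

lemma grpdP_sel:
  "Ob (grpdP k G) = {xs. xs \<noteq> [] \<and> set xs \<subseteq> Ob G}"
  "gid (grpdP k G) xs = (id, map (gid G) xs)"
  "gcomp (grpdP k G) (\<tau>, gs) (\<sigma>, fs) =
     (\<sigma> \<circ> \<tau>, map (\<lambda>i. gcomp G (gs ! i) (fs ! \<tau> i)) [0..<length gs])"
  by (simp_all add: grpdP_def)

lemma permutes_less_iff: "\<sigma> permutes {..<n} \<Longrightarrow> \<sigma> i < n \<longleftrightarrow> i < n" for n :: nat
  using permutes_in_image[of \<sigma> "{..<n}" i] by simp

text \<open>Indexes the components by target positions, with the permutation applied forwards;
  \<open>gdom\<close> itself is phrased through the inverse permutation.\<close>

lemma hom_grpdP:
  "(\<sigma>, fs) \<in> hom (grpdP k G) xs ys \<longleftrightarrow>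
     fs \<noteq> [] \<and> length xs = length fs \<and> length ys = length fs \<and> \<sigma> permutes {..<length fs} \<and>
     (k = Mr \<longrightarrow> \<sigma> = id) \<and> (\<forall>i<length fs. fs ! i \<in> hom G (xs ! \<sigma> i) (ys ! i))"
proof (cases "\<sigma> permutes {..<length fs}")
  case True
  have "(\<forall>j<length fs. gdom G (fs ! inv \<sigma> j) = xs ! j) \<longleftrightarrow>
      (\<forall>i<length fs. gdom G (fs ! i) = xs ! \<sigma> i)"
    using permutes_in_image[OF True] permutes_in_image[OF permutes_inv[OF True]]
    by (metis lessThan_iff permutes_inverses[OF True])
  then show ?thesis
    using True
    by (auto simp: hom_def grpdP_def list_eq_iff[of _ xs] list_eq_iff[of _ ys] set_conv_nth)
qed (auto simp: hom_def grpdP_def)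

lemma groupoid_grpdP:
  assumes "groupoid G"
  shows "groupoid (grpdP k G)"
proof -
  interpret G: groupoid G by fact
  show ?thesis
  proof
    fix f assume f: "f \<in> Ar (grpdP k G)"
    obtain \<sigma> fs where fs: "f = (\<sigma>, fs)" "fs \<noteq> []" "set fs \<subseteq> Ar G" "\<sigma> permutes {..<length fs}"
      using f by (auto simp: grpdP_def)
    have "inv \<sigma> i < length fs" if "i < length fs" for i
      using permutes_in_image[OF permutes_inv[OF fs(4)], of i] that by simp
    then have "gdom G (fs ! inv \<sigma> i) \<in> Ob G" if "i < length fs" for i
      using that fs(3) G.dom_ob nth_mem by blast
    then show "gdom (grpdP k G) f \<in> Ob (grpdP k G)" "gcod (grpdP k G) f \<in> Ob (grpdP k G)"
      using fs G.cod_ob by (auto simp: grpdP_def)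
  next
    fix xs assume "xs \<in> Ob (grpdP k G)"
    then show "gid (grpdP k G) xs \<in> hom (grpdP k G) xs xs"
      by (auto simp: grpdP_sel hom_grpdP permutes_id intro!: G.id_hom)
  next
    fix f g xs ys zs
    assume "f \<in> hom (grpdP k G) xs ys" "g \<in> hom (grpdP k G) ys zs"
    then show "gcomp (grpdP k G) g f \<in> hom (grpdP k G) xs zs"
      by (cases f; cases g)
         (auto simp: hom_grpdP grpdP_sel permutes_less_iff intro!: G.comp_hom permutes_compose)
  next
    fix f xs ys assume f: "f \<in> hom (grpdP k G) xs ys"
    obtain \<sigma> fs where fs: "f = (\<sigma>, fs)" "length xs = length fs" "length ys = length fs"
      "fs \<noteq> []" "\<sigma> permutes {..<length fs}" "k = Mr \<longrightarrow> \<sigma> = id"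
      "\<And>i. i < length fs \<Longrightarrow> fs ! i \<in> hom G (xs ! \<sigma> i) (ys ! i)"
      using f by (cases f) (auto simp: hom_grpdP)
    have s: "\<sigma> i < length fs \<longleftrightarrow> i < length fs" for i
      using permutes_in_image[OF fs(5), of i] by simp
    have s': "inv \<sigma> i < length fs \<longleftrightarrow> i < length fs" for i
      using permutes_in_image[OF permutes_inv[OF fs(5)], of i] by simp
    show "gcomp (grpdP k G) f (gid (grpdP k G) xs) = f"
      "gcomp (grpdP k G) (gid (grpdP k G) ys) f = f"
      unfolding fs(1) grpdP_sel
      by (auto intro!: nth_equalityI simp: fs(2,3) s G.comp_id_right[OF fs(7)] G.comp_id_left[OF fs(7)])
    define inverse_of where "inverse_of i = (SOME g. g \<in> hom G (ys ! i) (xs ! \<sigma> i) \<and>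
      gcomp G g (fs ! i) = gid G (xs ! \<sigma> i) \<and> gcomp G (fs ! i) g = gid G (ys ! i))" for i
    have inv: "inverse_of i \<in> hom G (ys ! i) (xs ! \<sigma> i) \<and>
      gcomp G (inverse_of i) (fs ! i) = gid G (xs ! \<sigma> i) \<and> gcomp G (fs ! i) (inverse_of i) = gid G (ys ! i)"
      if "i < length fs" for i
      unfolding inverse_of_def by (rule someI_ex) (use G.ex_inverse[OF fs(7)[OF that]] in blast)
    \<comment> \<open>Component i has to run from \<open>ys ! inv \<sigma> i\<close> to
      \<open>xs ! i\<close>, so it inverts \<open>fs ! inv \<sigma> i\<close>.\<close>
    let ?g = "(inv \<sigma>, map (\<lambda>i. inverse_of (inv \<sigma> i)) [0..<length fs])"
    have "?g \<in> hom (grpdP k G) ys xs"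
      using fs s' inv permutes_inv[OF fs(5)] permutes_inverses[OF fs(5)]
      by (auto simp: hom_grpdP) metis
    moreover have "gcomp (grpdP k G) ?g f = gid (grpdP k G) xs"
      "gcomp (grpdP k G) f ?g = gid (grpdP k G) ys"
      unfolding fs(1) grpdP_sel
      using fs(2,3) s s' inv permutes_inverses[OF fs(5)] permutes_inv_o[OF fs(5)]
      by (auto intro!: nth_equalityI)
    ultimately show "\<exists>g\<in>hom (grpdP k G) ys xs. gcomp (grpdP k G) g f = gid (grpdP k G) xs \<and>
        gcomp (grpdP k G) f g = gid (grpdP k G) ys" by blast
  next
    fix f g h xs ys zs ws
    assume "f \<in> hom (grpdP k G) xs ys" "g \<in> hom (grpdP k G) ys zs" "h \<in> hom (grpdP k G) zs ws"
    moreover obtain \<sigma> fs \<tau> gs \<rho> hs where "f = (\<sigma>, fs)" "g = (\<tau>, gs)" "h = (\<rho>, hs)"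
      by (cases f; cases g; cases h)
    ultimately have *: "length gs = length fs" "length hs = length fs"
      "f = (\<sigma>, fs)" "g = (\<tau>, gs)" "h = (\<rho>, hs)"
      "\<rho> permutes {..<length fs}" "\<tau> permutes {..<length fs}"
      "\<And>i. i < length fs \<Longrightarrow> fs ! i \<in> hom G (xs ! \<sigma> i) (ys ! i)"
      "\<And>i. i < length fs \<Longrightarrow> gs ! i \<in> hom G (ys ! \<tau> i) (zs ! i)"
      "\<And>i. i < length fs \<Longrightarrow> hs ! i \<in> hom G (zs ! \<rho> i) (ws ! i)"
      by (auto simp: hom_grpdP)
    have "\<rho> i < length fs \<longleftrightarrow> i < length fs" "\<tau> i < length fs \<longleftrightarrow> i < length fs" for i
      using permutes_in_image[OF *(6), of i] permutes_in_image[OF *(7), of i] by auto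
    then show "gcomp (grpdP k G) h (gcomp (grpdP k G) g f) =
        gcomp (grpdP k G) (gcomp (grpdP k G) h g) f"
      unfolding *(3-5) grpdP_sel using *(1,2,8-10)
      by (auto simp: o_assoc intro!: nth_equalityI G.comp_assoc[OF *(8-10)])
  qed
qed

lemma is_functor_mapP:
  assumes F: "is_functor G H F"
  shows "is_functor (grpdP k G) (grpdP k H) (mapP F)"
proof (rule is_functorI)
  show "groupoid (grpdP k G)" "groupoid (grpdP k H)"
    using F groupoid_grpdP functor_dom functor_cod by blast+
next
  fix xs assume "xs \<in> Ob (grpdP k G)"
  then show "on_ob (mapP F) xs \<in> Ob (grpdP k H)"
    using functor_ob[OF F] by (auto simp: grpdP_def mapP_def)
next
  fix xs ys f assume "f \<in> hom (grpdP k G) xs ys"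
  then show "on_ar (mapP F) f \<in> hom (grpdP k H) (on_ob (mapP F) xs) (on_ob (mapP F) ys)"
    using functor_hom[OF F] by (cases f) (auto simp: mapP_def hom_grpdP permutes_less_iff)
next
  fix xs ys zs f g assume a: "f \<in> hom (grpdP k G) xs ys" "g \<in> hom (grpdP k G) ys zs"
  obtain \<sigma> fs \<tau> gs where "f = (\<sigma>, fs)" "g = (\<tau>, gs)" by (cases f; cases g)
  note fg = this
  from fg a have *: "length gs = length fs" "\<tau> permutes {..<length fs}"
      "\<And>i. i < length fs \<Longrightarrow> fs ! i \<in> hom G (xs ! \<sigma> i) (ys ! i)"
      "\<And>i. i < length fs \<Longrightarrow> gs ! i \<in> hom G (ys ! \<tau> i) (zs ! i)"
    by (auto simp: hom_grpdP)
  show "on_ar (mapP F) (gcomp (grpdP k G) g f) =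
      gcomp (grpdP k H) (on_ar (mapP F) g) (on_ar (mapP F) f)"
    unfolding fg grpdP_sel
    by (auto simp: mapP_def grpdP_sel *(1) permutes_less_iff[OF *(2)]
        intro!: nth_equalityI functor_comp[OF F *(3,4)])
qed

section \<open>Positions in a concatenation of blocks\<close>

definition offset :: "'a list list \<Rightarrow> nat \<Rightarrow> nat" where
  "offset xss i = (\<Sum>l<i. length (xss ! l))"

lemma offset_Suc: "offset xss (Suc i) = offset xss i + length (xss ! i)"
  by (simp add: offset_def)

lemma offset_mono: "i \<le> i' \<Longrightarrow> offset xss i \<le> offset xss i'"
  unfolding offset_def by (rule sum_mono2) auto

lemma offset_snoc: "i \<le> length xss \<Longrightarrow> offset (xss @ [xs]) i = offset xss i"
  by (simp add: offset_def nth_append)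

lemma offset_length: "offset xss (length xss) = length (concat xss)"
  by (induction xss rule: rev_induct) (simp add: offset_def, simp add: offset_snoc offset_Suc)

lemma offset_less:
  assumes "i < length xss" "j < length (xss ! i)"
  shows "offset xss i + j < length (concat xss)"
  using assms offset_mono[of "Suc i" "length xss" xss] by (simp add: offset_Suc offset_length)

lemma nth_concat_offset:
  "i < length xss \<Longrightarrow> j < length (xss ! i) \<Longrightarrow> concat xss ! (offset xss i + j) = xss ! i ! j"
proof (induction xss rule: rev_induct)
  case (snoc xs xss)
  show ?case
  proof (cases "i < length xss")
    case True
    then show ?thesis
      using snoc offset_less[of i xss j] by (simp add: offset_snoc nth_append)
  next
    case False
    then have "i = length xss" using snoc.prems by simp
    then show ?thesis using snoc.prems by (simp add: offset_snoc offset_length nth_append)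
  qed
qed simp

lemma offset_inj:
  assumes "j < length (xss ! i)" "j' < length (xss ! i')" "offset xss i + j = offset xss i' + j'"
  shows "i = i' \<and> j = j'"
  using assms offset_mono[of "Suc i" i' xss] offset_mono[of "Suc i'" i xss]
  by (cases i i' rule: linorder_cases) (auto simp: offset_Suc)

lemma offset_surj:
  assumes "p < length (concat xss)"
  obtains i j where "i < length xss" "j < length (xss ! i)" "p = offset xss i + j"
proof -
  have "\<exists>i<length xss. \<exists>j<length (xss ! i). p = offset xss i + j"
    using assms
  proof (induction xss rule: rev_induct)
    case (snoc xs xss)
    show ?case
    proof (cases "p < length (concat xss)")
      case True
      with snoc.IH obtain i j where "i < length xss" "j < length (xss ! i)" "p = offset xss i + j"
        by blast
      then show ?thesis by (intro exI[of _ i]) (auto simp: offset_snoc nth_append)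
    next
      case False
      then show ?thesis using snoc.prems
        by (intro exI[of _ "length xss"])
           (auto simp: offset_snoc offset_length intro!: exI[of _ "p - length (concat xss)"])
    qed
  qed simp
  then show thesis using that by blast
qed

text \<open>Replaces the list \<open>src_positions\<close> by block coordinates, the form in which
  flattened permutations are used from here on. It works because the blocks of that list have the
  lengths of the target blocks.\<close>

lemma mu_ar_hom:
  assumes m: "(\<tau>, ms) \<in> hom (grpdP k (grpdP k' G)) xss yss"
  shows mu_ar_snd: "snd (mu_ar (\<tau>, ms)) = concat (map snd ms)"
    and mu_ar_block: "i < length yss \<Longrightarrow> j < length (yss ! i) \<Longrightarrow>
      fst (mu_ar (\<tau>, ms)) (offset yss i + j) = offset xss (\<tau> i) + fst (ms ! i) j"
    and mu_ar_outside: "length (concat yss) \<le> p \<Longrightarrow> fst (mu_ar (\<tau>, ms)) p = p"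
    and mu_ar_nth: "i < length yss \<Longrightarrow> j < length (yss ! i) \<Longrightarrow>
      snd (mu_ar (\<tau>, ms)) ! (offset yss i + j) = snd (ms ! i) ! j"
    and mu_ar_length: "length (snd (mu_ar (\<tau>, ms))) = length (concat yss)"
      "length (concat xss) = length (concat yss)"
    and mu_ar_perm: "fst (mu_ar (\<tau>, ms)) permutes {..<length (concat yss)}"
proof -
  have len: "length xss = length ms" "length yss = length ms" and \<tau>: "\<tau> permutes {..<length ms}"
    and ms: "\<And>i. i < length ms \<Longrightarrow> ms ! i \<in> hom (grpdP k' G) (xss ! \<tau> i) (yss ! i)"
    using m by (auto simp: hom_grpdP)
  have \<tau>i: "\<tau> i < length ms \<longleftrightarrow> i < length ms" "inv \<tau> i < length ms \<longleftrightarrow> i < length ms" for i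
    using permutes_in_image[OF \<tau>, of i] permutes_in_image[OF permutes_inv[OF \<tau>], of i] by auto
  have len1: "length (snd (ms ! i)) = length (yss ! i)" "length (xss ! \<tau> i) = length (yss ! i)"
    and \<sigma>: "fst (ms ! i) permutes {..<length (yss ! i)}" if "i < length ms" for i
    using ms[OF that] by (cases "ms ! i"; auto simp: hom_grpdP)+
  \<comment> \<open>The definition reads the length of source block l off the target block that
    receives it; for an arrow this is the length of \<open>xss ! l\<close>.\<close>
  have src: "(\<Sum>l<\<tau> i. length (snd (ms ! inv \<tau> l))) = offset xss (\<tau> i)" if "i < length ms" for i
    unfolding offset_def
  proof (rule sum.cong[OF refl])
    fix l assume "l \<in> {..<\<tau> i}"
    then have "inv \<tau> l < length ms" using \<tau>i that by (metis lessThan_iff order_less_trans)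
    then show "length (snd (ms ! inv \<tau> l)) = length (xss ! l)"
      using len1 permutes_inverses[OF \<tau>] by metis
  qed
  define pss where "pss = map (\<lambda>i. map (\<lambda>j. offset xss (\<tau> i) + fst (ms ! i) j) [0..<length (yss ! i)])
    [0..<length ms]"
  have pos: "src_positions (\<tau>, ms) = concat pss"
    unfolding src_positions_def pss_def Let_def prod.case
    by (intro arg_cong[where f = concat] map_cong) (auto simp: src len1)
  have pss: "length pss = length yss" "\<And>i. i < length ms \<Longrightarrow> length (pss ! i) = length (yss ! i)"
    by (simp_all add: pss_def len)
  have off: "offset uss i = offset vss i"
    if "length uss = length vss" "\<forall>i<length vss. length (uss ! i) = length (vss ! i)" "i \<le> length vss"
    for uss :: "'x list list" and vss :: "'y list list" and i
    unfolding offset_def using that by (intro sum.cong) auto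
  have off_pss: "offset pss i = offset yss i" if "i \<le> length ms" for i
    by (rule off) (use that pss len in auto)
  have lenc: "length (concat pss) = length (concat yss)"
    using off_pss[of "length ms"] offset_length[of pss] offset_length[of yss] pss len by simp
  show "snd (mu_ar (\<tau>, ms)) = concat (map snd ms)" by (simp add: mu_ar_def)
  have snds: "length (map snd ms) = length yss"
    "\<forall>i<length yss. length (map snd ms ! i) = length (yss ! i)"
    using len len1 by auto
  show "snd (mu_ar (\<tau>, ms)) ! (offset yss i + j) = snd (ms ! i) ! j"
    if "i < length yss" "j < length (yss ! i)" for i j
    using nth_concat_offset[of i "map snd ms" j] that snds off[OF snds, of i] len
    by (simp add: mu_ar_def)
  show "length (snd (mu_ar (\<tau>, ms))) = length (concat yss)"
    using off[OF snds, of "length ms"] offset_length[of "map snd ms"] offset_length[of yss] len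
    by (simp add: mu_ar_def)
  have "length (concat xss) = (\<Sum>i<length ms. length (xss ! i))"
    using offset_length[of xss] len by (simp add: offset_def)
  also have "\<dots> = (\<Sum>i<length ms. length (xss ! \<tau> i))"
    using sum.permute[OF \<tau>, of "\<lambda>i. length (xss ! i)"] by (simp add: o_def)
  also have "\<dots> = length (concat yss)"
    using offset_length[of yss] len len1 by (simp add: offset_def)
  finally show lenx: "length (concat xss) = length (concat yss)" .
  show out: "fst (mu_ar (\<tau>, ms)) p = p" if "length (concat yss) \<le> p" for p
    using that by (simp add: mu_ar_def pos lenc)
  show block: "fst (mu_ar (\<tau>, ms)) (offset yss i + j) = offset xss (\<tau> i) + fst (ms ! i) j"
    if "i < length yss" "j < length (yss ! i)" for i j
    using offset_less[OF that] nth_concat_offset[of i pss j] that pss len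
    by (simp add: mu_ar_def pos lenc off_pss) (simp add: pss_def)
  let ?\<pi> = "fst (mu_ar (\<tau>, ms))"
  have into: "\<tau> i < length xss" "fst (ms ! i) j < length (xss ! \<tau> i)"
    if "i < length yss" "j < length (yss ! i)" for i j
    using that \<tau>i len len1 permutes_in_image[OF \<sigma>[of i], of j] by auto
  \<comment> \<open>Block coordinates are unique and both \<open>\<tau>\<close> and the inner
    permutations are injective, so the map is injective; on a finite initial segment this makes it
    bijective.\<close>
  show "?\<pi> permutes {..<length (concat yss)}"
  proof (rule bij_imp_permutes)
    have "inj_on ?\<pi> {..<length (concat yss)}"
    proof (rule inj_onI)
      fix p q assume "p \<in> {..<length (concat yss)}" "q \<in> {..<length (concat yss)}" "?\<pi> p = ?\<pi> q"
      moreover obtain i j where ij: "i < length yss" "j < length (yss ! i)" "p = offset yss i + j"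
        using offset_surj[of p yss] calculation by auto
      moreover obtain i' j' where ij': "i' < length yss" "j' < length (yss ! i')" "q = offset yss i' + j'"
        using offset_surj[of q yss] calculation by auto
      ultimately have "\<tau> i = \<tau> i' \<and> fst (ms ! i) j = fst (ms ! i') j'"
        using offset_inj[OF into(2)[OF ij(1,2)] into(2)[OF ij'(1,2)]] block by auto
      moreover have "inj \<tau>" by (rule permutes_inj[OF \<tau>])
      moreover have "inj (fst (ms ! i))" using permutes_inj[OF \<sigma>] ij len by simp
      ultimately show "p = q" using ij ij' by (auto dest: injD)
    qed
    moreover have "?\<pi> ` {..<length (concat yss)} \<subseteq> {..<length (concat yss)}"
    proof (rule image_subsetI)
      fix p assume "p \<in> {..<length (concat yss)}"
      then obtain i j where ij: "i < length yss" "j < length (yss ! i)" "p = offset yss i + j"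
        using offset_surj[of p yss] by auto
      then show "?\<pi> p \<in> {..<length (concat yss)}"
        using offset_less[OF into[OF ij(1,2)]] block[OF ij(1,2)] lenx by simp
    qed
    ultimately show "bij_betw ?\<pi> {..<length (concat yss)} {..<length (concat yss)}"
      using endo_inj_surj[OF finite_lessThan] unfolding bij_betw_def by blast
  qed (use out in auto)
qed

text \<open>Besides the multiplication of each monad this covers ordered tuples inside reorderable
  ones, the flattening that occurs in the last face of the bar construction. Only an ordered result
  demands ordered tuples at both layers.\<close>

lemma is_functor_muP:
  assumes "groupoid G" and k: "l = Mr \<Longrightarrow> k = Mr \<and> k' = Mr"
  shows "is_functor (grpdP k (grpdP k' G)) (grpdP l G) muP"
proof (rule is_functorI)
  interpret G: groupoid G by fact
  show "groupoid (grpdP k (grpdP k' G))" "groupoid (grpdP l G)"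
    by (intro groupoid_grpdP assms)+
  fix xss assume "xss \<in> Ob (grpdP k (grpdP k' G))"
  then show "on_ob muP xss \<in> Ob (grpdP l G)"
    by (cases xss) (auto simp: grpdP_def muP_def)
next
  interpret PP: groupoid "grpdP k (grpdP k' G)" by (intro groupoid_grpdP assms)
  have into: "\<tau> i < length xss \<and> fst (ms ! i) j < length (xss ! \<tau> i) \<and>
      snd (ms ! i) ! j \<in> hom G (xss ! \<tau> i ! fst (ms ! i) j) (yss ! i ! j)"
    if m: "(\<tau>, ms) \<in> hom (grpdP k (grpdP k' G)) xss yss"
      and ij: "i < length yss" "j < length (yss ! i)" for \<tau> ms xss yss i j
  proof -
    have ms: "length xss = length ms" "\<tau> permutes {..<length ms}" "i < length ms"
      "ms ! i \<in> hom (grpdP k' G) (xss ! \<tau> i) (yss ! i)"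
      using m ij by (auto simp: hom_grpdP)
    obtain \<sigma> fs where mi: "ms ! i = (\<sigma>, fs)" by fastforce
    then show ?thesis using ms ij permutes_in_image[OF ms(2), of i]
      by (auto simp: hom_grpdP dest!: permutes_in_image[where x = j])
  qed
  note [simp] = muP_def
  {
    fix xss yss f assume f: "f \<in> hom (grpdP k (grpdP k' G)) xss yss"
    obtain \<tau> ms where m: "f = (\<tau>, ms)" by fastforce
    note f = f[unfolded m]
    obtain \<pi> fs where mu: "mu_ar (\<tau>, ms) = (\<pi>, fs)" by fastforce
    note fm = mu_ar_length[OF f] mu_ar_perm[OF f]
    note blocks = mu_ar_nth[OF f] mu_ar_block[OF f]
    have yss: "yss \<noteq> []" "length yss = length ms" "\<forall>ys\<in>set yss. ys \<noteq> []"
      using f PP.hom_ob[OF f] by (auto simp: hom_grpdP grpdP_sel)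
    have "fs ! p \<in> hom G (concat xss ! \<pi> p) (concat yss ! p)" if "p < length fs" for p
    proof -
      have "p < length (concat yss)" using fm(1) that mu by simp
      then obtain i j where ij: "i < length yss" "j < length (yss ! i)" "p = offset yss i + j"
        by (rule offset_surj)
      note into = into[OF f ij(1,2)]
      show ?thesis
        using into nth_concat_offset[of "\<tau> i" xss "fst (ms ! i) j"] nth_concat_offset[OF ij(1,2)]
          blocks[OF ij(1,2)] ij(3) mu by simp
    qed
    \<comment> \<open>When all permutations are trivial, source and target blocks have the same
      lengths, so the offsets agree and every position is fixed.\<close>
    moreover have "\<pi> = id" if "l = Mr"
    proof
      fix p
      have "k = Mr" "k' = Mr" using k that by auto
      then have "\<tau> = id" "length xss = length ms"
        and "\<forall>i<length ms. ms ! i \<in> hom (grpdP Mr G) (xss ! i) (yss ! i)"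
        using f by (auto simp: hom_grpdP)
      moreover have "fst m = id \<and> length xs = length ys" if "m \<in> hom (grpdP Mr G) xs ys" for m xs ys
        using that by (cases m) (auto simp: hom_grpdP)
      ultimately have \<sigma>: "\<forall>i<length ms. fst (ms ! i) = id \<and> length (xss ! i) = length (yss ! i)"
        by blast
      then have "offset xss i = offset yss i" if "i < length yss" for i
        unfolding offset_def using that yss by (intro sum.cong) auto
      then show "\<pi> p = id p"
        using mu_ar_outside[OF f, of p] blocks(2) \<open>\<tau> = id\<close> \<sigma> yss mu offset_surj[of p yss]
        by (metis fst_conv id_apply linorder_not_less)
    qed
    ultimately have "(\<forall>p<length fs. fs ! p \<in> hom G (concat xss ! \<pi> p) (concat yss ! p)) \<and>
        (l = Mr \<longrightarrow> \<pi> = id)" by blast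
    moreover have "concat yss \<noteq> []" using yss by (cases yss) auto
    ultimately show "on_ar muP f \<in> hom (grpdP l G) (on_ob muP xss) (on_ob muP yss)"
      using fm mu m by (auto simp: hom_grpdP)
  }
  fix xss yss zss f g
  assume f: "f \<in> hom (grpdP k (grpdP k' G)) xss yss" and g: "g \<in> hom (grpdP k (grpdP k' G)) yss zss"
  obtain \<tau> ms where m: "f = (\<tau>, ms)" by fastforce
  obtain \<tau>' ms' where m': "g = (\<tau>', ms')" by fastforce
  obtain \<tau>'' ms'' where m'': "gcomp (grpdP k (grpdP k' G)) g f = (\<tau>'', ms'')" by fastforce
  have h: "(\<tau>'', ms'') \<in> hom (grpdP k (grpdP k' G)) xss zss"
    using PP.comp_hom[OF f g] m'' by simp
  note f = f[unfolded m] and g = g[unfolded m']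
  have len: "length ms' = length zss" "length ms'' = length zss" "length yss = length zss"
    using g h by (simp_all add: hom_grpdP)
  have \<tau>'': "\<tau>'' = \<tau> \<circ> \<tau>'"
    and ms''_eq: "ms'' = map (\<lambda>i. gcomp (grpdP k' G) (ms' ! i) (ms ! \<tau>' i)) [0..<length ms']"
    using m''[unfolded m m' grpdP_sel(3)[of k]] by simp_all
  have ms'': "\<forall>i<length zss. ms'' ! i = gcomp (grpdP k' G) (ms' ! i) (ms ! \<tau>' i)"
    unfolding ms''_eq using len by simp
  let ?\<pi> = "fst (mu_ar (\<tau>, ms))" and ?\<pi>' = "fst (mu_ar (\<tau>', ms'))" and ?\<pi>'' = "fst (mu_ar (\<tau>'', ms''))"
  let ?f = "snd (mu_ar (\<tau>, ms))" and ?g = "snd (mu_ar (\<tau>', ms'))" and ?h = "snd (mu_ar (\<tau>'', ms''))"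
  have lenc: "length (concat yss) = length (concat zss)" by (rule mu_ar_length(2)[OF g])
  \<comment> \<open>Composition is compared position by position: p lies in some block i of
    \<open>zss\<close>, is read from block \<open>\<tau>' i\<close> of \<open>yss\<close>, and from
    there from a block of \<open>xss\<close>.\<close>
  have *: "?\<pi>'' p = ?\<pi> (?\<pi>' p) \<and> ?h ! p = gcomp G (?g ! p) (?f ! ?\<pi>' p)"
    if "p < length (concat zss)" for p
  proof -
    from that obtain i j where ij: "i < length zss" "j < length (zss ! i)" "p = offset zss i + j"
      by (rule offset_surj)
    note into = into[OF g ij(1,2)]
    obtain \<sigma>' gs where mi': "ms' ! i = (\<sigma>', gs)" by fastforce
    obtain \<sigma> fs where mi: "ms ! \<tau>' i = (\<sigma>, fs)" by fastforce
    have "ms' ! i \<in> hom (grpdP k' G) (yss ! \<tau>' i) (zss ! i)" using g ij by (auto simp: hom_grpdP)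
    then have lgs: "length gs = length (zss ! i)" using mi' by (auto simp: hom_grpdP)
    have "ms'' ! i = (\<sigma> \<circ> \<sigma>', map (\<lambda>i. gcomp G (gs ! i) (fs ! \<sigma>' i)) [0..<length gs])"
      using ms'' ij mi mi' by (simp add: grpdP_sel)
    then show ?thesis
      using into mu_ar_block[OF g ij(1,2)] mu_ar_nth[OF g ij(1,2)] mu_ar_block[OF h ij(1,2)]
        mu_ar_nth[OF h ij(1,2)] mu_ar_block[OF f, of "\<tau>' i" "\<sigma>' j"] mu_ar_nth[OF f, of "\<tau>' i" "\<sigma>' j"]
        ij mi mi' \<tau>'' lgs by simp
  qed
  have "?\<pi>'' = ?\<pi> \<circ> ?\<pi>'"
  proof
    fix p show "?\<pi>'' p = (?\<pi> \<circ> ?\<pi>') p"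
      using *[of p] mu_ar_outside[OF h, of p] mu_ar_outside[OF g, of p] mu_ar_outside[OF f, of p] lenc
      by (cases "p < length (concat zss)") auto
  qed
  moreover have "?h = map (\<lambda>i. gcomp G (?g ! i) (?f ! ?\<pi>' i)) [0..<length ?g]"
    using * mu_ar_length(1)[OF g] mu_ar_length(1)[OF h] by (intro nth_equalityI) auto
  ultimately have "mu_ar (\<tau>'', ms'') = gcomp (grpdP l G) (?\<pi>', ?g) (?\<pi>, ?f)"
    unfolding grpdP_sel by (simp only: prod_eq_iff fst_conv snd_conv simp_thms)
  then show "on_ar muP (gcomp (grpdP k (grpdP k' G)) g f) =
      gcomp (grpdP l G) (on_ar muP g) (on_ar muP f)"
    using m m' m'' by simp
qed

section \<open>Constant, paired and zipped tuples\<close>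

lemma gcomp_pullback: "gcomp (pullback G H F K) (f', g') (f, g) = (gcomp G f' f, gcomp H g' g)"
  by (simp add: pullback_def)

lemma gcomp_prod: "gcomp (prod_grpd G H) (f', g') (f, g) = (gcomp G f' f, gcomp H g' g)"
  by (simp add: prod_grpd_def pullback_def)

lemma is_functor_constP:
  assumes "groupoid G"
  shows "is_functor (prod_grpd G (grpdP k terminal_grpd)) (grpdP k G) constP"
proof (rule is_functorI)
  show "groupoid (prod_grpd G (grpdP k terminal_grpd))" "groupoid (grpdP k G)"
    by (intro groupoid_prod groupoid_grpdP groupoid_terminal assms)+
next
  fix x assume "x \<in> Ob (prod_grpd G (grpdP k terminal_grpd))"
  then show "on_ob constP x \<in> Ob (grpdP k G)" by (auto simp: Ob_prod constP_def grpdP_def)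
next
  fix x y f assume "f \<in> hom (prod_grpd G (grpdP k terminal_grpd)) x y"
  then show "on_ar constP f \<in> hom (grpdP k G) (on_ob constP x) (on_ob constP y)"
    by (cases x; cases y; cases f) (auto simp: hom_prod constP_def hom_grpdP permutes_less_iff)
next
  fix x y z f g
  assume "f \<in> hom (prod_grpd G (grpdP k terminal_grpd)) x y"
    "g \<in> hom (prod_grpd G (grpdP k terminal_grpd)) y z"
  then show "on_ar constP (gcomp (prod_grpd G (grpdP k terminal_grpd)) g f) =
      gcomp (grpdP k G) (on_ar constP g) (on_ar constP f)"
    by (cases x; cases y; cases z; cases f; cases g)
       (auto simp: hom_prod hom_grpdP gcomp_prod constP_def grpdP_sel permutes_less_iff intro!: nth_equalityI)
qed

text \<open>The strength of the tuple monad: in a composition it pairs one arrow of the root with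
  every arrow of the operation grafted onto it.\<close>

definition strengthF :: "('o \<times> 'p list, 'm \<times> 'n parr, ('o \<times> 'p) list, ('m \<times> 'n) parr) gfun" where
  "strengthF = \<lparr>on_ob = (\<lambda>(x, ys). map (Pair x) ys), on_ar = (\<lambda>(f, (\<sigma>, gs)). (\<sigma>, map (Pair f) gs))\<rparr>"

lemma is_functor_strengthF:
  assumes "groupoid G" "groupoid H"
  shows "is_functor (prod_grpd G (grpdP k H)) (grpdP k (prod_grpd G H)) strengthF"
proof (rule is_functorI)
  show "groupoid (prod_grpd G (grpdP k H))" "groupoid (grpdP k (prod_grpd G H))"
    by (intro groupoid_prod groupoid_grpdP assms)+
next
  fix x assume "x \<in> Ob (prod_grpd G (grpdP k H))"
  then show "on_ob strengthF x \<in> Ob (grpdP k (prod_grpd G H))"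
    by (auto simp: strengthF_def grpdP_def Ob_prod)
next
  fix x y f assume "f \<in> hom (prod_grpd G (grpdP k H)) x y"
  then show "on_ar strengthF f \<in> hom (grpdP k (prod_grpd G H)) (on_ob strengthF x) (on_ob strengthF y)"
    by (cases x; cases y; cases f)
       (auto simp: hom_prod strengthF_def hom_grpdP permutes_less_iff)
next
  fix x y z f g
  assume "f \<in> hom (prod_grpd G (grpdP k H)) x y" "g \<in> hom (prod_grpd G (grpdP k H)) y z"
  then show "on_ar strengthF (gcomp (prod_grpd G (grpdP k H)) g f) =
      gcomp (grpdP k (prod_grpd G H)) (on_ar strengthF g) (on_ar strengthF f)"
    by (cases x; cases y; cases z; cases f; cases g)
       (auto simp: hom_prod hom_grpdP gcomp_prod strengthF_def grpdP_sel permutes_less_iff intro!: nth_equalityI)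
qed

text \<open>Intended for a pullback along \<open>mapP\<close> on both sides, where the two tuples
  have the same length and their arrows the same permutation.\<close>

definition zipF :: "('o list \<times> 'p list, 'm parr \<times> 'n parr, ('o \<times> 'p) list, ('m \<times> 'n) parr) gfun" where
  "zipF = \<lparr>on_ob = (\<lambda>(xs, ys). zip xs ys), on_ar = (\<lambda>((\<sigma>, fs), (\<tau>, gs)). (\<tau>, zip fs gs))\<rparr>"

lemma is_functor_zipF:
  assumes F: "is_functor G K F" and E: "is_functor H K E"
  shows "is_functor (pullback (grpdP k G) (grpdP k H) (mapP F) (mapP E)) (grpdP k (prod_grpd G H)) zipF"
    (is "is_functor ?P ?Z _")
proof (rule is_functorI)
  show "groupoid ?P" by (rule groupoid_pullback[OF is_functor_mapP is_functor_mapP]) fact+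
  show "groupoid ?Z" by (intro groupoid_grpdP groupoid_prod functor_dom[OF F] functor_dom[OF E])
next
  fix x assume "x \<in> Ob ?P"
  then obtain xs ys where x: "x = (xs, ys)" "xs \<noteq> []" "ys \<noteq> []" "set xs \<subseteq> Ob G" "set ys \<subseteq> Ob H"
    "map (on_ob F) xs = map (on_ob E) ys"
    by (auto simp: pullback_def grpdP_def mapP_def)
  then show "on_ob zipF x \<in> Ob ?Z"
    using map_eq_imp_length_eq[OF x(6)]
    by (auto simp: zipF_def grpdP_def Ob_prod dest: set_zip_leftD set_zip_rightD)
next
  fix x y f assume f: "f \<in> hom ?P x y"
  obtain xs ys xs' ys' \<sigma> fs \<tau> gs where "x = (xs, ys)" "y = (xs', ys')" "f = ((\<sigma>, fs), (\<tau>, gs))"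
    by (cases x; cases y; cases f; auto)
  moreover from this f have "\<tau> = \<sigma>" "length gs = length fs"
    by (auto simp: hom_pullback mapP_def dest: map_eq_imp_length_eq)
  ultimately show "on_ar zipF f \<in> hom ?Z (on_ob zipF x) (on_ob zipF y)"
    using f by (auto simp: hom_pullback hom_grpdP zipF_def hom_prod permutes_less_iff)
next
  fix x y z f g assume f: "f \<in> hom ?P x y" and g: "g \<in> hom ?P y z"
  obtain \<sigma> fs \<sigma>' fs' where fe: "f = ((\<sigma>, fs), (\<sigma>', fs'))" by (cases f; auto)
  obtain \<tau> gs \<tau>' gs' where ge: "g = ((\<tau>, gs), (\<tau>', gs'))" by (cases g; auto)
  obtain xs ys xs' ys' xs'' ys'' where xe: "x = (xs, ys)" "y = (xs', ys')" "z = (xs'', ys'')"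
    by (cases x; cases y; cases z; auto)
  have len: "length fs' = length fs" "length gs' = length gs"
    using f g unfolding fe ge xe by (auto simp: hom_pullback mapP_def dest: map_eq_imp_length_eq)
  have gl: "\<tau> permutes {..<length gs}" "length gs = length fs" "\<tau>' = \<tau>" "\<sigma>' = \<sigma>"
    using f g unfolding fe ge xe by (auto simp: hom_pullback hom_grpdP mapP_def)
  have "map (\<lambda>i. gcomp (prod_grpd G H) (zip gs gs' ! i) (zip fs fs' ! \<tau> i)) [0..<length (zip gs gs')] =
      zip (map (\<lambda>i. gcomp G (gs ! i) (fs ! \<tau> i)) [0..<length gs])
        (map (\<lambda>i. gcomp H (gs' ! i) (fs' ! \<tau> i)) [0..<length gs'])"
    by (rule nth_equalityI)
       (use len gl(2) permutes_less_iff[OF gl(1)] in \<open>simp_all add: gcomp_prod\<close>)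
  then show "on_ar zipF (gcomp ?P g f) = gcomp ?Z (on_ar zipF g) (on_ar zipF f)"
    unfolding fe ge gcomp_pullback grpdP_sel by (simp add: zipF_def grpdP_sel gl(3))
qed

section \<open>Counting arrows in skeletal groupoids\<close>

text \<open>Isomorphic objects coincide, so \<open>indeg\<close> is the order of the automorphism
  group. The levels of the bar construction have this property before the outer \<open>Sr\<close> is
  applied; in general reorderings destroy it.\<close>

definition skeletal :: "('o, 'm) grpd \<Rightarrow> bool" where
  "skeletal G \<longleftrightarrow> (\<forall>f\<in>Ar G. gdom G f = gcod G f)"

lemma skeletal_terminal: "skeletal terminal_grpd"
  by (simp add: skeletal_def terminal_grpd_def)

text \<open>A reordered tuple of units is the same tuple, so even the symmetries of
  \<open>Sr\<close> are automorphisms here.\<close>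

lemma skeletal_grpdP_terminal: "skeletal (grpdP k terminal_grpd)"
  unfolding skeletal_def grpdP_def by (auto intro!: nth_equalityI)

lemma skeletal_grpdP_Mr: "skeletal G \<Longrightarrow> skeletal (grpdP Mr G)"
  unfolding skeletal_def grpdP_def by (auto simp: subset_code(1) intro!: nth_equalityI)

lemma skeletal_pullback: "skeletal G \<Longrightarrow> skeletal H \<Longrightarrow> skeletal (pullback G H F K)"
  by (auto simp: skeletal_def pullback_def)

lemma skeletal_prod: "skeletal G \<Longrightarrow> skeletal H \<Longrightarrow> skeletal (prod_grpd G H)"
  by (simp add: prod_grpd_def skeletal_pullback)

lemma (in relabelling) skeletal_relabel: "skeletal G \<Longrightarrow> skeletal (relabel F F' G)"
  by (auto simp: skeletal_def relabel_def)

lemma indeg_prod: "indeg (prod_grpd G H) (x, y) = indeg G x * indeg H y"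
proof -
  have "{f \<in> Ar (prod_grpd G H). gcod (prod_grpd G H) f = (x, y)} =
      {f \<in> Ar G. gcod G f = x} \<times> {f \<in> Ar H. gcod H f = y}"
    by (auto simp: prod_grpd_def pullback_def bangF_def)
  then show ?thesis by (simp add: indeg_def card_cartesian_product)
qed

lemma mem_listset_iff: "ys \<in> listset As \<longleftrightarrow> list_all2 (\<in>) ys As"
  by (induction As arbitrary: ys) (auto simp: set_Cons_def list_all2_Cons2)

lemma listset_Cons_eq: "listset (A # As) = (\<lambda>(x, xs). x # xs) ` (A \<times> listset As)"
  by (auto simp: set_Cons_def)

lemma card_listset: "card (listset As) = prod_list (map card As)"
proof (induction As)
  case (Cons A As)
  then show ?case unfolding listset_Cons_eq
    by (subst card_image) (auto simp: inj_on_def card_cartesian_product)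
qed simp

lemma finite_listset: "\<forall>A\<in>set As. finite A \<Longrightarrow> finite (listset As)"
proof (induction As)
  case (Cons A As)
  then show ?case unfolding listset_Cons_eq by simp
qed simp

lemma arrows_into_tuple:
  assumes "\<sigma> permutes {..<length ys}" "k = Mr \<longrightarrow> \<sigma> = id" "ys \<noteq> []"
  shows "(\<sigma>, fs) \<in> Ar (grpdP k G) \<and> gcod (grpdP k G) (\<sigma>, fs) = ys \<longleftrightarrow>
    fs \<in> listset (map (\<lambda>y. {f \<in> Ar G. gcod G f = y}) ys)"
  using assms by (auto simp: grpdP_def mem_listset_iff list_all2_conv_all_nth set_conv_nth intro: nth_equalityI)

text \<open>A permutation and one arrow into each entry can be chosen freely, because the source of
  the arrow is not prescribed.\<close>

lemma indeg_grpdP: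
  assumes "ys \<noteq> []"
  shows "indeg (grpdP k G) ys = (if k = Sr then fact (length ys) else 1) * prod_list (map (indeg G) ys)"
proof -
  let ?P = "{\<sigma>. \<sigma> permutes {..<length ys} \<and> (k = Mr \<longrightarrow> \<sigma> = id)}"
  let ?L = "listset (map (\<lambda>y. {f \<in> Ar G. gcod G f = y}) ys)"
  have "{f \<in> Ar (grpdP k G). gcod (grpdP k G) f = ys} = ?P \<times> ?L"
  proof (rule set_eqI, clarify)
    fix \<sigma> fs
    have "\<sigma> \<in> ?P" if "(\<sigma>, fs) \<in> Ar (grpdP k G)" "gcod (grpdP k G) (\<sigma>, fs) = ys"
      using that by (auto simp: grpdP_def)
    then show "(\<sigma>, fs) \<in> {f \<in> Ar (grpdP k G). gcod (grpdP k G) f = ys} \<longleftrightarrow> (\<sigma>, fs) \<in> ?P \<times> ?L"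
      using arrows_into_tuple[OF _ _ assms, of \<sigma> k fs G] by auto
  qed
  moreover have "card ?P = (if k = Sr then fact (length ys) else 1)"
  proof (cases k)
    case Mr
    then have "?P = {id}" by (auto simp: permutes_id)
    then show ?thesis using Mr by simp
  qed (simp add: card_permutations[of _ "length ys"])
  ultimately show ?thesis
    by (simp add: indeg_def[abs_def] card_cartesian_product card_listset o_def)
qed

text \<open>Since G has only automorphisms, the permutation alone must carry xs to ys; the
  components are then arbitrary automorphisms of the entries of ys.\<close>

lemma card_hom_Sr:
  assumes G: "skeletal G" and ne: "ys \<noteq> []"
  shows "card (hom (grpdP Sr G) xs ys) =
    card {\<sigma>. \<sigma> permutes {..<length xs} \<and> permute_list \<sigma> xs = ys} * prod_list (map (indeg G) ys)"
proof -
  let ?P = "{\<sigma>. \<sigma> permutes {..<length xs} \<and> permute_list \<sigma> xs = ys}"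
  let ?L = "listset (map (\<lambda>y. {f \<in> Ar G. gcod G f = y}) ys)"
  have "hom (grpdP Sr G) xs ys = ?P \<times> ?L"
  proof (rule set_eqI, clarify)
    fix \<sigma> fs
    have eq: "f \<in> hom G x y \<longleftrightarrow> x = y \<and> f \<in> Ar G \<and> gcod G f = y" for f x y
      using G by (auto simp: hom_def skeletal_def)
    have 1: "permute_list \<sigma> xs = ys \<longleftrightarrow> length xs = length ys \<and> (\<forall>i<length xs. xs ! \<sigma> i = ys ! i)"
      by (auto simp: permute_list_def intro!: nth_equalityI)
    have 2: "fs \<in> ?L \<longleftrightarrow> length fs = length ys \<and> (\<forall>i<length ys. fs ! i \<in> Ar G \<and> gcod G (fs ! i) = ys ! i)"
      by (auto simp: mem_listset_iff list_all2_conv_all_nth)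
    show "(\<sigma>, fs) \<in> hom (grpdP Sr G) xs ys \<longleftrightarrow> (\<sigma>, fs) \<in> ?P \<times> ?L"
      unfolding hom_grpdP eq mem_Sigma_iff mem_Collect_eq 1 2 using ne
      by (intro iffI conjI; elim conjE; simp) (metis length_0_conv)
  qed
  then show ?thesis by (simp add: indeg_def[abs_def] card_cartesian_product card_listset o_def)
qed

lemma hom_Sr_ne_iff:
  assumes G: "groupoid G" "skeletal G" and ys: "ys \<in> Ob (grpdP Sr G)"
  shows "hom (grpdP Sr G) xs ys \<noteq> {} \<longleftrightarrow> mset xs = mset ys"
proof
  assume "hom (grpdP Sr G) xs ys \<noteq> {}"
  then obtain \<sigma> fs where f: "(\<sigma>, fs) \<in> hom (grpdP Sr G) xs ys" by fastforce
  have "\<forall>i<length xs. xs ! \<sigma> i = ys ! i"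
    using f G(2) unfolding hom_grpdP by (auto simp: hom_def skeletal_def)
  then have "permute_list \<sigma> xs = ys" "\<sigma> permutes {..<length xs}"
    using f by (auto simp: permute_list_def hom_grpdP intro!: nth_equalityI)
  then show "mset xs = mset ys" by auto
next
  assume "mset xs = mset ys"
  then obtain \<sigma> where \<sigma>: "\<sigma> permutes {..<length xs}" "permute_list \<sigma> xs = ys"
    by (metis mset_eq_permutation)
  interpret G: groupoid G by (rule G)
  have "gid G (ys ! i) \<in> hom G (xs ! \<sigma> i) (ys ! i)" if "i < length xs" for i
    using permute_list_nth[OF \<sigma>(1) that] \<sigma>(2) G.id_hom[of "ys ! i"] ys that nth_mem[of i ys]
    by (auto simp: grpdP_sel)
  moreover have "length ys = length xs" using \<sigma>(2) by auto
  ultimately have "(\<sigma>, map (gid G) ys) \<in> hom (grpdP Sr G) xs ys"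
    using \<sigma>(1) ys by (auto simp: hom_grpdP grpdP_sel)
  then show "hom (grpdP Sr G) xs ys \<noteq> {}" by blast
qed

lemma permute_list_Ob_iff:
  assumes "\<sigma> permutes {..<length xs}"
  shows "permute_list \<sigma> xs \<in> Ob (grpdP k G) \<longleftrightarrow> xs \<in> Ob (grpdP k G)"
  using set_permute_list[OF assms] by (metis (mono_tags) grpdP_sel(1) mem_Collect_eq set_empty)

lemma permute_list_inv:
  assumes "\<sigma> permutes {..<length xs}"
  shows "permute_list (inv \<sigma>) (permute_list \<sigma> xs) = xs" "permute_list \<sigma> (permute_list (inv \<sigma>) xs) = xs"
  using permute_list_compose[of "inv \<sigma>" xs \<sigma>] permute_list_compose[of \<sigma> xs "inv \<sigma>"]
    assms permutes_inv[OF assms]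
  by (simp_all add: permutes_inv_o[OF assms])

text \<open>Both sides count tuples over \<open>f\<close>, up to reordering on the left.  An arrow into \<open>f\<close> contains a
  permutation; moving it to the tuple makes the summands independent of it, which cancels the
  factorial in the number of arrows into the tuple.\<close>

lemma sum_symmetric_fibre:
  fixes c :: "('o, 'm, 'p, 'n) gfun"
  assumes H: "skeletal H" and f: "f \<noteq> []"
    and fin: "\<And>w. w \<in> set f \<Longrightarrow> finite {x \<in> Ob G. on_ob c x = w}"
    and P: "\<And>xs \<sigma>. \<sigma> permutes {..<length xs} \<Longrightarrow> P (permute_list \<sigma> xs) \<longleftrightarrow> P xs"
  defines "S \<equiv> {xs \<in> Ob (grpdP Sr G). mset (map (on_ob c) xs) = mset f}"
  shows "finite S"
    and "(\<Sum>xs\<in>{xs\<in>S. P xs}. of_nat (card (hom (grpdP Sr H) (on_ob (mapP c) xs) f)) /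
           of_nat (indeg (grpdP Sr G) xs)) =
      (\<Sum>xs\<in>{xs\<in>Ob (grpdP Sr G). map (on_ob c) xs = f \<and> P xs}.
         of_nat (prod_list (map (indeg H) f)) / of_nat (prod_list (map (indeg G) xs)) :: rat)"
proof -
  let ?n = "length f"
  let ?U = "\<Union>w\<in>set f. {x \<in> Ob G. on_ob c x = w}"
  have "S \<subseteq> {xs. set xs \<subseteq> ?U \<and> length xs = ?n}"
  proof
    fix xs assume "xs \<in> S"
    then have "set xs \<subseteq> Ob G" "mset (map (on_ob c) xs) = mset f" by (auto simp: S_def grpdP_sel)
    then have "set xs \<subseteq> ?U" "length xs = ?n"
      using mset_eq_setD[of "map (on_ob c) xs" f] mset_eq_length[of "map (on_ob c) xs" f] by auto
    then show "xs \<in> {xs. set xs \<subseteq> ?U \<and> length xs = ?n}" by simp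
  qed
  then show S: "finite S"
    using fin finite_lists_length_eq[of ?U ?n] by (auto intro: finite_subset)
  let ?T = "{xs\<in>S. P xs}" and ?Perm = "{\<sigma>. \<sigma> permutes {..<?n}}"
  let ?Y = "{xs\<in>Ob (grpdP Sr G). map (on_ob c) xs = f \<and> P xs}"
  let ?W = "\<lambda>xs. of_nat (prod_list (map (indeg H) f)) / of_nat (fact ?n * prod_list (map (indeg G) xs)) :: rat"
  have len: "length xs = ?n" if "xs \<in> S" for xs
    using that mset_eq_length[of "map (on_ob c) xs" f] by (auto simp: S_def)
  have "(\<Sum>xs\<in>?T. of_nat (card (hom (grpdP Sr H) (on_ob (mapP c) xs) f)) /
        of_nat (indeg (grpdP Sr G) xs)) =
      (\<Sum>xs\<in>?T. \<Sum>\<sigma>\<in>{\<sigma>. \<sigma> \<in> ?Perm \<and> permute_list \<sigma> (map (on_ob c) xs) = f}. ?W xs)"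
  proof (rule sum.cong[OF refl])
    fix xs assume "xs \<in> ?T"
    then have "xs \<noteq> []" "length xs = ?n" using len by (auto simp: S_def grpdP_sel)
    then show "of_nat (card (hom (grpdP Sr H) (on_ob (mapP c) xs) f)) / of_nat (indeg (grpdP Sr G) xs) =
        (\<Sum>\<sigma>\<in>{\<sigma>. \<sigma> \<in> ?Perm \<and> permute_list \<sigma> (map (on_ob c) xs) = f}. ?W xs)"
      by (simp add: mapP_def card_hom_Sr[OF H f] indeg_grpdP)
  qed
  also have "\<dots> = (\<Sum>\<sigma>\<in>?Perm. \<Sum>xs\<in>{xs. xs \<in> ?T \<and> permute_list \<sigma> (map (on_ob c) xs) = f}. ?W xs)"
    by (rule sum.swap_restrict) (use S finite_permutations[of "{..<?n}"] in auto)
  also have "\<dots> = (\<Sum>\<sigma>\<in>?Perm. \<Sum>xs\<in>?Y. ?W xs)"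
  proof (rule sum.cong[OF refl])
    fix \<sigma> assume "\<sigma> \<in> ?Perm"
    then have \<sigma>: "\<sigma> permutes {..<?n}" by simp
    note inv = permutes_inv[OF \<sigma>]
    note ob = permute_list_Ob_iff[where k = Sr and G = G]
    show "(\<Sum>xs\<in>{xs. xs \<in> ?T \<and> permute_list \<sigma> (map (on_ob c) xs) = f}. ?W xs) = (\<Sum>xs\<in>?Y. ?W xs)"
    proof (rule sum.reindex_bij_witness[of _ "permute_list (inv \<sigma>)" "permute_list \<sigma>"])
      fix xs assume xs: "xs \<in> {xs. xs \<in> ?T \<and> permute_list \<sigma> (map (on_ob c) xs) = f}"
      then have l: "length xs = ?n" using len by simp
      show "permute_list (inv \<sigma>) (permute_list \<sigma> xs) = xs" by (rule permute_list_inv) (use \<sigma> l in simp)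
      show "permute_list \<sigma> xs \<in> ?Y"
        using xs \<sigma> l P[of \<sigma> xs] ob[of \<sigma> xs] by (simp add: S_def permute_list_map)
      have "prod_list (map (indeg G) (permute_list \<sigma> xs)) = prod_list (map (indeg G) xs)"
        using \<sigma> l by (intro prod_mset_prod_list[symmetric, THEN trans] trans[OF _ prod_mset_prod_list]) simp
      then show "?W (permute_list \<sigma> xs) = ?W xs" by simp
    next
      fix xs assume xs: "xs \<in> ?Y"
      then have l: "length xs = ?n" by auto
      show "permute_list \<sigma> (permute_list (inv \<sigma>) xs) = xs" by (rule permute_list_inv) (use \<sigma> l in simp)
      have "map (on_ob c) (permute_list (inv \<sigma>) xs) = permute_list (inv \<sigma>) f"
        using xs inv l by (auto simp: permute_list_map[symmetric])
      then have "permute_list \<sigma> (map (on_ob c) (permute_list (inv \<sigma>) xs)) = f"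
        "mset (map (on_ob c) (permute_list (inv \<sigma>) xs)) = mset f"
        using permute_list_inv(2)[OF \<sigma>] inv by simp_all
      then show "permute_list (inv \<sigma>) xs \<in> {xs. xs \<in> ?T \<and> permute_list \<sigma> (map (on_ob c) xs) = f}"
        using xs inv l P[of "inv \<sigma>" xs] ob[of "inv \<sigma>" xs] by (simp add: S_def)
    qed
  qed
  also have "\<dots> = (\<Sum>xs\<in>?Y. of_nat (fact ?n) * ?W xs)"
    by (simp add: card_permutations[of _ ?n] sum_distrib_left del: of_nat_fact)
  also have "\<dots> = (\<Sum>xs\<in>?Y. of_nat (prod_list (map (indeg H) f)) / of_nat (prod_list (map (indeg G) xs)))"
    by (intro sum.cong refl) simp
  finally show "(\<Sum>xs\<in>?T. of_nat (card (hom (grpdP Sr H) (on_ob (mapP c) xs) f)) /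
      of_nat (indeg (grpdP Sr G) xs)) =
    (\<Sum>xs\<in>?Y. of_nat (prod_list (map (indeg H) f)) / of_nat (prod_list (map (indeg G) xs)) :: rat)" .
qed

section \<open>Incidence comultiplication and counit of a symmetric bar construction\<close>

abbreviation "keys \<equiv> Poly_Mapping.keys"
abbreviation "lookup \<equiv> Poly_Mapping.lookup"
abbreviation "single \<equiv> Poly_Mapping.single"

lemma single_sum: "single k (sum f A) = (\<Sum>a\<in>A. single k (f a))"
  by (induction A rule: infinite_finite_induct) (simp_all add: single_add)

text \<open>For a bar construction, \<open>c\<close> composes the two levels of a tree and \<open>s\<close> inserts units.\<close>

locale symmetric_bar =
  fixes X :: "('o list, 'm parr) sgrpd"
    and G0 G1 G2 :: "('o, 'm) grpd" and c s :: "('o, 'm, 'o, 'm) gfun"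
  assumes lev: "lev X 0 = grpdP Sr G0" "lev X 1 = grpdP Sr G1" "lev X 2 = grpdP Sr G2"
    and faces: "face X 2 1 = mapP c" "degen X 0 0 = mapP s"
    and c: "is_functor G2 G1 c" and s: "is_functor G0 G1 s"
    and d2: "is_functor (grpdP Sr G2) (grpdP Sr G1) (face X 2 2)"
    and d0: "is_functor (grpdP Sr G2) (grpdP Sr G1) (face X 2 0)"
    and skel: "skeletal G0" "skeletal G1" "skeletal G2"
    and pos0: "x \<in> Ob G0 \<Longrightarrow> indeg G0 x > 0" and pos1: "y \<in> Ob G1 \<Longrightarrow> indeg G1 y > 0"
    and pos2: "z \<in> Ob G2 \<Longrightarrow> indeg G2 z > 0"
    and finc: "y \<in> Ob G1 \<Longrightarrow> finite {z \<in> Ob G2. on_ob c z = y}"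
    and fins: "y \<in> Ob G1 \<Longrightarrow> finite {z \<in> Ob G0. on_ob s z = y}"
begin

abbreviation "S0 \<equiv> grpdP Sr G0"
abbreviation "S1 \<equiv> grpdP Sr G1"
abbreviation "S2 \<equiv> grpdP Sr G2"

sublocale G1: groupoid G1 by (rule functor_cod[OF c])
sublocale S1: groupoid S1 by (rule functor_cod[OF d0])
sublocale S2: groupoid S2 by (rule functor_dom[OF d0])

lemma indeg_Sr_pos:
  assumes "\<And>x. x \<in> Ob G \<Longrightarrow> indeg G x > 0" "xs \<in> Ob (grpdP Sr G)"
  shows "indeg (grpdP Sr G) xs > 0"
proof -
  have "prod_list (map (indeg G) ys) > 0" if "set ys \<subseteq> Ob G" for ys
    using that assms(1) by (induction ys) auto
  then show ?thesis using assms(2) by (auto simp: indeg_grpdP grpdP_sel)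
qed

lemma finite_aut_S1: "f \<in> Ob S1 \<Longrightarrow> finite (aut S1 f)"
  using indeg_pos_finite_hom[OF indeg_Sr_pos[OF pos1]] by (simp add: aut_def)

lemma card_aut_S1: "f \<in> Ob S1 \<Longrightarrow> card (aut S1 f) > 0"
  using finite_aut_S1[of f] S1.id_hom[of f] by (auto simp: aut_def card_gt_0_iff)

lemma iso_S1_iff: "ys \<in> Ob S1 \<Longrightarrow> hom S1 xs ys \<noteq> {} \<longleftrightarrow> mset xs = mset ys"
  by (rule hom_Sr_ne_iff[OF G1.groupoid_axioms skel(2)])

lemma pi0_S1_iff: "A \<in> pi0 S1 \<Longrightarrow> x \<in> A \<Longrightarrow> y \<in> A \<longleftrightarrow> y \<in> Ob S1 \<and> mset x = mset y"
  using S1.pi0_iff[of A x y] iso_S1_iff[of y x] S1.hom_ob S1.pi0_sub[of A] by blast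

lemma permute_iso:
  assumes "\<sigma> permutes {..<length xs}" "xs \<in> Ob S2"
  shows "hom S2 xs (permute_list \<sigma> xs) \<noteq> {}" "permute_list \<sigma> xs \<in> Ob S2"
proof -
  show ob: "permute_list \<sigma> xs \<in> Ob S2" using assms by (simp add: permute_list_Ob_iff)
  show "hom S2 xs (permute_list \<sigma> xs) \<noteq> {}"
    by (rule hom_Sr_ne_iff[OF functor_dom[OF c] skel(3) ob, THEN iffD2]) (use assms in simp)
qed

lemma counit_fibre_hfinite_hcard:
  assumes f: "f \<in> Ob S1"
  shows "hfinite (counit_fibre X f)"
    and "hcard (counit_fibre X f) = (\<Sum>xs\<in>{xs\<in>Ob S0. map (on_ob s) xs = f}.
      of_nat (prod_list (map (indeg G1) f)) / of_nat (prod_list (map (indeg G0) xs)))"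
proof -
  have ne: "f \<noteq> []" and sub: "set f \<subseteq> Ob G1" using f by (auto simp: grpdP_sel)
  let ?S = "{xs \<in> Ob S0. mset (map (on_ob s) xs) = mset f}"
  note sym = sum_symmetric_fibre[OF skel(2) ne, of G0 s "\<lambda>_. True"]
  have fin: "finite ?S" by (rule sym(1)) (use sub fins in auto)
  have F: "is_functor S0 S1 (mapP s)" by (rule is_functor_mapP[OF s])
  have S: "{xs \<in> Ob S0. hom S1 (on_ob (mapP s) xs) f \<noteq> {}} \<subseteq> ?S"
    using iso_S1_iff[OF f] by (auto simp: mapP_def)
  note h = hcard_hfib[OF F fin S _ indeg_Sr_pos[OF pos0] indeg_Sr_pos[OF pos1 f]]
  show "hfinite (counit_fibre X f)"
    unfolding counit_fibre_def lev faces by (rule h(2)) auto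
  have "hcard (counit_fibre X f) = (\<Sum>xs\<in>?S. of_nat (card (hom S1 (on_ob (mapP s) xs) f)) / of_nat (indeg S0 xs))"
    unfolding counit_fibre_def lev faces by (rule h(3)) auto
  also have "\<dots> = (\<Sum>xs\<in>{xs\<in>Ob S0. map (on_ob s) xs = f}.
      of_nat (prod_list (map (indeg G1) f)) / of_nat (prod_list (map (indeg G0) xs)))"
    using sym(2) sub fins by simp (metis (no_types, lifting) subsetD)
  finally show "hcard (counit_fibre X f) = \<dots>" .
qed

text \<open>The fibre is iterated, so \<open>hcard_hfib\<close> is applied twice; the inner fibre
  has the arrow counts of \<open>S2\<close>. The outer one contributes the two automorphism groups
  as factors, and \<open>sum_symmetric_fibre\<close> turns what remains into a count over the strict
  fibre.\<close>

lemma comult_fibre_hfinite_hcard: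
  assumes f: "f \<in> Ob S1" and a: "a \<in> Ob S1" and b: "b \<in> Ob S1"
  shows "hfinite (comult_fibre X f a b)"
    and "hcard (comult_fibre X f a b) =
      of_nat (card (aut S1 a)) * of_nat (card (aut S1 b)) *
      (\<Sum>xs\<in>{xs\<in>Ob S2. map (on_ob c) xs = f \<and> mset (on_ob (face X 2 2) xs) = mset a \<and>
           mset (on_ob (face X 2 0) xs) = mset b}.
        of_nat (prod_list (map (indeg G1) f)) / of_nat (prod_list (map (indeg G2) xs)))"
proof -
  have ne: "f \<noteq> []" and sub: "set f \<subseteq> Ob G1" using f by (auto simp: grpdP_sel)
  let ?S = "{xs \<in> Ob S2. mset (map (on_ob c) xs) = mset f}"
  let ?P = "\<lambda>xs. xs \<in> Ob S2 \<and> mset (on_ob (face X 2 2) xs) = mset a \<and> mset (on_ob (face X 2 0) xs) = mset b"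
  \<comment> \<open>Reordering a tuple of trees is an isomorphism, and both outer faces are functors
    into \<open>S1\<close>, where isomorphic tuples have equal multisets.\<close>
  have P: "?P (permute_list \<sigma> xs) \<longleftrightarrow> ?P xs" if \<sigma>: "\<sigma> permutes {..<length xs}" for xs \<sigma>
  proof -
    note ob = permute_list_Ob_iff[OF \<sigma>, of Sr G2]
    have "mset (on_ob F xs) = mset (on_ob F (permute_list \<sigma> xs))"
      if x: "xs \<in> Ob S2" and F: "is_functor S2 S1 F" for F
    proof -
      obtain h where "h \<in> hom S2 xs (permute_list \<sigma> xs)" using permute_iso[OF \<sigma> x] by blast
      then have "hom S1 (on_ob F xs) (on_ob F (permute_list \<sigma> xs)) \<noteq> {}"
        using functor_hom[OF F] by blast
      then show ?thesis using iso_S1_iff functor_ob[OF F permute_iso(2)[OF \<sigma> x]] by blast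
    qed
    then show ?thesis using ob d0 d2 by metis
  qed
  note sym = sum_symmetric_fibre[OF skel(2) ne _ P, of G2 c]
  have fin: "finite ?S" by (rule sym(1)) (use sub finc in auto)
  have F: "is_functor S2 S1 (mapP c)" by (rule is_functor_mapP[OF c])
  have S: "{xs \<in> Ob S2. hom S1 (on_ob (mapP c) xs) f \<noteq> {}} \<subseteq> ?S"
    using iso_S1_iff[OF f] by (auto simp: mapP_def)
  let ?K = "hfib S2 S1 (mapP c) f"
  have pos2': "indeg S2 xs > 0" if "xs \<in> Ob S2" for xs by (rule indeg_Sr_pos[OF pos2 that])
  note posf = indeg_Sr_pos[OF pos1 f]
  have finK: "finite (Ob ?K)" by (rule hcard_hfib(1)[OF F fin S _ pos2' posf]) auto
  have E: "is_functor ?K (prod_grpd S1 S1) (pairF (face X 2 2) (face X 2 0) \<odot> hfib_pr)"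
    by (rule is_functor_compF[OF is_functor_hfib_pr[OF F] is_functor_prod_pairF[OF d2 d0]])
  have posK: "indeg ?K u > 0" if "u \<in> Ob ?K" for u
    using that indeg_hfib[OF F, of "fst u" "snd u"] pos2' by (auto simp: Ob_hfib)
  have posab: "indeg (prod_grpd S1 S1) (a, b) > 0"
    using indeg_Sr_pos[OF pos1 a] indeg_Sr_pos[OF pos1 b] by (simp add: indeg_prod)
  note h = hcard_hfib[OF E finK _ subset_refl posK posab]
  show "hfinite (comult_fibre X f a b)"
    unfolding comult_fibre_def lev faces by (rule h(2)) auto
  let ?d2 = "on_ob (face X 2 2)" and ?d0 = "on_ob (face X 2 0)"
  have "hcard (comult_fibre X f a b) = (\<Sum>u\<in>Ob ?K. of_nat (card (hom (prod_grpd S1 S1)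
      (on_ob (pairF (face X 2 2) (face X 2 0) \<odot> hfib_pr) u) (a, b))) / of_nat (indeg ?K u))"
    unfolding comult_fibre_def lev faces by (rule h(3)) auto
  also have "\<dots> = (\<Sum>(xs, \<beta>)\<in>(SIGMA xs:?S. hom S1 (on_ob (mapP c) xs) f).
      of_nat (card (hom S1 (?d2 xs) a)) * of_nat (card (hom S1 (?d0 xs) b)) / of_nat (indeg S2 xs))"
  proof (rule sum.cong)
    show "Ob ?K = (SIGMA xs:?S. hom S1 (on_ob (mapP c) xs) f)"
      using S by (auto simp: Ob_hfib)
  next
    fix u assume "u \<in> (SIGMA xs:?S. hom S1 (on_ob (mapP c) xs) f)"
    then show "of_nat (card (hom (prod_grpd S1 S1)
      (on_ob (pairF (face X 2 2) (face X 2 0) \<odot> hfib_pr) u) (a, b))) / of_nat (indeg ?K u) =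
      (case u of (xs, \<beta>) \<Rightarrow> of_nat (card (hom S1 (?d2 xs) a)) * of_nat (card (hom S1 (?d0 xs) b)) / of_nat (indeg S2 xs))"
      by (auto simp: indeg_hfib[OF F] Ob_hfib compF_def pairF_def hfib_pr_def hom_prod card_cartesian_product)
  qed
  also have "\<dots> = (\<Sum>xs\<in>?S. of_nat (card (hom S1 (on_ob (mapP c) xs) f)) *
      (of_nat (card (hom S1 (?d2 xs) a)) * of_nat (card (hom S1 (?d0 xs) b)) / of_nat (indeg S2 xs)))"
    by (subst sum.Sigma[symmetric]) (use fin indeg_pos_finite_hom[OF posf] in auto)
  \<comment> \<open>A nonempty hom set into an object has as many elements as its automorphism
    group, so each face either contributes a constant or kills the summand.\<close>
  also have "\<dots> = (\<Sum>xs\<in>?S. if ?P xs then of_nat (card (aut S1 a)) * of_nat (card (aut S1 b)) *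
      (of_nat (card (hom S1 (on_ob (mapP c) xs) f)) / of_nat (indeg S2 xs)) else 0)"
  proof (rule sum.cong[OF refl])
    fix xs assume xs: "xs \<in> ?S"
    have 1: "card (hom S1 u v) = (if mset u = mset v then card (aut S1 v) else 0)" if v: "v \<in> Ob S1" for u v
    proof (cases "mset u = mset v")
      case True
      then obtain h where "h \<in> hom S1 u v" using iso_S1_iff[OF v] by blast
      then show ?thesis using True S1.card_hom_aut(1) by simp
    next
      case False
      then have "hom S1 u v = {}" using iso_S1_iff[OF v] by blast
      then show ?thesis using False by simp
    qed
    show "of_nat (card (hom S1 (on_ob (mapP c) xs) f)) *
      (of_nat (card (hom S1 (?d2 xs) a)) * of_nat (card (hom S1 (?d0 xs) b)) / of_nat (indeg S2 xs)) =
      (if ?P xs then of_nat (card (aut S1 a)) * of_nat (card (aut S1 b)) *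
      (of_nat (card (hom S1 (on_ob (mapP c) xs) f)) / of_nat (indeg S2 xs)) else 0 :: rat)"
      using xs unfolding 1[OF a] 1[OF b] by simp
  qed
  also have "\<dots> = of_nat (card (aut S1 a)) * of_nat (card (aut S1 b)) *
      (\<Sum>xs\<in>{xs\<in>?S. ?P xs}. of_nat (card (hom S1 (on_ob (mapP c) xs) f)) / of_nat (indeg S2 xs))"
    unfolding sum.inter_filter[OF fin, symmetric] sum_distrib_left[symmetric] ..
  also have "(\<Sum>xs\<in>{xs\<in>?S. ?P xs}. of_nat (card (hom S1 (on_ob (mapP c) xs) f)) / of_nat (indeg S2 xs)) =
    (\<Sum>xs\<in>{xs\<in>Ob S2. map (on_ob c) xs = f \<and> ?P xs}.
        of_nat (prod_list (map (indeg G1) f)) / of_nat (prod_list (map (indeg G2) xs)) :: rat)"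
    by (rule sym(2)) (use sub finc in auto)
  also have "{xs\<in>Ob S2. map (on_ob c) xs = f \<and> ?P xs} = {xs\<in>Ob S2. map (on_ob c) xs = f \<and>
      mset (?d2 xs) = mset a \<and> mset (?d0 xs) = mset b}" by auto
  finally show "hcard (comult_fibre X f a b) = of_nat (card (aut S1 a)) * of_nat (card (aut S1 b)) *
      (\<Sum>xs\<in>{xs\<in>Ob S2. map (on_ob c) xs = f \<and> mset (?d2 xs) = mset a \<and> mset (?d0 xs) = mset b}.
        of_nat (prod_list (map (indeg G1) f)) / of_nat (prod_list (map (indeg G2) xs)))" .
qed

text \<open>The division in \<open>comult_coeff\<close> cancels the automorphism groups produced by
  the outer fibre, and having the multiset of a representative means lying in its class.\<close>

lemma comult_coeff_eq:
  assumes C: "C \<in> pi0 S1" and A: "A \<in> pi0 S1" and B: "B \<in> pi0 S1"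
  shows "comult_coeff X C A B =
      (\<Sum>xs\<in>{xs\<in>Ob S2. map (on_ob c) xs = rep C \<and> on_ob (face X 2 2) xs \<in> A \<and> on_ob (face X 2 0) xs \<in> B}.
        of_nat (prod_list (map (indeg G1) (rep C))) / of_nat (prod_list (map (indeg G2) xs)))"
proof -
  have eq: "{xs\<in>Ob S2. map (on_ob c) xs = rep C \<and> mset (on_ob (face X 2 2) xs) = mset (rep A) \<and>
      mset (on_ob (face X 2 0) xs) = mset (rep B)} =
    {xs\<in>Ob S2. map (on_ob c) xs = rep C \<and> on_ob (face X 2 2) xs \<in> A \<and> on_ob (face X 2 0) xs \<in> B}"
    using pi0_S1_iff[OF A S1.rep_in[OF A]] pi0_S1_iff[OF B S1.rep_in[OF B]]
      functor_ob[OF d2] functor_ob[OF d0] by (intro Collect_cong) metis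
  show ?thesis
    unfolding comult_coeff_def lev
      comult_fibre_hfinite_hcard(2)[OF S1.rep_ob[OF C] S1.rep_ob[OF A] S1.rep_ob[OF B]] eq
    using card_aut_S1[OF S1.rep_ob[OF A]] card_aut_S1[OF S1.rep_ob[OF B]] by simp
qed

lemma finite_over: "f \<in> Ob S1 \<Longrightarrow> finite {xs\<in>Ob S2. map (on_ob c) xs = f}"
proof (rule finite_subset)
  assume "f \<in> Ob S1"
  then show "finite (listset (map (\<lambda>w. {z \<in> Ob G2. on_ob c z = w}) f))"
    using finc by (intro finite_listset) (auto simp: grpdP_sel)
  show "{xs\<in>Ob S2. map (on_ob c) xs = f} \<subseteq> listset (map (\<lambda>w. {z \<in> Ob G2. on_ob c z = w}) f)"
    by (auto simp: mem_listset_iff grpdP_sel list_all2_conv_all_nth intro: subsetD[OF _ nth_mem])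
qed

text \<open>A nonzero coefficient requires at least one tuple of trees strictly over
  \<open>rep C\<close>; this is what bounds the support.\<close>

lemma comult_support_sub:
  assumes C: "C \<in> pi0 S1"
  shows "comult_support X C \<subseteq> (\<lambda>xs. (iso_class S1 (on_ob (face X 2 2) xs), iso_class S1 (on_ob (face X 2 0) xs))) `
    {xs\<in>Ob S2. map (on_ob c) xs = rep C}"
proof clarify
  fix A B assume AB: "(A, B) \<in> comult_support X C"
  then have A: "A \<in> pi0 S1" and B: "B \<in> pi0 S1" and "comult_coeff X C A B \<noteq> 0"
    unfolding comult_support_def lev by simp_all
  then have "{xs\<in>Ob S2. map (on_ob c) xs = rep C \<and> on_ob (face X 2 2) xs \<in> A \<and> on_ob (face X 2 0) xs \<in> B} \<noteq> {}"
    unfolding comult_coeff_eq[OF C A B] by (metis (no_types, lifting) sum.empty)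
  then show "(A, B) \<in> (\<lambda>xs. (iso_class S1 (on_ob (face X 2 2) xs), iso_class S1 (on_ob (face X 2 0) xs))) `
      {xs\<in>Ob S2. map (on_ob c) xs = rep C}"
    using S1.pi0_eq_iso_class[OF A] S1.pi0_eq_iso_class[OF B] by blast
qed

lemma finite_comult_support: "C \<in> pi0 S1 \<Longrightarrow> finite (comult_support X C)"
  using finite_subset[OF comult_support_sub] finite_over S1.rep_ob by blast

text \<open>A sum over tuples of trees, instead of pairs of classes, is the shape in which the
  polynomial side arises. Pairs of classes outside the support have coefficient zero and may be
  added before regrouping.\<close>

lemma comult_sum:
  assumes C: "C \<in> pi0 S1"
  shows "(\<Sum>(A, B)\<in>comult_support X C. single (Some A, Some B) (comult_coeff X C A B)) =
    (\<Sum>xs\<in>{xs\<in>Ob S2. map (on_ob c) xs = rep C}.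
      single (Some (iso_class S1 (on_ob (face X 2 2) xs)), Some (iso_class S1 (on_ob (face X 2 0) xs)))
        (of_nat (prod_list (map (indeg G1) (rep C))) / of_nat (prod_list (map (indeg G2) xs))))"
proof -
  let ?Y = "{xs\<in>Ob S2. map (on_ob c) xs = rep C}"
  let ?\<kappa> = "\<lambda>xs. (iso_class S1 (on_ob (face X 2 2) xs), iso_class S1 (on_ob (face X 2 0) xs))"
  let ?w = "\<lambda>xs. of_nat (prod_list (map (indeg G1) (rep C))) / of_nat (prod_list (map (indeg G2) xs)) :: rat"
  let ?s = "\<lambda>(A, B). single (Some A, Some B) :: rat \<Rightarrow> _"
  have finY: "finite ?Y" by (rule finite_over[OF S1.rep_ob[OF C]])
  have pi: "fst (?\<kappa> xs) \<in> pi0 S1 \<and> snd (?\<kappa> xs) \<in> pi0 S1" if "xs \<in> Ob S2" for xs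
    using S1.iso_class_in_pi0 functor_ob[OF d2 that] functor_ob[OF d0 that] by simp
  have "(\<Sum>(A, B)\<in>comult_support X C. single (Some A, Some B) (comult_coeff X C A B)) =
      (\<Sum>(A, B)\<in>?\<kappa> ` ?Y. single (Some A, Some B) (comult_coeff X C A B))"
  proof (rule sum.mono_neutral_left)
    show "finite (?\<kappa> ` ?Y)" using finY by simp
    show "comult_support X C \<subseteq> ?\<kappa> ` ?Y" by (rule comult_support_sub[OF C])
    show "\<forall>i\<in>?\<kappa> ` ?Y - comult_support X C.
        (case i of (A, B) \<Rightarrow> single (Some A, Some B) (comult_coeff X C A B)) = 0"
    proof
      fix i assume i: "i \<in> ?\<kappa> ` ?Y - comult_support X C"
      then have "fst i \<in> pi0 S1" "snd i \<in> pi0 S1" using pi by auto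
      then have "comult_coeff X C (fst i) (snd i) = 0"
        using i unfolding comult_support_def lev by (cases i) auto
      then show "(case i of (A, B) \<Rightarrow> single (Some A, Some B) (comult_coeff X C A B)) = 0"
        by (simp add: split_def)
    qed
  qed
  also have "\<dots> = (\<Sum>i\<in>?\<kappa> ` ?Y. \<Sum>xs\<in>{xs. xs \<in> ?Y \<and> ?\<kappa> xs = i}. ?s (?\<kappa> xs) (?w xs))"
  proof (rule sum.cong[OF refl])
    fix i assume "i \<in> ?\<kappa> ` ?Y"
    then obtain A B where i: "i = (A, B)" "A \<in> pi0 S1" "B \<in> pi0 S1" using pi by force
    have mem: "x \<in> D \<longleftrightarrow> iso_class S1 x = D" if "D \<in> pi0 S1" "x \<in> Ob S1" for x D
      using S1.pi0_eq_iso_class[OF that(1)] S1.in_iso_class[OF that(2)] by blast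
    have "{xs\<in>Ob S2. map (on_ob c) xs = rep C \<and> on_ob (face X 2 2) xs \<in> A \<and> on_ob (face X 2 0) xs \<in> B} =
        {xs. xs \<in> ?Y \<and> ?\<kappa> xs = i}"
      using mem[OF i(2)] mem[OF i(3)] functor_ob[OF d2] functor_ob[OF d0] i(1) by auto
    then show "(case i of (A, B) \<Rightarrow> single (Some A, Some B) (comult_coeff X C A B)) =
        (\<Sum>xs\<in>{xs. xs \<in> ?Y \<and> ?\<kappa> xs = i}. ?s (?\<kappa> xs) (?w xs))"
      unfolding i(1) prod.case comult_coeff_eq[OF C i(2,3)] single_sum
      by (intro sum.cong) auto
  qed
  also have "\<dots> = (\<Sum>xs\<in>?Y. ?s (?\<kappa> xs) (?w xs))"
    by (rule sum.group[OF finY finite_imageI[OF finY] subset_refl])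
  finally show ?thesis by simp
qed

lemma locally_finite: "locally_finite X"
  unfolding locally_finite_def lev
  by (intro conjI ballI finite_aut_S1 counit_fibre_hfinite_hcard(1) comult_fibre_hfinite_hcard(1)
      finite_comult_support)

end

section \<open>Two-level trees of words\<close>

lemma words_pos: "w \<in> words \<Longrightarrow> k \<in> set w \<Longrightarrow> k > 0"
  by (cases k) (auto simp: words_def)

text \<open>The monomials of G(F_1, F_2, ...): a letter k of the outer word is replaced by a word of
  F_k, whose variables have their indices multiplied by k.\<close>

definition graft_word :: "nat list \<Rightarrow> nat list list \<Rightarrow> nat list" where
  "graft_word \<eta> \<xi>s = concat (map2 (\<lambda>k. map ((*) k)) \<eta> \<xi>s)"

lemma graft_word_simps [simp]:
  "graft_word [] \<xi>s = []" "graft_word \<eta> [] = []"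
  "graft_word (k # \<eta>) (\<xi> # \<xi>s) = map ((*) k) \<xi> @ graft_word \<eta> \<xi>s"
  by (simp_all add: graft_word_def)

text \<open>Leaves come before the root, in the order of \<open>Graft\<close> and of the two tensor
  factors.\<close>

definition word_trees :: "nat list \<Rightarrow> (nat list list \<times> nat list) set" where
  "word_trees w = {(\<xi>s, \<eta>). \<eta> \<in> words \<and> set \<xi>s \<subseteq> words \<and> length \<xi>s = length \<eta> \<and> graft_word \<eta> \<xi>s = w}"

text \<open>Leaf words are nonempty and letters positive, so grafting neither shortens words nor
  shrinks letters. The bounds leave only finitely many trees over a given word.\<close>

lemma graft_word_bounds:
  assumes "length \<eta> = length \<xi>s" "set \<xi>s \<subseteq> words" "0 \<notin> set \<eta>"
  shows "length \<eta> \<le> length (graft_word \<eta> \<xi>s) \<and> set \<eta> \<subseteq> {..sum_list (graft_word \<eta> \<xi>s)} \<and>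
    (\<forall>\<xi>\<in>set \<xi>s. length \<xi> \<le> length (graft_word \<eta> \<xi>s) \<and> set \<xi> \<subseteq> {..sum_list (graft_word \<eta> \<xi>s)})"
  using assms
proof (induction \<eta> \<xi>s rule: list_induct2)
  case (Cons k \<eta> \<xi> \<xi>s)
  have \<xi>: "\<xi> \<noteq> []" "0 \<notin> set \<xi>" and k: "k > 0" using Cons.prems by (auto simp: words_def)
  have sum: "sum_list (map ((*) k) \<xi>) = k * sum_list \<xi>" by (simp add: sum_list_const_mult)
  have "sum_list \<xi> > 0" using \<xi> by (cases \<xi>) auto
  then have 1: "k \<le> sum_list (map ((*) k) \<xi>)" unfolding sum by simp
  have 2: "x \<le> sum_list (map ((*) k) \<xi>)" if "x \<in> set \<xi>" for x
  proof -
    have "x \<le> sum_list \<xi>" using that by (simp add: member_le_sum_list)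
    also have "\<dots> \<le> k * sum_list \<xi>" using k by simp
    finally show ?thesis unfolding sum .
  qed
  have 3: "length \<xi> > 0" using \<xi> by simp
  have IH: "length \<eta> \<le> length (graft_word \<eta> \<xi>s)" "set \<eta> \<subseteq> {..sum_list (graft_word \<eta> \<xi>s)}"
    "\<forall>\<xi>\<in>set \<xi>s. length \<xi> \<le> length (graft_word \<eta> \<xi>s) \<and> set \<xi> \<subseteq> {..sum_list (graft_word \<eta> \<xi>s)}"
    using Cons.IH Cons.prems by auto
  have "length (k # \<eta>) \<le> length (graft_word (k # \<eta>) (\<xi> # \<xi>s))"
    using IH(1) 3 unfolding graft_word_simps length_append length_map list.size by linarith
  moreover have "set (k # \<eta>) \<subseteq> {..sum_list (graft_word (k # \<eta>) (\<xi> # \<xi>s))}"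
    using IH(2) 1 by fastforce
  moreover have "length \<zeta> \<le> length (graft_word (k # \<eta>) (\<xi> # \<xi>s)) \<and>
      set \<zeta> \<subseteq> {..sum_list (graft_word (k # \<eta>) (\<xi> # \<xi>s))}" if "\<zeta> \<in> set (\<xi> # \<xi>s)" for \<zeta>
    using that IH(3) 2 by fastforce
  ultimately show ?case by blast
qed simp

lemma finite_word_trees: "finite (word_trees w)"
proof (rule finite_subset)
  let ?L = "{\<xi>. set \<xi> \<subseteq> {..sum_list w} \<and> length \<xi> \<le> length w}"
  show "word_trees w \<subseteq> {\<xi>s. set \<xi>s \<subseteq> ?L \<and> length \<xi>s \<le> length w} \<times> ?L"
  proof (rule subrelI)
    fix \<xi>s \<eta> assume "(\<xi>s, \<eta>) \<in> word_trees w"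
    then show "(\<xi>s, \<eta>) \<in> {\<xi>s. set \<xi>s \<subseteq> ?L \<and> length \<xi>s \<le> length w} \<times> ?L"
      using graft_word_bounds[of \<eta> \<xi>s] unfolding word_trees_def words_def by fastforce
  qed
  show "finite ({\<xi>s. set \<xi>s \<subseteq> ?L \<and> length \<xi>s \<le> length w} \<times> ?L)"
    by (intro finite_cartesian_product finite_lists_length_le finite_atMost)
qed

lemma graft_word_words: "(\<xi>s, \<eta>) \<in> word_trees w \<Longrightarrow> w \<in> words"
proof -
  assume a: "(\<xi>s, \<eta>) \<in> word_trees w"
  then have *: "length \<eta> = length \<xi>s" "set \<xi>s \<subseteq> words" "0 \<notin> set \<eta>" "\<eta> \<noteq> []" "graft_word \<eta> \<xi>s = w"
    by (auto simp: word_trees_def words_def)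
  from *(1-3) have "0 \<notin> set (graft_word \<eta> \<xi>s)"
    by (induction \<eta> \<xi>s rule: list_induct2) (auto simp: words_def)
  moreover have "graft_word \<eta> \<xi>s \<noteq> []" using graft_word_bounds[OF *(1-3)] *(4) by auto
  ultimately show ?thesis using *(5) by (simp add: words_def)
qed

section \<open>The operad\<close>

abbreviation "tgrpd \<equiv> terminal_grpd"

lemma unit_list_eq_iff: "us = vs \<longleftrightarrow> length us = length (vs :: unit list)"
  by (auto intro: nth_equalityI)

lemma map_unit_list: "map f us = (us :: unit list)"
  by (simp add: unit_list_eq_iff)

text \<open>Between ordered tuples of units there is at most one arrow, so agreement on objects
  already forces agreement on arrows.\<close>

lemma functors_to_Mr_terminal_eq:
  assumes F: "is_functor M (grpdP Mr tgrpd) F" and E: "is_functor M (grpdP Mr tgrpd) E"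
    and ob: "\<And>x. x \<in> Ob M \<Longrightarrow> on_ob F x = on_ob E x" and f: "f \<in> Ar M"
  shows "on_ar F f = on_ar E f"
proof -
  interpret M: groupoid M by (rule functor_dom[OF F])
  have h: "f \<in> hom M (gdom M f) (gcod M f)" using f by (simp add: hom_def)
  have "m = m'" if "m \<in> hom (grpdP Mr tgrpd) xs ys" "m' \<in> hom (grpdP Mr tgrpd) xs ys" for m m' xs ys
  proof -
    have "fst m = id" "length (snd m) = length ys" "fst m' = id" "length (snd m') = length ys"
      using that hom_grpdP[of "fst m" "snd m" Mr tgrpd xs ys]
        hom_grpdP[of "fst m'" "snd m'" Mr tgrpd xs ys] by simp_all
    then show ?thesis by (metis unit_list_eq_iff prod_eqI)
  qed
  moreover have "on_ar F f \<in> hom (grpdP Mr tgrpd) (on_ob F (gdom M f)) (on_ob F (gcod M f))"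
    by (rule functor_hom[OF F h])
  moreover have "on_ar E f \<in> hom (grpdP Mr tgrpd) (on_ob F (gdom M f)) (on_ob F (gcod M f))"
    using functor_hom[OF E h] ob M.dom_ob[OF f] M.cod_ob[OF f] by simp
  ultimately show ?thesis by blast
qed

text \<open>For tuples of a single colour, being composable is a matter of length alone.\<close>

lemma is_functor_pairF_Mr_terminal:
  assumes E: "is_functor M G E" and E': "is_functor M H E'"
    and F: "is_functor G (grpdP Mr tgrpd) F" and K: "is_functor H (grpdP Mr tgrpd) K"
    and len: "\<And>x. x \<in> Ob M \<Longrightarrow> length (on_ob F (on_ob E x)) = length (on_ob K (on_ob E' x))"
  shows "is_functor M (pullback G H F K) (pairF E E')"
proof (rule is_functor_pairF[OF E E' F K])
  show ob: "on_ob F (on_ob E x) = on_ob K (on_ob E' x)" if "x \<in> Ob M" for x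
    using len[OF that] by (simp add: unit_list_eq_iff)
  show "on_ar F (on_ar E f) = on_ar K (on_ar E' f)" if "f \<in> Ar M" for f
    using functors_to_Mr_terminal_eq[OF is_functor_compF[OF E F] is_functor_compF[OF E' K] _ that] ob
    by (simp add: compF_def)
qed

section \<open>The internal category of arities\<close>

definition "SymC = T_cat Sr Sym"
definition "SymT = T_op Mr Sr Sym"

lemma SymC_sel:
  "cobj SymC = tgrpd"
  "carr SymC = pullback (grpdP Sr tgrpd) (prod_grpd tgrpd (grpdP Sr tgrpd)) idF constP"
  "csource SymC = pr1 \<odot> pr2" "ctarget SymC = bangF \<odot> pr1"
  by (simp_all add: SymC_def T_cat_def Sym_def)

text \<open>In this form functoriality is inherited from the constituents. The composite of
  \<open>constP\<close> and \<open>muP\<close> repeats one tuple as often as the other is long, so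
  it multiplies arities.\<close>

lemma SymC_ccomp:
  "ccomp SymC = pairF (muP \<odot> constP \<odot> pairF (pr1 \<odot> pr2) (pr2 \<odot> pr2 \<odot> pr1))
     (pairF (pr1 \<odot> pr2 \<odot> pr2) (muP \<odot> constP \<odot> pairF (pr2 \<odot> pr2 \<odot> pr2) (pr2 \<odot> pr2 \<odot> pr1)))"
  by (simp add: SymC_def T_cat_def Sym_def pairF_def compF_def pr1_def pr2_def muP_def constP_def
      fun_eq_iff split: prod.split)

lemma groupoid_tgrpd_tuples: "groupoid (grpdP k tgrpd)"
  by (rule groupoid_grpdP[OF groupoid_terminal])

lemma is_functor_repeat: "is_functor (prod_grpd tgrpd (grpdP k tgrpd)) (grpdP k tgrpd) constP"
  by (rule is_functor_constP[OF groupoid_terminal])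

lemma terminal_sel [simp]: "Ob tgrpd = UNIV" "Ar tgrpd = UNIV"
  by (simp_all add: terminal_grpd_def)

lemma idF_sel [simp]: "on_ob idF x = x" "on_ar idF f = f"
  by (simp_all add: idF_def)

text \<open>Over one colour \<open>constP\<close> is a projection, so the pullback defining the
  arrows of \<open>SymC\<close> is a diagonal: an arrow is an arity stored twice.\<close>

lemma constP_unit: "on_ob constP (u, us) = us" "on_ar constP (v, m) = m"
  for us :: "unit list" and m :: "unit parr"
  by (simp_all add: constP_def map_unit_list split_def)

lemma Ar_pullback: "Ar (pullback G H F K) = {(f, g). f \<in> Ar G \<and> g \<in> Ar H \<and> on_ar F f = on_ar K g}"
  and Ob_pullback: "Ob (pullback G H F K) = {(x, y). x \<in> Ob G \<and> y \<in> Ob H \<and> on_ob F x = on_ob K y}"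
  by (simp_all add: pullback_def)

lemma Ar_prod: "Ar (prod_grpd G H) = Ar G \<times> Ar H"
  by (auto simp: prod_grpd_def pullback_def bangF_def)

lemma Ob_carr: "Ob (carr SymC) = {(us, ((), us)) | us. us \<noteq> []}"
  unfolding SymC_sel Ob_pullback Ob_prod grpdP_sel by (auto simp: constP_unit)

lemma Ar_carr: "Ar (carr SymC) = {(\<phi>, ((), \<phi>)) | \<phi>. \<phi> \<in> Ar (grpdP Sr tgrpd)}"
  unfolding SymC_sel Ar_pullback Ar_prod by (auto simp: constP_unit)

lemma groupoid_carr: "groupoid (carr SymC)"
  unfolding SymC_sel
  by (rule groupoid_pullback[OF is_functor_idF[OF groupoid_tgrpd_tuples] is_functor_repeat])

lemma carr_projections:
  "is_functor (carr SymC) (grpdP Sr tgrpd) pr1"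
  "is_functor (carr SymC) (grpdP Sr tgrpd) (pr2 \<odot> pr2)"
  unfolding SymC_sel
  by (rule is_functor_pr1[OF is_functor_idF[OF groupoid_tgrpd_tuples] is_functor_repeat],
      rule is_functor_compF[OF is_functor_pr2[OF is_functor_idF[OF groupoid_tgrpd_tuples] is_functor_repeat]
        is_functor_prod_pr2[OF groupoid_terminal groupoid_tgrpd_tuples]])

lemma compF_assoc: "(F \<odot> G) \<odot> H = F \<odot> G \<odot> H"
  by (simp add: compF_def o_assoc)

lemma is_functor_ccomp: "is_functor (prod_grpd (carr SymC) (carr SymC)) (carr SymC) (ccomp SymC)"
proof -
  let ?M = "prod_grpd (carr SymC) (carr SymC)"
  note M = groupoid_prod[OF groupoid_carr groupoid_carr]
  note p1 = is_functor_prod_pr1[OF groupoid_carr groupoid_carr]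
  note p2 = is_functor_prod_pr2[OF groupoid_carr groupoid_carr]
  have power: "is_functor (prod_grpd (grpdP Sr tgrpd) (grpdP Sr tgrpd)) (grpdP Sr tgrpd) (muP \<odot> constP)"
    by (rule is_functor_compF[OF is_functor_constP is_functor_muP])
       (simp_all add: groupoid_tgrpd_tuples groupoid_terminal)
  have 1: "is_functor ?M (grpdP Sr tgrpd) (muP \<odot> constP \<odot> pairF (pr1 \<odot> pr2) (pr2 \<odot> pr2 \<odot> pr1))"
    using is_functor_compF[OF is_functor_prod_pairF[OF
          is_functor_compF[OF p2 carr_projections(1)] is_functor_compF[OF p1 carr_projections(2)]] power]
    by (simp add: compF_assoc)
  have 2: "is_functor ?M (grpdP Sr tgrpd) (muP \<odot> constP \<odot> pairF (pr2 \<odot> pr2 \<odot> pr2) (pr2 \<odot> pr2 \<odot> pr1))"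
    using is_functor_compF[OF is_functor_prod_pairF[OF
          is_functor_compF[OF p2 carr_projections(2)] is_functor_compF[OF p1 carr_projections(2)]] power]
    by (simp add: compF_assoc)
  \<comment> \<open>One component of the composite repeats the first copy of the arity and the other
    the second; they agree because the pullback is a diagonal.\<close>
  have ob: "fst y = snd (snd y)" if "(x, y) \<in> Ob ?M" for x y
    using that by (auto simp: Ob_prod Ob_carr)
  have ar: "fst y = snd (snd y)" if "(x, y) \<in> Ar ?M" for x y
    using that by (auto simp: Ar_prod Ar_carr)
  show ?thesis
    unfolding SymC_ccomp
  proof (subst (3) SymC_sel(2), rule is_functor_pairF[OF 1
      is_functor_prod_pairF[OF is_functor_to_terminal[OF M] 2]
      is_functor_idF[OF groupoid_tgrpd_tuples] is_functor_repeat])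
    fix x assume "x \<in> Ob ?M"
    then have "fst (snd x) = snd (snd (snd x))" using ob[of "fst x" "snd x"] by simp
    then show "on_ob idF (on_ob (muP \<odot> constP \<odot> pairF (pr1 \<odot> pr2) (pr2 \<odot> pr2 \<odot> pr1)) x) =
       on_ob constP (on_ob (pairF (pr1 \<odot> pr2 \<odot> pr2) (muP \<odot> constP \<odot> pairF (pr2 \<odot> pr2 \<odot> pr2) (pr2 \<odot> pr2 \<odot> pr1))) x)"
      by (simp add: idF_def compF_def pairF_def pr1_def pr2_def constP_def map_unit_list muP_def)
  next
    fix f assume "f \<in> Ar ?M"
    then have "fst (snd f) = snd (snd (snd f))" using ar[of "fst f" "snd f"] by simp
    then show "on_ar idF (on_ar (muP \<odot> constP \<odot> pairF (pr1 \<odot> pr2) (pr2 \<odot> pr2 \<odot> pr1)) f) =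
       on_ar constP (on_ar (pairF (pr1 \<odot> pr2 \<odot> pr2) (muP \<odot> constP \<odot> pairF (pr2 \<odot> pr2 \<odot> pr2) (pr2 \<odot> pr2 \<odot> pr1))) f)"
      by (simp add: idF_def compF_def pairF_def pr1_def pr2_def constP_def map_unit_list muP_def split_def)
  qed
qed

section \<open>The operad of tuples of arities\<close>

lemma SymT_sel:
  "colours SymT = tgrpd"
  "ops SymT = pullback (grpdP Mr (carr SymC)) (prod_grpd tgrpd (grpdP Mr tgrpd)) (mapP (ctarget SymC)) constP"
  "opinputs SymT = mapP (csource SymC) \<odot> pr1" "opoutput SymT = pr1 \<odot> pr2"
  by (simp_all add: SymT_def T_op_def T_operad_def SymC_def[symmetric]) (simp_all add: SymC_sel)

text \<open>Root entries are zipped with the operations grafted onto them, each pair is spread over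
  the entries of its operation and composed there, and the blocks are flattened. Functoriality can
  then be read off factor by factor.\<close>

lemma SymT_opcomp:
  "opcomp SymT = pairF
     (muP \<odot> mapP (mapP (ccomp SymC) \<odot> strengthF \<odot> pairF pr1 (pr1 \<odot> pr2)) \<odot> zipF \<odot> pairF (pr1 \<odot> pr2) pr1)
     (pairF (pr1 \<odot> pr2 \<odot> pr2) (muP \<odot> mapP (pr2 \<odot> pr2) \<odot> pr1))"
  by (simp add: SymT_def T_op_def T_operad_def SymC_def[symmetric] pairF_def compF_def pr1_def pr2_def
      muP_def mapP_def strengthF_def zipF_def fun_eq_iff split_def o_def)

lemma is_functor_ctargets: "is_functor (grpdP Mr (carr SymC)) (grpdP Mr tgrpd) (mapP (ctarget SymC))"
  by (rule is_functor_mapP[OF is_functor_to_terminal[OF groupoid_carr]])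

lemma is_functor_csources: "is_functor (grpdP Mr (carr SymC)) (grpdP Mr tgrpd) (mapP (csource SymC))"
  by (rule is_functor_mapP[OF is_functor_to_terminal[OF groupoid_carr]])

lemma groupoid_ops: "groupoid (ops SymT)"
  unfolding SymT_sel by (rule groupoid_pullback[OF is_functor_ctargets is_functor_repeat])

lemma ops_projections:
  "is_functor (ops SymT) (grpdP Mr (carr SymC)) pr1"
  "is_functor (ops SymT) (grpdP Mr tgrpd) (pr2 \<odot> pr2)"
  unfolding SymT_sel
  by (rule is_functor_pr1[OF is_functor_ctargets is_functor_repeat],
      rule is_functor_compF[OF is_functor_pr2[OF is_functor_ctargets is_functor_repeat]
        is_functor_prod_pr2[OF groupoid_terminal groupoid_tgrpd_tuples]])

lemma is_functor_opinputs: "is_functor (ops SymT) (grpdP Mr tgrpd) (opinputs SymT)"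
  unfolding SymT_sel(3) by (rule is_functor_compF[OF ops_projections(1) is_functor_csources])

lemma is_functor_opoutputs: "is_functor (grpdP Mr (ops SymT)) (grpdP Mr tgrpd) (mapP (opoutput SymT))"
  by (rule is_functor_mapP[OF is_functor_to_terminal[OF groupoid_ops]])

lemma Ob_ops:
  "Ob (ops SymT) = {(fs, ((), us)) | fs us. fs \<noteq> [] \<and> set fs \<subseteq> Ob (carr SymC) \<and> length us = length fs}"
proof -
  have "on_ob (mapP (ctarget SymC)) fs = on_ob constP (u, us) \<longleftrightarrow> length us = length fs" for fs u us
    unfolding constP_unit unit_list_eq_iff by (auto simp: mapP_def)
  then show ?thesis
    unfolding SymT_sel(2) Ob_pullback Ob_prod grpdP_sel by auto
qed

abbreviation "composables \<equiv>
  pullback (grpdP Mr (ops SymT)) (ops SymT) (mapP (opoutput SymT)) (opinputs SymT)"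

lemma is_functor_opcomp: "is_functor composables (ops SymT) (opcomp SymT)"
proof -
  let ?C = "carr SymC"
  note q1 = is_functor_pr1[OF is_functor_opoutputs is_functor_opinputs]
  note q2 = is_functor_pr2[OF is_functor_opoutputs is_functor_opinputs]
  \<comment> \<open>Each entry of the root meets the operation grafted onto it; the tuples have
    equal length because the root has one input per entry.\<close>
  have zip: "is_functor composables (pullback (grpdP Mr ?C) (grpdP Mr (ops SymT)) (mapP (csource SymC)) (mapP (opoutput SymT)))
      (pairF (pr1 \<odot> pr2) pr1)"
  proof (rule is_functor_pairF_Mr_terminal[OF is_functor_compF[OF q2 ops_projections(1)] q1
        is_functor_csources is_functor_opoutputs])
    fix x assume "x \<in> Ob composables"
    then have "length (on_ob (mapP (opoutput SymT)) (fst x)) = length (on_ob (opinputs SymT) (snd x))"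
      by (auto simp: pullback_def)
    then show "length (on_ob (mapP (csource SymC)) (on_ob (pr1 \<odot> pr2) x)) =
        length (on_ob (mapP (opoutput SymT)) (on_ob pr1 x))"
      by (simp add: SymT_sel(3) mapP_def compF_def pr1_def pr2_def)
  qed
  have block: "is_functor (prod_grpd ?C (ops SymT)) (grpdP Mr ?C)
      (mapP (ccomp SymC) \<odot> strengthF \<odot> pairF pr1 (pr1 \<odot> pr2))"
    by (rule is_functor_compF[OF is_functor_compF[OF
          is_functor_prod_pairF[OF is_functor_prod_pr1[OF groupoid_carr groupoid_ops]
            is_functor_compF[OF is_functor_prod_pr2[OF groupoid_carr groupoid_ops] ops_projections(1)]]
          is_functor_strengthF[OF groupoid_carr groupoid_carr]]
        is_functor_mapP[OF is_functor_ccomp], unfolded compF_assoc])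
  have 1: "is_functor composables (grpdP Mr ?C)
     (muP \<odot> mapP (mapP (ccomp SymC) \<odot> strengthF \<odot> pairF pr1 (pr1 \<odot> pr2)) \<odot> zipF \<odot> pairF (pr1 \<odot> pr2) pr1)"
    by (rule is_functor_compF[OF is_functor_compF[OF is_functor_compF[OF zip
            is_functor_zipF[OF is_functor_to_terminal[OF groupoid_carr] is_functor_to_terminal[OF groupoid_ops]]]
          is_functor_mapP[OF block]]
          is_functor_muP[OF groupoid_carr], unfolded compF_assoc]) simp
  have 2: "is_functor composables (grpdP Mr tgrpd) (muP \<odot> mapP (pr2 \<odot> pr2) \<odot> pr1)"
    by (rule is_functor_compF[OF is_functor_compF[OF q1 is_functor_mapP[OF ops_projections(2)]]
          is_functor_muP[OF groupoid_terminal], unfolded compF_assoc]) simp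
  show ?thesis
    unfolding SymT_opcomp
  proof (subst (2) SymT_sel(2), rule is_functor_pairF_Mr_terminal[OF 1
      is_functor_prod_pairF[OF is_functor_to_terminal[OF functor_dom[OF 2]] 2] is_functor_ctargets is_functor_repeat])
    fix x assume "x \<in> Ob composables"
    then obtain bs fs us where x: "x = (bs, (fs, ((), us)))" and bs: "set bs \<subseteq> Ob (ops SymT)"
      and len: "length bs = length fs"
      by (auto simp: Ob_pullback grpdP_sel Ob_ops SymT_sel(3) mapP_def
          compF_def pr1_def dest: map_eq_imp_length_eq)
    \<comment> \<open>An operation repeats its output colour once per entry, so counting colours
      counts entries.\<close>
    have "length gs = length us" if "(gs, (c, us)) \<in> set bs" for gs c us
      using that bs by (auto simp: Ob_ops)
    then have "length (concat (map (\<lambda>(f, gs, _). map (\<lambda>g. on_ob (ccomp SymC) (f, g)) gs) (zip fs bs))) =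
        length (concat (map (\<lambda>(gs, c, us). us) bs))"
      using len by (induction bs arbitrary: fs) (auto simp: Suc_length_conv)
    then show "length (on_ob (mapP (ctarget SymC)) (on_ob
        (muP \<odot> mapP (mapP (ccomp SymC) \<odot> strengthF \<odot> pairF pr1 (pr1 \<odot> pr2)) \<odot> zipF \<odot> pairF (pr1 \<odot> pr2) pr1) x)) =
      length (on_ob constP (on_ob (pairF (pr1 \<odot> pr2 \<odot> pr2) (muP \<odot> mapP (pr2 \<odot> pr2) \<odot> pr1)) x))"
      by (simp add: x mapP_def compF_def pairF_def pr1_def pr2_def muP_def zipF_def strengthF_def constP_def
          split_def o_def)
  qed
qed

section \<open>Levels zero to two of the bar construction\<close>

interpretation col: relabelling colF uncolF
  by standard (simp_all add: colF_def uncolF_def)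

interpretation op: relabelling opF unopF
  by standard (simp_all add: opF_def unopF_def)

interpretation graft: relabelling graftF ungraftF
  by standard (auto simp: graftF_def ungraftF_def)

definition "SymX = bar Sr Mr SymT"

definition "T0 = level Mr SymT 0"
definition "T1 = level Mr SymT 1"
definition "T2 = level Mr SymT 2"

lemma level_1: "T1 = relabel opF unopF (ops SymT)"
  by (simp add: T1_def)

lemma level_0: "T0 = relabel colF uncolF tgrpd"
  by (simp add: T0_def SymT_sel)

lemma level_2: "T2 = relabel graftF ungraftF (pullback (grpdP Mr T1) (ops SymT) (mapP (outF SymT)) (opinputs SymT))"
  by (simp add: T1_def T2_def numeral_2_eq_2)

type_synonym sym_tree = "(unit, (unit list \<times> unit \<times> unit list) list \<times> unit \<times> unit list) tree"
type_synonym sym_tree_ar = "(unit, (unit parr \<times> unit \<times> unit parr) parr \<times> unit \<times> unit parr) tree_ar"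

definition composeF :: "(sym_tree, sym_tree_ar, sym_tree, sym_tree_ar) gfun" where
  "composeF = opF \<odot> opcomp SymT \<odot> pairF (mapP unopF \<odot> pr1) pr2 \<odot> ungraftF"
definition identityF :: "(sym_tree, sym_tree_ar, sym_tree, sym_tree_ar) gfun" where
  "identityF = opF \<odot> opunit SymT \<odot> uncolF"

lemma lev_SymX: "lev SymX 0 = grpdP Sr T0" "lev SymX 1 = grpdP Sr T1" "lev SymX 2 = grpdP Sr T2"
  by (simp_all add: SymX_def bar_def T0_def T1_def T2_def)

lemma SymX_sel:
  "face SymX 2 0 = mapP (opF \<odot> pr2 \<odot> ungraftF)"
  "face SymX 2 1 = mapP composeF"
  "face SymX 2 2 = muP \<odot> mapP (pr1 \<odot> ungraftF)"
  "degen SymX 0 0 = mapP identityF"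
  by (simp_all add: SymX_def bar_def composeF_def identityF_def numeral_2_eq_2)

lemma groupoid_level_1: "groupoid T1"
  unfolding level_1 by (rule op.groupoid_relabel[OF groupoid_ops])

lemma groupoid_level_0: "groupoid T0"
  unfolding level_0 by (rule col.groupoid_relabel[OF groupoid_terminal])

lemma is_functor_outputs: "is_functor (grpdP Mr T1) (grpdP Mr tgrpd) (mapP (outF SymT))"
  by (rule is_functor_mapP[OF is_functor_to_terminal[OF groupoid_level_1]])

abbreviation "grafts \<equiv> pullback (grpdP Mr T1) (ops SymT) (mapP (outF SymT)) (opinputs SymT)"

lemma groupoid_grafts: "groupoid grafts"
  by (rule groupoid_pullback[OF is_functor_outputs is_functor_opinputs])

lemma is_functor_ungraft: "is_functor T2 grafts ungraftF"
  unfolding level_2 by (rule graft.is_functor_unrelabel[OF groupoid_grafts])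

lemma is_functor_op: "is_functor (ops SymT) T1 opF"
  unfolding level_1 by (rule op.is_functor_relabel[OF groupoid_ops])

lemma is_functor_unop: "is_functor T1 (ops SymT) unopF"
  unfolding level_1 by (rule op.is_functor_unrelabel[OF groupoid_ops])

lemma is_functor_root: "is_functor T2 T1 (opF \<odot> pr2 \<odot> ungraftF)"
  using is_functor_compF[OF is_functor_compF[OF is_functor_ungraft
      is_functor_pr2[OF is_functor_outputs is_functor_opinputs]] is_functor_op] .

lemma is_functor_leaves: "is_functor T2 (grpdP Mr T1) (pr1 \<odot> ungraftF)"
  using is_functor_compF[OF is_functor_ungraft is_functor_pr1[OF is_functor_outputs is_functor_opinputs]] .

lemma is_functor_compose: "is_functor T2 T1 composeF"
proof -
  note p1 = is_functor_pr1[OF is_functor_outputs is_functor_opinputs]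
  note p2 = is_functor_pr2[OF is_functor_outputs is_functor_opinputs]
  have "is_functor grafts composables (pairF (mapP unopF \<odot> pr1) pr2)"
  proof (rule is_functor_pairF_Mr_terminal[OF is_functor_compF[OF p1 is_functor_mapP[OF is_functor_unop]] p2
      is_functor_opoutputs is_functor_opinputs])
    fix x assume "x \<in> Ob grafts"
    then have "length (on_ob (mapP (outF SymT)) (fst x)) = length (on_ob (opinputs SymT) (snd x))"
      by (auto simp: Ob_pullback)
    then show "length (on_ob (mapP (opoutput SymT)) (on_ob (mapP unopF \<odot> pr1) x)) =
        length (on_ob (opinputs SymT) (on_ob pr2 x))"
      by (simp add: mapP_def compF_def pr1_def pr2_def)
  qed
  from is_functor_compF[OF is_functor_compF[OF is_functor_compF[OF is_functor_ungraft this] is_functor_opcomp] is_functor_op]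
  show ?thesis unfolding composeF_def .
qed

lemma mem_hom_terminal: "f \<in> hom tgrpd x y"
  by (simp add: hom_def)

text \<open>With a single colour the map is constant on objects and on arrows, so respecting
  composition means that its one arrow is idempotent.\<close>

lemma is_functor_identity: "is_functor T0 T1 identityF"
proof (rule is_functorI[OF groupoid_level_0 groupoid_level_1])
  let ?i = "(id, [()]) :: unit parr"
  have opunit: "on_ob (opunit SymT) u = ([([()], ((), [()]))], ((), [()]))"
    "on_ar (opunit SymT) v = ((id, [(?i, ((), ?i))]), ((), ?i))" for u v
    by (simp_all add: SymT_def T_op_def T_operad_def T_cat_def Sym_def etaP_def)
  have u: "on_ob (opunit SymT) u \<in> Ob (ops SymT)" for u
    by (simp add: opunit Ob_ops Ob_carr)
  have i: "?i \<in> hom (grpdP k tgrpd) [()] [()]" for k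
    by (simp add: hom_grpdP permutes_id mem_hom_terminal)
  then have "(?i, ((), ?i)) \<in> hom (carr SymC) ([()], ((), [()])) ([()], ((), [()]))"
    unfolding SymC_sel hom_pullback hom_prod by (simp add: constP_unit mem_hom_terminal)
  then have "(id, [(?i, ((), ?i))]) \<in> hom (grpdP Mr (carr SymC)) [([()], ((), [()]))] [([()], ((), [()]))]"
    by (simp add: hom_grpdP permutes_id)
  then have "on_ar (opunit SymT) v \<in> hom (ops SymT) (on_ob (opunit SymT) u) (on_ob (opunit SymT) u')" for u u' v
    unfolding opunit SymT_sel hom_pullback hom_prod
    using i[of Mr] by (simp add: constP_unit mem_hom_terminal mapP_def)
  then have hom: "on_ar identityF f \<in> hom T1 (on_ob identityF x) (on_ob identityF y)" for f x y
    unfolding identityF_def level_1 compF_def by (simp add: op.hom_relabel)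
  then show "\<And>f x y. on_ar identityF f \<in> hom T1 (on_ob identityF x) (on_ob identityF y)" .
  show "on_ob identityF x \<in> Ob T1" for x
    using groupoid.hom_ob[OF groupoid_level_1 hom] by blast
  interpret T1: groupoid T1 by (rule groupoid_level_1)
  fix f g x y z
  let ?U = "on_ob identityF x" and ?e = "on_ar identityF f"
  have const: "on_ar identityF f' = ?e" "on_ob identityF x' = ?U" for f' x'
    by (simp_all add: identityF_def compF_def opunit)
  have e: "?e \<in> hom T1 ?U ?U" using hom[of f x x] .
  have "gcomp (ops SymT) (on_ar (opunit SymT) u) (on_ar (opunit SymT) u) = on_ar (opunit SymT) u" for u
    by (simp add: opunit SymT_sel gcomp_pullback gcomp_prod grpdP_sel SymC_sel)
  then have "gcomp T1 ?e ?e = ?e"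
    unfolding level_1 identityF_def compF_def by (simp add: relabel_def)
  then show "on_ar identityF (gcomp T0 g f) = gcomp T1 (on_ar identityF g) (on_ar identityF f)"
    unfolding const(1)[of "gcomp T0 g f"] const(1)[of g] by (rule sym)
qed

section \<open>Operations as words\<close>

lemma mem_Ob_ops:
  "(fs, (u, us)) \<in> Ob (ops SymT) \<longleftrightarrow> fs \<noteq> [] \<and> set fs \<subseteq> Ob (carr SymC) \<and> length us = length fs"
  by (simp add: Ob_ops)

text \<open>A list of units is nothing but its length, so an operation is determined by the arities
  of its entries; \<open>word_op\<close> is the inverse on objects of \<open>T1\<close>.\<close>

definition op_word :: "sym_tree \<Rightarrow> nat list" where
  "op_word t = map (length \<circ> fst) (fst (unop t))"

definition word_op :: "nat list \<Rightarrow> sym_tree" where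
  "word_op w = Op (map (\<lambda>k. (replicate k (), ((), replicate k ()))) w, ((), replicate (length w) ()))"

lemma op_word_word_op [simp]: "op_word (word_op w) = w"
  by (simp add: op_word_def word_op_def o_def)

lemma Ob_level_1: "Ob T1 = word_op ` words"
proof (intro equalityI subsetI)
  fix t assume "t \<in> Ob T1"
  then obtain fs us where t: "t = Op (fs, ((), us))" and fs: "fs \<noteq> []" "set fs \<subseteq> Ob (carr SymC)"
    "length us = length fs"
    unfolding level_1 by (auto simp: relabel_def opF_def Ob_ops)
  have fs': "map (\<lambda>k. (replicate k (), ((), replicate k ()))) (op_word t) = map id fs"
    unfolding op_word_def t tree.sel fst_conv map_map
  proof (rule map_cong[OF refl])
    fix f assume "f \<in> set fs"
    then obtain vs where f: "f = (vs, ((), vs))" using fs(2) unfolding Ob_carr by blast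
    have "replicate (length vs) () = vs" by (simp add: unit_list_eq_iff)
    then show "((\<lambda>k. (replicate k (), ((), replicate k ()))) \<circ> (length \<circ> fst)) f = id f"
      by (simp add: f)
  qed
  have "replicate (length (op_word t)) () = us"
    using fs by (simp add: unit_list_eq_iff op_word_def t)
  then have "t = word_op (op_word t)" unfolding word_op_def fs' by (simp add: t)
  moreover have "op_word t \<in> words"
    using fs by (auto simp: words_def op_word_def t Ob_carr)
  ultimately show "t \<in> word_op ` words" by blast
next
  fix t assume "t \<in> word_op ` words"
  then obtain w where w: "w \<in> words" "t = word_op w" by blast
  have "(replicate k (), ((), replicate k ())) \<in> Ob (carr SymC)" if "k \<in> set w" for k
  proof -
    have "replicate k () \<noteq> []" using words_pos[OF w(1) that] by simp
    then show ?thesis unfolding Ob_carr by blast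
  qed
  then have "set (map (\<lambda>k. (replicate k (), ((), replicate k ()))) w) \<subseteq> Ob (carr SymC)"
    unfolding set_map by (rule image_subsetI)
  moreover have "map (\<lambda>k. (replicate k (), ((), replicate k ()))) w \<noteq> []"
    using w(1) by (simp add: words_def)
  ultimately have "(map (\<lambda>k. (replicate k (), ((), replicate k ()))) w, ((), replicate (length w) ())) \<in> Ob (ops SymT)"
    unfolding mem_Ob_ops by (intro conjI) (assumption | simp only: length_map length_replicate)+
  then show "t \<in> Ob T1"
    unfolding level_1 w word_op_def by (auto simp: relabel_def opF_def)
qed

section \<open>Arrow counts of operations and trees\<close>

lemma indeg_tgrpd: "indeg tgrpd = (\<lambda>_. 1)"
  by (rule ext) (simp add: indeg_def UNIV_unit)

lemma indeg_level_0: "x \<in> Ob T0 \<Longrightarrow> indeg T0 x = 1"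
  using col.indeg_relabel_ob[of x tgrpd] unfolding level_0 by (simp add: indeg_tgrpd)

lemma indeg_carr: "us \<noteq> [] \<Longrightarrow> indeg (carr SymC) (us, ((), us)) = fact (length us)"
proof -
  assume us: "us \<noteq> []"
  have "{f \<in> Ar (carr SymC). gcod (carr SymC) f = (us, ((), us))} =
      (\<lambda>\<phi>. (\<phi>, ((), \<phi>))) ` {\<phi> \<in> Ar (grpdP Sr tgrpd). gcod (grpdP Sr tgrpd) \<phi> = us}"
    unfolding Ar_carr by (auto simp: SymC_sel pullback_def prod_grpd_def)
  then have "indeg (carr SymC) (us, ((), us)) = indeg (grpdP Sr tgrpd) us"
    unfolding indeg_def by (simp add: card_image inj_on_def)
  also have "\<dots> = fact (length us)"
    using us by (simp add: indeg_grpdP indeg_tgrpd map_replicate_const)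
  finally show ?thesis .
qed

text \<open>Over \<open>Mr\<close>-tuples of colours, being composable imposes no condition on arrows, so the arrows into
  an object of a pullback are counted componentwise.\<close>

lemma indeg_pullback_Mr_terminal:
  assumes F: "is_functor G (grpdP Mr tgrpd) F" and K: "is_functor H (grpdP Mr tgrpd) K"
    and xy: "on_ob F x = on_ob K y"
  shows "indeg (pullback G H F K) (x, y) = indeg G x * indeg H y"
proof -
  interpret G: groupoid G by (rule functor_dom[OF F])
  interpret H: groupoid H by (rule functor_dom[OF K])
  have eq: "on_ar F f = on_ar K g" if "f \<in> Ar G" "gcod G f = x" "g \<in> Ar H" "gcod H g = y" for f g
  proof -
    have "on_ar F f \<in> hom (grpdP Mr tgrpd) (on_ob F (gdom G f)) (on_ob F x)"
      "on_ar K g \<in> hom (grpdP Mr tgrpd) (on_ob K (gdom H g)) (on_ob K y)"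
      by (rule functor_hom[OF F], use that in \<open>simp add: hom_def\<close>,
          rule functor_hom[OF K], use that in \<open>simp add: hom_def\<close>)
    then have "fst (on_ar F f) = id" "length (snd (on_ar F f)) = length (on_ob F x)"
      "fst (on_ar K g) = id" "length (snd (on_ar K g)) = length (on_ob K y)"
      using hom_grpdP[of "fst (on_ar F f)" "snd (on_ar F f)" Mr tgrpd "on_ob F (gdom G f)" "on_ob F x"]
        hom_grpdP[of "fst (on_ar K g)" "snd (on_ar K g)" Mr tgrpd "on_ob K (gdom H g)" "on_ob K y"]
      by simp_all
    then show ?thesis using xy by (metis unit_list_eq_iff prod_eqI)
  qed
  have "{f \<in> Ar (pullback G H F K). gcod (pullback G H F K) f = (x, y)} =
      {f \<in> Ar G. gcod G f = x} \<times> {f \<in> Ar H. gcod H f = y}"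
    unfolding pullback_def by (auto intro: eq)
  then show ?thesis by (simp add: indeg_def card_cartesian_product)
qed

text \<open>The inputs of each entry may be permuted, but the entries keep their order: a factorial
  for each letter and none for the length.\<close>

lemma indeg_level_1:
  assumes "w \<in> words"
  shows "indeg T1 (word_op w) = prod_list (map fact w)"
proof -
  let ?fs = "map (\<lambda>k. (replicate k (), ((), replicate k ()))) w" and ?us = "replicate (length w) ()"
  have "indeg T1 (word_op w) = indeg (ops SymT) (?fs, ((), ?us))"
    unfolding level_1 word_op_def using op.indeg_relabel[of "ops SymT" "(?fs, ((), ?us))"]
    by (simp add: opF_def)
  also have "\<dots> = indeg (grpdP Mr (carr SymC)) ?fs * indeg (prod_grpd tgrpd (grpdP Mr tgrpd)) ((), ?us)"
    unfolding SymT_sel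
    by (rule indeg_pullback_Mr_terminal[OF is_functor_ctargets is_functor_repeat])
       (simp add: constP_unit mapP_def unit_list_eq_iff)
  also have "indeg (prod_grpd tgrpd (grpdP Mr tgrpd)) ((), ?us) = 1"
    using assms by (simp add: indeg_prod indeg_grpdP indeg_tgrpd words_def map_replicate_const)
  also have "indeg (grpdP Mr (carr SymC)) ?fs = prod_list (map (indeg (carr SymC)) ?fs)"
    using assms by (simp add: indeg_grpdP words_def)
  also have "map (indeg (carr SymC)) ?fs = map fact w"
  proof -
    have "indeg (carr SymC) (replicate k (), ((), replicate k ())) = fact k" if "k \<in> set w" for k
    proof -
      have "replicate k () \<noteq> []" using words_pos[OF assms that] by simp
      then show ?thesis using indeg_carr[of "replicate k ()"] by simp
    qed
    then show ?thesis by simp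
  qed
  finally show ?thesis by simp
qed

definition word_tree ::
  "nat list list \<times> nat list \<Rightarrow> sym_tree" where
  "word_tree = (\<lambda>(\<xi>s, \<eta>). Graft (map word_op \<xi>s) (unop (word_op \<eta>)))"

lemma Ob_ops': "Ob (ops SymT) = (\<lambda>w. unop (word_op w)) ` words"
proof -
  have "Op ` Ob (ops SymT) = word_op ` words"
    using Ob_level_1 unfolding level_1 by (simp add: relabel_def opF_def)
  from arg_cong[OF this, of "image unop"] show ?thesis by (simp add: image_image)
qed

lemma opinputs_length: "length (on_ob (opinputs SymT) (unop (word_op w))) = length w"
  by (simp add: SymT_sel(3) compF_def mapP_def pr1_def word_op_def)

text \<open>An operation has one input per letter of its word, so a list of words can be grafted
  onto it exactly when the lengths agree.\<close>

lemma Ob_level_2: "Ob T2 = word_tree ` {(\<xi>s, \<eta>). \<eta> \<in> words \<and> set \<xi>s \<subseteq> words \<and> length \<xi>s = length \<eta>}"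
proof (intro equalityI subsetI)
  fix t assume "t \<in> Ob T2"
  then obtain ts q where t: "t = Graft ts q" and ts: "set ts \<subseteq> Ob T1" and q: "q \<in> Ob (ops SymT)"
    and len: "length ts = length (on_ob (opinputs SymT) q)"
    unfolding level_2 by (auto simp: relabel_def graftF_def Ob_pullback grpdP_sel mapP_def dest: arg_cong[where f = length])
  obtain \<eta> where \<eta>: "\<eta> \<in> words" "q = unop (word_op \<eta>)" using q unfolding Ob_ops' by blast
  have "ts = map word_op (map op_word ts)"
  proof -
    have "word_op (op_word t) = t" if "t \<in> set ts" for t
      using that ts unfolding Ob_level_1 by auto
    then show ?thesis by (simp add: map_idI)
  qed
  moreover have "set (map op_word ts) \<subseteq> words"
    using ts unfolding Ob_level_1 by auto
  moreover have "length (map op_word ts) = length \<eta>" using len \<eta> opinputs_length by simp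
  ultimately show "t \<in> word_tree ` {(\<xi>s, \<eta>). \<eta> \<in> words \<and> set \<xi>s \<subseteq> words \<and> length \<xi>s = length \<eta>}"
    using \<eta> t by (intro image_eqI[of _ _ "(map op_word ts, \<eta>)"]) (auto simp: word_tree_def)
next
  fix t assume "t \<in> word_tree ` {(\<xi>s, \<eta>). \<eta> \<in> words \<and> set \<xi>s \<subseteq> words \<and> length \<xi>s = length \<eta>}"
  then obtain \<xi>s \<eta> where t: "t = word_tree (\<xi>s, \<eta>)" and w: "\<eta> \<in> words" "set \<xi>s \<subseteq> words" "length \<xi>s = length \<eta>"
    by auto
  have "map word_op \<xi>s \<in> Ob (grpdP Mr T1)"
    unfolding grpdP_sel Ob_level_1 using w by (auto simp: words_def)
  moreover have "unop (word_op \<eta>) \<in> Ob (ops SymT)" using w unfolding Ob_ops' by blast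
  moreover have "on_ob (mapP (outF SymT)) (map word_op \<xi>s) = on_ob (opinputs SymT) (unop (word_op \<eta>))"
    using w opinputs_length[of \<eta>] by (simp add: unit_list_eq_iff mapP_def)
  ultimately show "t \<in> Ob T2"
    unfolding level_2 t by (auto simp: relabel_def graftF_def Ob_pullback word_tree_def)
qed

lemma indeg_level_2:
  assumes "\<eta> \<in> words" "set \<xi>s \<subseteq> words" "length \<xi>s = length \<eta>"
  shows "indeg T2 (word_tree (\<xi>s, \<eta>)) = prod_list (map (\<lambda>\<xi>. prod_list (map fact \<xi>)) \<xi>s) * prod_list (map fact \<eta>)"
proof -
  have "indeg T2 (word_tree (\<xi>s, \<eta>)) = indeg grafts (map word_op \<xi>s, unop (word_op \<eta>))"
    unfolding level_2 word_tree_def using graft.indeg_relabel[of _ "(map word_op \<xi>s, unop (word_op \<eta>))"]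
    by (simp add: graftF_def)
  also have "\<dots> = indeg (grpdP Mr T1) (map word_op \<xi>s) * indeg (ops SymT) (unop (word_op \<eta>))"
    by (rule indeg_pullback_Mr_terminal[OF is_functor_outputs is_functor_opinputs])
       (use assms opinputs_length[of \<eta>] in \<open>simp add: unit_list_eq_iff mapP_def\<close>)
  also have "indeg (ops SymT) (unop (word_op \<eta>)) = indeg T1 (word_op \<eta>)"
  proof -
    have "word_op \<eta> = on_ob opF (unop (word_op \<eta>))" by (simp add: opF_def word_op_def)
    then show ?thesis unfolding level_1 by (metis op.indeg_relabel)
  qed
  also have "indeg (grpdP Mr T1) (map word_op \<xi>s) = prod_list (map (indeg T1) (map word_op \<xi>s))"
  proof -
    have "map word_op \<xi>s \<noteq> []" using assms by (auto simp: words_def)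
    from indeg_grpdP[OF this, of Mr T1] show ?thesis by simp
  qed
  also have "map (indeg T1) (map word_op \<xi>s) = map (\<lambda>\<xi>. prod_list (map fact \<xi>)) \<xi>s"
    unfolding map_map o_def by (rule map_cong[OF refl], rule indeg_level_1) (use assms in auto)
  finally show ?thesis using indeg_level_1[OF assms(1)] by simp
qed

text \<open>Arities multiply when arrows of \<open>SymC\<close> are composed, so a word grafted onto
  the letter k has its letters scaled by k. This is the scaling of variables that turns F into
  F_k.\<close>

lemma compose_word_tree:
  assumes "length \<xi>s = length \<eta>"
  shows "op_word (on_ob composeF (word_tree (\<xi>s, \<eta>))) = graft_word \<eta> \<xi>s"
proof -
  have ccomp: "length (fst (on_ob (ccomp SymC) ((us, u, vs), (us', u', vs')))) = length vs * length us'"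
    for us vs us' vs' u u'
    by (simp add: SymC_def T_cat_def Sym_def compF_def muP_def pr1_def length_concat sum_list_triv map_replicate_const o_def
        flip: map_replicate_const)
  have "op_word (on_ob composeF (word_tree (\<xi>s, \<eta>))) =
    map (length \<circ> fst) (concat (map (\<lambda>(f, gs, _). map (\<lambda>g. on_ob (ccomp SymC) (f, g)) gs)
      (zip (fst (unop (word_op \<eta>))) (map unop (map word_op \<xi>s)))))"
    by (simp add: op_word_def composeF_def compF_def opF_def unopF_def pairF_def mapP_def pr1_def pr2_def
        ungraftF_def word_tree_def SymT_def T_op_def T_operad_def SymC_def[symmetric] split_def)
  also have "\<dots> = graft_word \<eta> \<xi>s"
    using assms[symmetric]
    by (induction \<eta> \<xi>s rule: list_induct2) (simp_all add: word_op_def ccomp o_def)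
  finally show ?thesis .
qed

text \<open>Objects of \<open>T1\<close> are determined by their words, which reduces equality of
  composites to equality of words.\<close>

lemma compose_in_level_1: "t \<in> Ob T2 \<Longrightarrow> on_ob composeF t = word_op (op_word (on_ob composeF t))"
proof -
  assume "t \<in> Ob T2"
  then have "on_ob composeF t \<in> Ob T1" by (rule functor_ob[OF is_functor_compose])
  then obtain w where "on_ob composeF t = word_op w" unfolding Ob_level_1 by blast
  then show ?thesis by simp
qed

lemma composite_fibre:
  assumes "w \<in> words"
  shows "{t \<in> Ob T2. on_ob composeF t = word_op w} = word_tree ` word_trees w"
proof -
  have eq: "on_ob composeF (word_tree (\<xi>s, \<eta>)) = word_op w \<longleftrightarrow> graft_word \<eta> \<xi>s = w"
    if "\<eta> \<in> words" "set \<xi>s \<subseteq> words" "length \<xi>s = length \<eta>" for \<xi>s \<eta>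
  proof -
    have "word_tree (\<xi>s, \<eta>) \<in> Ob T2" unfolding Ob_level_2 using that by blast
    then show ?thesis using compose_in_level_1 compose_word_tree[OF that(3)] by (metis op_word_word_op)
  qed
  then show ?thesis unfolding Ob_level_2 word_trees_def by auto
qed

lemma SymX_symmetric_bar: "symmetric_bar SymX T0 T1 T2 composeF identityF"
proof
  show "lev SymX 0 = grpdP Sr T0" "lev SymX 1 = grpdP Sr T1" "lev SymX 2 = grpdP Sr T2"
    by (rule lev_SymX)+
  show "face SymX 2 1 = mapP composeF" "degen SymX 0 0 = mapP identityF"
    by (rule SymX_sel)+
  show "is_functor T2 T1 composeF" by (rule is_functor_compose)
  show "is_functor T0 T1 identityF" by (rule is_functor_identity)
  show "is_functor (grpdP Sr T2) (grpdP Sr T1) (face SymX 2 0)"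
    unfolding SymX_sel by (rule is_functor_mapP[OF is_functor_root])
  show "is_functor (grpdP Sr T2) (grpdP Sr T1) (face SymX 2 2)"
    unfolding SymX_sel
    by (rule is_functor_compF[OF is_functor_mapP[OF is_functor_leaves] is_functor_muP[OF groupoid_level_1]]) simp
  show skel0: "skeletal T0" unfolding level_0 by (rule col.skeletal_relabel[OF skeletal_terminal])
  have ops: "skeletal (ops SymT)"
    unfolding SymT_sel SymC_sel
    by (intro skeletal_pullback skeletal_grpdP_Mr skeletal_prod skeletal_terminal skeletal_grpdP_terminal)
  then show skel1: "skeletal T1" unfolding level_1 by (rule op.skeletal_relabel)
  show "skeletal T2"
    unfolding level_2 by (intro graft.skeletal_relabel skeletal_pullback skeletal_grpdP_Mr skel1 ops)
  have fact_pos: "prod_list (map fact w) > (0::nat)" for w :: "nat list" by (induction w) auto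
  show "indeg T0 x > 0" if "x \<in> Ob T0" for x
    using indeg_level_0[OF that] by simp
  show "indeg T1 x > 0" if "x \<in> Ob T1" for x
    using that unfolding Ob_level_1 by (auto simp: indeg_level_1 fact_pos simp del: One_nat_def)
  have "prod_list (map (\<lambda>\<xi>. prod_list (map fact \<xi>)) \<xi>s) > (0::nat)" for \<xi>s :: "nat list list"
    by (induction \<xi>s) (auto simp: fact_pos)
  then show "indeg T2 x > 0" if "x \<in> Ob T2" for x
    using that unfolding Ob_level_2 by (auto simp: indeg_level_2 fact_pos)
  show "finite {z \<in> Ob T2. on_ob composeF z = y}" if "y \<in> Ob T1" for y
    using that unfolding Ob_level_1 by (auto simp: composite_fibre finite_word_trees simp del: One_nat_def)
  show "finite {z \<in> Ob T0. on_ob identityF z = y}" for y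
    unfolding level_0 by (auto simp: relabel_def)
qed

section \<open>Linear extensions\<close>

lemma lookup_smul [simp]: "lookup (smul c v) x = c * lookup v x"
  by (simp add: smul_def Poly_Mapping.map.rep_eq when_def)

lemma smul_single [simp]: "smul c (single b d) = single b (c * d)"
  by (rule poly_mapping_eqI) (simp add: lookup_single when_def)

lemma smul_add: "smul c (u + v) = smul c u + smul c v"
  by (rule poly_mapping_eqI) (simp add: lookup_add algebra_simps)

lemma smul_add_left: "smul (c + d) v = smul c v + smul d v"
  by (rule poly_mapping_eqI) (simp add: lookup_add algebra_simps)

lemma smul_smul: "smul c (smul d v) = smul (c * d) v"
  by (rule poly_mapping_eqI) simp

lemma smul_zero [simp]: "smul 0 v = 0" "smul c 0 = 0"
  by (rule poly_mapping_eqI, simp)+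

lemma smul_one [simp]: "smul 1 v = v"
  by (rule poly_mapping_eqI) simp

lemma poly_mapping_as_sum:
  "v = (\<Sum>b\<in>keys v. single b (lookup v b))"
proof (rule poly_mapping_eqI)
  fix x
  have "lookup (\<Sum>b\<in>keys v. single b (lookup v b)) x =
      (\<Sum>b\<in>keys v. if b = x then lookup v b else 0)"
    by (simp add: lookup_sum lookup_single when_def)
  also have "\<dots> = lookup v x"
    by (simp add: in_keys_iff)
  finally show "lookup v x =
      lookup (\<Sum>b\<in>keys v. single b (lookup v b)) x" ..
qed

lemma additive_sum:
  fixes f :: "('b \<Rightarrow>\<^sub>0 rat) \<Rightarrow> 'c :: ab_group_add"
  assumes "\<And>u v. f (u + v) = f u + f v"
  shows "f (sum h A) = (\<Sum>a\<in>A. f (h a))"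
proof -
  have "f 0 = 0" using assms[of 0 0] by simp
  then show ?thesis by (induction A rule: infinite_finite_induct) (simp_all add: assms)
qed

text \<open>The coefficient c is arbitrary, so additivity alone reduces an identity to multiples of
  basis vectors.\<close>

lemma additive_eqI:
  fixes f g :: "('b \<Rightarrow>\<^sub>0 rat) \<Rightarrow> 'c :: ab_group_add"
  assumes "\<And>u v. f (u + v) = f u + f v" "\<And>u v. g (u + v) = g u + g v"
    and "\<And>b c. b \<in> keys v \<Longrightarrow> f (single b c) = g (single b c)"
  shows "f v = g v"
  by (subst (1 2) poly_mapping_as_sum[of v]) (simp add: additive_sum[OF assms(1)] additive_sum[OF assms(2)] assms(3))

text \<open>Keys may disappear from \<open>u + v\<close> by cancellation, so all three sums are
  first extended to the union of the two supports.\<close>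

lemma sum_keys_additive:
  fixes h :: "'b \<Rightarrow> rat \<Rightarrow> 'c :: ab_group_add"
  assumes h: "\<And>b c d. h b (c + d) = h b c + h b d"
  shows "(\<Sum>b\<in>keys (u + v). h b (lookup (u + v) b)) =
    (\<Sum>b\<in>keys u. h b (lookup u b)) +
    (\<Sum>b\<in>keys v. h b (lookup v b))"
proof -
  let ?S = "keys u \<union> keys v"
  have h0: "h b 0 = 0" for b using h[of b 0 0] by simp
  have *: "(\<Sum>b\<in>keys w. h b (lookup w b)) = (\<Sum>b\<in>?S. h b (lookup w b))"
    if "keys w \<subseteq> ?S" for w
    by (rule sum.mono_neutral_left) (use that in \<open>auto simp: in_keys_iff h0\<close>)
  show ?thesis
    using *[OF Poly_Mapping.keys_add] *[of u] *[of v] by (simp add: lookup_add h sum.distrib)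
qed

lemma lin_ext_add: "lin_ext h (u + v) = lin_ext h u + lin_ext h v"
  unfolding lin_ext_def by (rule sum_keys_additive) (rule smul_add_left)

lemma lin_ext_single [simp]: "lin_ext h (single b c) = smul c (h b)"
  by (simp add: lin_ext_def)

lemma lin_ext_smul: "lin_ext h (smul c v) = smul c (lin_ext h v)"
  by (rule additive_eqI[where v = v]) (simp_all add: smul_add lin_ext_add smul_smul)

lemma keys_lin_ext: "keys (lin_ext h v) \<subseteq> (\<Union>b\<in>keys v. keys (h b))"
proof -
  have "keys (lin_ext h v) \<subseteq>
      (\<Union>b\<in>keys v. keys (smul (lookup v b) (h b)))"
    unfolding lin_ext_def by (rule Poly_Mapping.keys_sum)
  also have "\<dots> \<subseteq> (\<Union>b\<in>keys v. keys (h b))"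
    by (rule UN_mono) (auto simp: in_keys_iff)
  finally show ?thesis .
qed

section \<open>Evaluation of polynomials\<close>

text \<open>The multiplicative extension of g to monomials, the common form of
  \<open>eval_mono\<close> and of the comultiplication on monomials.\<close>

definition mono_prod :: "('b \<Rightarrow> 'c :: comm_monoid_mult) \<Rightarrow> ('b \<Rightarrow>\<^sub>0 nat) \<Rightarrow> 'c" where
  "mono_prod g m = (\<Prod>w\<in>keys m. g w ^ lookup m w)"

lemma mono_prod_superset:
  assumes "finite S" "keys m \<subseteq> S"
  shows "mono_prod g m = (\<Prod>w\<in>S. g w ^ lookup m w)"
  unfolding mono_prod_def by (rule prod.mono_neutral_left) (use assms in \<open>auto simp: in_keys_iff\<close>)

lemma mono_prod_add: "mono_prod g (m + n) = mono_prod g m * mono_prod g n"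
proof -
  let ?S = "keys m \<union> keys n"
  have "mono_prod g (m + n) = (\<Prod>w\<in>?S. g w ^ lookup (m + n) w)"
    "mono_prod g m = (\<Prod>w\<in>?S. g w ^ lookup m w)"
    "mono_prod g n = (\<Prod>w\<in>?S. g w ^ lookup n w)"
    using Poly_Mapping.keys_add[of m n] by (simp_all add: mono_prod_superset)
  then show ?thesis by (simp add: lookup_add power_add prod.distrib)
qed

lemma mono_prod_zero [simp]: "mono_prod g 0 = 1"
  by (simp add: mono_prod_def)

text \<open>Presents a monomial by a list, the form of a tuple of operations; forgetting the order
  of the list is what passing to isomorphism classes does, see
  \<open>word_mono_eq_iff\<close>.\<close>

definition word_mono :: "nat list list \<Rightarrow> mono" where
  "word_mono ws = sum_list (map (\<lambda>w. single w 1) ws)"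

lemma word_mono_simps [simp]:
  "word_mono [] = 0" "word_mono (w # ws) = single w 1 + word_mono ws"
  "word_mono (us @ ws) = word_mono us + word_mono ws"
  by (simp_all add: word_mono_def)

lemma mono_prod_word_mono: "mono_prod g (word_mono ws) = prod_list (map g ws)"
proof (induction ws)
  case (Cons w ws)
  have "mono_prod g (single w 1) = g w" by (simp add: mono_prod_def)
  then show ?case using Cons by (simp add: mono_prod_add)
qed simp

lemma lookup_word_mono: "lookup (word_mono ws) w = count (mset ws) w"
  by (induction ws) (simp_all add: lookup_add lookup_single when_def)

lemma keys_word_mono: "keys (word_mono ws) = set ws"
  by (auto simp: in_keys_iff lookup_word_mono)

lemma word_mono_eq_iff: "word_mono us = word_mono ws \<longleftrightarrow> mset us = mset ws"
  by (auto simp: poly_mapping_eq_iff fun_eq_iff lookup_word_mono multiset_eq_iff)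

lemma word_mono_surj:
  obtains ws where "m = word_mono ws"
proof -
  have "\<exists>M. count M = lookup m"
    using Poly_Mapping.finite_keys[of m]
    by (intro exI[of _ "Abs_multiset (lookup m)"] Abs_multiset_inverse)
      (simp add: Poly_Mapping.keys.rep_eq)
  then obtain M where M: "count M = lookup m" by blast
  obtain ws where "mset ws = M" using ex_mset by blast
  then have "m = word_mono ws" by (intro poly_mapping_eqI) (simp add: lookup_word_mono M)
  then show thesis by (rule that)
qed

lemma word_mono_monomials: "word_mono ws \<in> monomials \<longleftrightarrow> set ws \<subseteq> words"
  by (simp add: monomials_def keys_word_mono)

lemma eval_mono_word_mono: "eval_mono (word_mono ws) F = prod_list (map (\<lambda>w. coord w F) ws)"
  using mono_prod_word_mono[of "\<lambda>w. coord w F"] by (simp add: eval_mono_def mono_prod_def)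

lemma eval_poly_add: "eval_poly (p + q) F = eval_poly p F + eval_poly q F"
  unfolding eval_poly_def by (rule sum_keys_additive) (simp add: algebra_simps)

lemma eval_poly2_add: "eval_poly2 (p + q) F G = eval_poly2 p F G + eval_poly2 q F G"
  unfolding eval_poly2_def split_def
  using sum_keys_additive[of "\<lambda>x c. c * eval_mono (fst x) F * eval_mono (snd x) G" p q]
  by (simp add: algebra_simps)

lemma eval_poly2_single: "eval_poly2 (single (m, n) c) F G = c * eval_mono m F * eval_mono n G"
  by (simp add: eval_poly2_def)

text \<open>Dedekind's argument: subtracting \<open>\<chi> a y\<close> times the relation at x from
  the relation at \<open>mul x y\<close> removes the term of a and leaves a shorter relation, whose
  coefficients are scaled by \<open>\<chi> i y - \<chi> a y\<close>.\<close>

lemma characters_independent: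
  fixes \<chi> :: "'i \<Rightarrow> 'x \<Rightarrow> 'k :: idom"
  assumes "finite S"
    and "\<And>x y. x \<in> D \<Longrightarrow> y \<in> D \<Longrightarrow> mul x y \<in> D"
    and "\<And>i x y. i \<in> S \<Longrightarrow> x \<in> D \<Longrightarrow> y \<in> D \<Longrightarrow> \<chi> i (mul x y) = \<chi> i x * \<chi> i y"
    and "\<And>i. i \<in> S \<Longrightarrow> \<exists>x\<in>D. \<chi> i x \<noteq> 0"
    and "\<And>i j. i \<in> S \<Longrightarrow> j \<in> S \<Longrightarrow> i \<noteq> j \<Longrightarrow> \<exists>x\<in>D. \<chi> i x \<noteq> \<chi> j x"
    and "\<And>x. x \<in> D \<Longrightarrow> (\<Sum>i\<in>S. c i * \<chi> i x) = 0"
  shows "\<forall>i\<in>S. c i = 0"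
  using assms
proof (induction S arbitrary: c rule: finite_induct)
  case (insert a S)
  have "c j = 0" if j: "j \<in> S" for j
  proof -
    obtain y where y: "y \<in> D" "\<chi> j y \<noteq> \<chi> a y" using insert.prems(4)[of j a] insert.hyps j by auto
    have "(\<Sum>i\<in>S. c i * (\<chi> i y - \<chi> a y) * \<chi> i x) = 0" if x: "x \<in> D" for x
    proof -
      have "(\<Sum>i\<in>S. c i * (\<chi> i y - \<chi> a y) * \<chi> i x) = (\<Sum>i\<in>insert a S. c i * (\<chi> i y - \<chi> a y) * \<chi> i x)"
        using insert.hyps by simp
      also have "\<dots> = (\<Sum>i\<in>insert a S. c i * \<chi> i (mul x y)) - \<chi> a y * (\<Sum>i\<in>insert a S. c i * \<chi> i x)"
        unfolding sum_distrib_left sum_subtractf[symmetric]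
        by (rule sum.cong[OF refl], subst insert.prems(2)[OF _ x y(1)]) (simp_all add: algebra_simps)
      also have "\<dots> = 0"
        unfolding insert.prems(5)[OF x] insert.prems(5)[OF insert.prems(1)[OF x y(1)]] by simp
      finally show ?thesis .
    qed
    then have "\<forall>i\<in>S. c i * (\<chi> i y - \<chi> a y) = 0"
      by (intro insert.IH) (use insert.prems in \<open>blast+\<close>)
    then show ?thesis using j y(2) by auto
  qed
  moreover obtain x where "x \<in> D" "\<chi> a x \<noteq> 0" using insert.prems(3)[of a] by auto
  ultimately show ?case using insert.prems(5)[of x] insert.hyps by simp
qed simp

lemma word_fact_nonzero: "word_fact w \<noteq> 0"
  by (induction w) (simp_all add: word_fact_def)

text \<open>Under the coordinatewise product of series, the pairs of monomials are pairwise distinct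
  characters of pairs of series, so a difference of polynomials that vanishes everywhere has zero
  coefficients.\<close>

lemma eval_poly2_inj:
  assumes p: "keys p \<subseteq> monomials \<times> monomials" and q: "keys q \<subseteq> monomials \<times> monomials"
    and eq: "\<And>F G. F \<in> series_plus \<Longrightarrow> G \<in> series_plus \<Longrightarrow> eval_poly2 p F G = eval_poly2 q F G"
  shows "p = q"
proof -
  define S where "S = keys p \<union> keys q"
  define \<chi> where "\<chi> = (\<lambda>(m, n) (F, G). eval_mono m F * eval_mono n G)"
  \<comment> \<open>The factor \<open>word_fact w\<close> makes \<open>coord\<close> multiplicative:
    a product of two coordinates contains it twice, while \<open>coord\<close> supplies it
    once.\<close>
  define mul :: "series \<Rightarrow> series \<Rightarrow> series" where "mul F F' = (\<lambda>w. word_fact w * F w * F' w)" for F F'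
  define ser :: "(nat list \<Rightarrow> rat) \<Rightarrow> series" where "ser f = (\<lambda>w. if w \<in> words then f w / word_fact w else 0)" for f
  have S: "finite S" "S \<subseteq> monomials \<times> monomials" using p q by (auto simp: S_def)
  have coord_mul: "coord w (mul F F') = coord w F * coord w F'" for w F F'
    by (simp add: coord_def mul_def)
  have coord_ser: "coord w (ser f) = f w" if "w \<in> words" for w f
    using that by (simp add: coord_def ser_def word_fact_nonzero)
  have eval_mul: "eval_mono m (mul F F') = eval_mono m F * eval_mono m F'" for m F F'
    by (simp add: eval_mono_def coord_mul power_mult_distrib prod.distrib)
  have eval_ser: "eval_mono m (ser f) = (\<Prod>w\<in>keys m. f w ^ lookup m w)"
    if "m \<in> monomials" for m f
    unfolding eval_mono_def by (rule prod.cong[OF refl]) (use that in \<open>auto simp: monomials_def coord_ser\<close>)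
  have eval_one: "eval_mono m (ser (\<lambda>_. 1)) = 1" if "m \<in> monomials" for m
    using that by (simp add: eval_ser)
  have ser_plus: "ser f \<in> series_plus" for f by (simp add: ser_def series_plus_def)
  have distinct: "\<exists>F\<in>series_plus. eval_mono m F \<noteq> eval_mono m' F"
    if m: "m \<in> monomials" "m' \<in> monomials" "m \<noteq> m'" for m m'
  proof -
    obtain w where w: "lookup m w \<noteq> lookup m' w"
      using m(3) poly_mapping_eqI[of m m'] by blast
    \<comment> \<open>With coordinate 2 at w and 1 elsewhere, a monomial takes the value 2 to the
      power of its exponent at w, which separates different exponents.\<close>
    have "eval_mono n (ser (\<lambda>v. if v = w then 2 else 1)) = 2 ^ lookup n w" if "n \<in> monomials" for n
    proof -
      have "eval_mono n (ser (\<lambda>v. if v = w then 2 else 1)) =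
          (\<Prod>v\<in>keys n. if v = w then 2 ^ lookup n v else 1)"
        unfolding eval_ser[OF that] by (rule prod.cong[OF refl]) simp
      also have "\<dots> = 2 ^ lookup n w"
        by (simp add: in_keys_iff)
      finally show ?thesis .
    qed
    then show ?thesis using w m ser_plus by (intro bexI[of _ "ser (\<lambda>v. if v = w then 2 else 1)"]) simp_all
  qed
  have "\<forall>i\<in>S. lookup p i - lookup q i = 0"
  proof (rule characters_independent[of S "series_plus \<times> series_plus" "\<lambda>(F, G) (F', G'). (mul F F', mul G G')" \<chi>])
    show "finite S" by (rule S)
    show "(case x of (F, G) \<Rightarrow> \<lambda>(F', G'). (mul F F', mul G G')) y \<in> series_plus \<times> series_plus"
      if "x \<in> series_plus \<times> series_plus" "y \<in> series_plus \<times> series_plus" for x y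
      using that by (auto simp: series_plus_def mul_def)
    show "\<chi> i ((case x of (F, G) \<Rightarrow> \<lambda>(F', G'). (mul F F', mul G G')) y) = \<chi> i x * \<chi> i y" for i x y
      by (cases i; cases x; cases y) (simp add: \<chi>_def eval_mul)
    show "\<exists>x\<in>series_plus \<times> series_plus. \<chi> i x \<noteq> 0" if "i \<in> S" for i
      using that S(2) ser_plus eval_one
      by (intro bexI[of _ "(ser (\<lambda>_. 1), ser (\<lambda>_. 1))"]) (auto simp: \<chi>_def)
    show "\<exists>x\<in>series_plus \<times> series_plus. \<chi> i x \<noteq> \<chi> j x" if ij: "i \<in> S" "j \<in> S" "i \<noteq> j" for i j
    proof -
      obtain m n m' n' where e: "i = (m, n)" "j = (m', n')" by (cases i; cases j)
      have mon: "m \<in> monomials" "n \<in> monomials" "m' \<in> monomials" "n' \<in> monomials"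
        using ij S(2) e by auto
      show ?thesis
      proof (cases "m = m'")
        case False
        then obtain F where "F \<in> series_plus" "eval_mono m F \<noteq> eval_mono m' F" using distinct mon by blast
        then show ?thesis using ser_plus mon e
          by (intro bexI[of _ "(F, ser (\<lambda>_. 1))"]) (auto simp: \<chi>_def eval_one)
      next
        case True
        then have "n \<noteq> n'" using ij(3) e by simp
        then obtain F where "F \<in> series_plus" "eval_mono n F \<noteq> eval_mono n' F" using distinct mon by blast
        then show ?thesis using ser_plus mon e
          by (intro bexI[of _ "(ser (\<lambda>_. 1), F)"]) (auto simp: \<chi>_def eval_one)
      qed
    qed
    show "(\<Sum>i\<in>S. (lookup p i - lookup q i) * \<chi> i x) = 0"
      if x: "x \<in> series_plus \<times> series_plus" for x
    proof -
      obtain F G where FG: "x = (F, G)" "F \<in> series_plus" "G \<in> series_plus" using x by blast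
      have *: "eval_poly2 r F G = (\<Sum>i\<in>S. lookup r i * \<chi> i x)" if "keys r \<subseteq> S" for r
        unfolding eval_poly2_def split_def
        by (rule sum.mono_neutral_cong_left)
           (use that S(1) in \<open>auto simp: in_keys_iff \<chi>_def FG algebra_simps\<close>)
      show ?thesis using *[of p] *[of q] eq[OF FG(2,3)]
        by (simp add: S_def left_diff_distrib sum_subtractf)
    qed
  qed
  moreover have "lookup p i = 0 \<and> lookup q i = 0" if "i \<notin> S" for i
    using that by (simp add: S_def in_keys_iff)
  ultimately have "lookup p i = lookup q i" for i
    by (metis eq_iff_diff_eq_0)
  then show ?thesis by (rule poly_mapping_eqI)
qed

section \<open>Plethystic substitution\<close>

text \<open>At most one word scales to u; writing its coefficient as a sum lets products over
  several letters be expanded by distributivity.\<close>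

lemma dilate_eq_sum:
  assumes "F \<in> series_plus" "k > 0"
  shows "dilate k F u = (\<Sum>\<xi>\<in>{\<xi> \<in> words. map ((*) k) \<xi> = u}. F \<xi>)"
    and "finite {\<xi> \<in> words. map ((*) k) \<xi> = u}"
proof -
  let ?\<xi> = "map (\<lambda>i. i div k) u"
  have *: "map ((*) k) \<xi> = u \<longleftrightarrow> (\<forall>i\<in>set u. k dvd i) \<and> \<xi> = ?\<xi>" for \<xi>
    using assms(2) by (auto simp: map_idI o_def)
  then have eq: "{\<xi> \<in> words. map ((*) k) \<xi> = u} = (if (\<forall>i\<in>set u. k dvd i) \<and> ?\<xi> \<in> words then {?\<xi>} else {})"
    by auto
  show "finite {\<xi> \<in> words. map ((*) k) \<xi> = u}" unfolding eq by simp
  show "dilate k F u = (\<Sum>\<xi>\<in>{\<xi> \<in> words. map ((*) k) \<xi> = u}. F \<xi>)"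
    unfolding eq using assms(1) by (auto simp: dilate_def series_plus_def)
qed

definition splits :: "nat list \<Rightarrow> nat list \<Rightarrow> nat list list set" where
  "splits \<eta> w = {\<xi>s. set \<xi>s \<subseteq> words \<and> length \<xi>s = length \<eta> \<and> graft_word \<eta> \<xi>s = w}"

lemma splits_Nil: "splits [] w = (if w = [] then {[]} else {})"
  by (auto simp: splits_def)

lemma finite_splits:
  assumes "0 \<notin> set \<eta>"
  shows "finite (splits \<eta> w)"
proof (cases "\<eta> = []")
  case False
  then have "splits \<eta> w \<subseteq> fst ` word_trees w"
    using assms by (force simp: splits_def word_trees_def words_def)
  then show ?thesis using finite_word_trees finite_subset by blast
qed (simp add: splits_Nil)

text \<open>Expanding the product cuts w into one block per letter of the root, each block being a
  word scaled by its letter.\<close>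

lemma series_prod_dilate:
  assumes F: "F \<in> series_plus" and "0 \<notin> set \<eta>"
  shows "series_prod (map (\<lambda>k. dilate k F) \<eta>) w = (\<Sum>\<xi>s\<in>splits \<eta> w. prod_list (map F \<xi>s))"
  using assms(2)
proof (induction \<eta> arbitrary: w)
  case Nil
  then show ?case by (simp add: series_prod_def series_one_def splits_Nil)
next
  case (Cons k \<eta>)
  then have k: "k > 0" and \<eta>: "0 \<notin> set \<eta>" by auto
  let ?A = "\<lambda>i. {\<xi> \<in> words. map ((*) k) \<xi> = take i w}"
  have "series_prod (map (\<lambda>k. dilate k F) (k # \<eta>)) w =
      (\<Sum>i\<le>length w. dilate k F (take i w) * series_prod (map (\<lambda>k. dilate k F) \<eta>) (drop i w))"
    by (simp add: series_prod_def series_mult_def)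
  also have "\<dots> = (\<Sum>i\<le>length w. \<Sum>(\<xi>, \<xi>s)\<in>?A i \<times> splits \<eta> (drop i w). prod_list (map F (\<xi> # \<xi>s)))"
    unfolding dilate_eq_sum(1)[OF F k] Cons.IH[OF \<eta>] sum_product sum.cartesian_product by simp
  also have "\<dots> = (\<Sum>(i, \<xi>, \<xi>s)\<in>(SIGMA i:{..length w}. ?A i \<times> splits \<eta> (drop i w)). prod_list (map F (\<xi> # \<xi>s)))"
    by (subst sum.Sigma) (use dilate_eq_sum(2)[OF F k] finite_splits[OF \<eta>] in \<open>auto simp: split_def\<close>)
  \<comment> \<open>The cut point carries no information of its own: it is the length of the first
    leaf word.\<close>
  also have "\<dots> = (\<Sum>\<xi>s\<in>splits (k # \<eta>) w. prod_list (map F \<xi>s))"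
  proof (rule sum.reindex_bij_witness[of _ "\<lambda>\<xi>s. (length (hd \<xi>s), hd \<xi>s, tl \<xi>s)" "\<lambda>(i, \<xi>, \<xi>s). \<xi> # \<xi>s"])
    fix a assume a: "a \<in> (SIGMA i:{..length w}. ?A i \<times> splits \<eta> (drop i w))"
    obtain i \<xi> \<xi>s where e: "a = (i, \<xi>, \<xi>s)" by (cases a)
    have *: "i \<le> length w" "\<xi> \<in> words" "map ((*) k) \<xi> = take i w" "\<xi>s \<in> splits \<eta> (drop i w)"
      using a e by auto
    have "length \<xi> = i" using arg_cong[OF *(3), of length] *(1) by simp
    then show "(\<lambda>\<xi>s. (length (hd \<xi>s), hd \<xi>s, tl \<xi>s)) (case a of (i, \<xi>, \<xi>s) \<Rightarrow> \<xi> # \<xi>s) = a"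
      by (simp add: e)
    show "(case a of (i, \<xi>, \<xi>s) \<Rightarrow> \<xi> # \<xi>s) \<in> splits (k # \<eta>) w"
      using * by (simp add: e splits_def)
  next
    fix \<zeta> assume z: "\<zeta> \<in> splits (k # \<eta>) w"
    then obtain \<xi> \<xi>s where e: "\<zeta> = \<xi> # \<xi>s" by (cases \<zeta>) (auto simp: splits_def)
    then show "(case (length (hd \<zeta>), hd \<zeta>, tl \<zeta>) of (i, \<xi>, \<xi>s) \<Rightarrow> \<xi> # \<xi>s) = \<zeta>" by simp
    have w: "w = map ((*) k) \<xi> @ graft_word \<eta> \<xi>s" using z e by (simp add: splits_def)
    show "(length (hd \<zeta>), hd \<zeta>, tl \<zeta>) \<in> (SIGMA i:{..length w}. ?A i \<times> splits \<eta> (drop i w))"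
      using z unfolding e w by (simp add: splits_def)
  qed auto
  finally show ?case .
qed

lemma plethysm_eq_sum:
  assumes F: "F \<in> series_plus"
  shows "(G \<circledast> F) w = (\<Sum>(\<xi>s, \<eta>)\<in>word_trees w. G \<eta> * prod_list (map F \<xi>s))"
proof -
  let ?sp = "\<lambda>\<eta>. series_prod (map (\<lambda>k. dilate k F) \<eta>) w"
  have sp: "?sp \<eta> = (\<Sum>\<xi>s\<in>splits \<eta> w. prod_list (map F \<xi>s))" if "\<eta> \<in> words" for \<eta>
    using that by (intro series_prod_dilate[OF F]) (simp add: words_def)
  have E: "snd ` word_trees w \<subseteq> words" by (auto simp: word_trees_def)
  \<comment> \<open>A root with nonvanishing product occurs in some tree over w, so the sum may run
    over the finite set of roots of such trees; the roots added in this way contribute zero.\<close>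
  have ne: "\<eta> \<in> snd ` word_trees w" if "\<eta> \<in> words" "?sp \<eta> \<noteq> 0" for \<eta>
  proof -
    have "splits \<eta> w \<noteq> {}" using that sp[OF that(1)] by force
    then show ?thesis using that(1) by (force simp: splits_def word_trees_def)
  qed
  have "(G \<circledast> F) w = (\<Sum>\<eta>\<in>{\<eta>\<in>words. ?sp \<eta> \<noteq> 0}. G \<eta> * ?sp \<eta>)"
    by (simp add: plethysm_def)
  also have "\<dots> = (\<Sum>\<eta>\<in>snd ` word_trees w. G \<eta> * ?sp \<eta>)"
    by (rule sum.mono_neutral_left) (use finite_word_trees ne E in auto)
  also have "\<dots> = (\<Sum>\<eta>\<in>snd ` word_trees w. \<Sum>\<xi>s\<in>splits \<eta> w. G \<eta> * prod_list (map F \<xi>s))"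
    by (rule sum.cong[OF refl]) (use sp E in \<open>auto simp: sum_distrib_left\<close>)
  also have "\<dots> = (\<Sum>(\<eta>, \<xi>s)\<in>(SIGMA \<eta>:snd ` word_trees w. splits \<eta> w). G \<eta> * prod_list (map F \<xi>s))"
    by (rule sum.Sigma) (use finite_word_trees E finite_splits in \<open>auto simp: words_def subset_iff\<close>)
  also have "(SIGMA \<eta>:snd ` word_trees w. splits \<eta> w) = prod.swap ` word_trees w"
    by (force simp: word_trees_def splits_def)
  also have "(\<Sum>(\<eta>, \<xi>s)\<in>prod.swap ` word_trees w. G \<eta> * prod_list (map F \<xi>s)) =
      (\<Sum>(\<xi>s, \<eta>)\<in>word_trees w. G \<eta> * prod_list (map F \<xi>s))"
    by (subst sum.reindex) (auto simp: split_def)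
  finally show ?thesis .
qed

text \<open>The factor converts plain coefficients into normalised coordinates; it is also the order
  of the automorphism group of the composite divided by that of the tree. Leaves go to the first
  tensor factor, evaluated at the inner series, and the root to the second.\<close>

definition tree_term :: "nat list list \<times> nat list \<Rightarrow> (mono \<times> mono \<Rightarrow>\<^sub>0 rat)" where
  "tree_term = (\<lambda>(\<xi>s, \<eta>). single (word_mono \<xi>s, word_mono [\<eta>])
     (word_fact (graft_word \<eta> \<xi>s) / (prod_list (map word_fact \<xi>s) * word_fact \<eta>)))"

lemma keys_sum_subsetI:
  "(\<And>a. a \<in> A \<Longrightarrow> keys (h a) \<subseteq> B) \<Longrightarrow> keys (sum h A) \<subseteq> B"
  using Poly_Mapping.keys_sum[of h A] by blast

lemma eval_tree_term:
  "eval_poly2 (tree_term (\<xi>s, \<eta>)) F G = word_fact (graft_word \<eta> \<xi>s) * (G \<eta> * prod_list (map F \<xi>s))"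
proof -
  have "prod_list (map (\<lambda>w. coord w F) \<xi>s) = prod_list (map word_fact \<xi>s) * prod_list (map F \<xi>s)"
    by (induction \<xi>s) (simp_all add: coord_def)
  moreover have "prod_list (map word_fact \<xi>s) \<noteq> 0"
    by (induction \<xi>s) (simp_all add: word_fact_nonzero)
  moreover have "eval_mono (word_mono [\<eta>]) G = word_fact \<eta> * G \<eta>"
    unfolding eval_mono_word_mono by (simp add: coord_def)
  ultimately show ?thesis
    unfolding tree_term_def prod.case eval_poly2_single eval_mono_word_mono[of \<xi>s]
    by (simp add: word_fact_nonzero field_simps)
qed

text \<open>The expansion of plethysm over trees supplies a polynomial with the required values, and
  \<open>eval_poly2_inj\<close> the uniqueness that the definite description calls for.\<close>

lemma pleth_comult_gen_eq: "pleth_comult_gen w = sum tree_term (word_trees w)"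
  unfolding pleth_comult_gen_def
proof (rule the_equality)
  let ?p = "sum tree_term (word_trees w)"
  have keys: "keys ?p \<subseteq> monomials \<times> monomials"
    by (rule keys_sum_subsetI)
       (auto simp: tree_term_def word_trees_def word_mono_monomials split: if_splits simp del: word_mono_simps)
  have eval: "eval_poly2 ?p F G = coord w (G \<circledast> F)" if "F \<in> series_plus" for F G
  proof -
    have "eval_poly2 ?p F G = (\<Sum>t\<in>word_trees w. eval_poly2 (tree_term t) F G)"
      by (rule additive_sum[where f = "\<lambda>p. eval_poly2 p F G"]) (rule eval_poly2_add)
    also have "\<dots> = (\<Sum>(\<xi>s, \<eta>)\<in>word_trees w. word_fact w * (G \<eta> * prod_list (map F \<xi>s)))"
      by (rule sum.cong[OF refl]) (auto simp: eval_tree_term word_trees_def)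
    also have "\<dots> = coord w (G \<circledast> F)"
      by (simp add: coord_def plethysm_eq_sum[OF that] sum_distrib_left split_def)
    finally show ?thesis .
  qed
  show "keys ?p \<subseteq> monomials \<times> monomials \<and>
      (\<forall>F\<in>series_plus. \<forall>G\<in>series_plus. eval_poly2 ?p F G = coord w (G \<circledast> F))"
    using keys eval by blast
  fix p assume "keys p \<subseteq> monomials \<times> monomials \<and>
      (\<forall>F\<in>series_plus. \<forall>G\<in>series_plus. eval_poly2 p F G = coord w (G \<circledast> F))"
  then show "p = ?p" using keys eval by (intro eval_poly2_inj) auto
qed

text \<open>Distributivity: a product of comultiplications of generators expands into choices of one
  tree for each factor.\<close>

lemma prod_list_sum_listset:
  fixes h :: "'b \<Rightarrow> 'c :: comm_semiring_1"
  assumes "\<forall>A\<in>set As. finite A"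
  shows "prod_list (map (sum h) As) = (\<Sum>cs\<in>listset As. prod_list (map h cs))"
  using assms
proof (induction As)
  case (Cons A As)
  have "(\<Sum>cs\<in>listset (A # As). prod_list (map h cs)) = (\<Sum>(c, cs)\<in>A \<times> listset As. h c * prod_list (map h cs))"
    unfolding listset_Cons_eq
    by (subst sum.reindex) (auto simp: inj_on_def split_def)
  also have "\<dots> = sum h A * (\<Sum>cs\<in>listset As. prod_list (map h cs))"
    by (simp add: sum_product sum.cartesian_product)
  finally show ?case using Cons by simp
qed simp

interpretation SymX: symmetric_bar SymX T0 T1 T2 composeF identityF
  by (rule SymX_symmetric_bar)

abbreviation "Confs \<equiv> grpdP Sr T1"

section \<open>The isomorphism\<close>

definition conf_mono :: "sym_tree list \<Rightarrow> mono" where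
  "conf_mono xs = word_mono (map op_word xs)"

lemma Ob_Confs: "Ob Confs = map word_op ` {ws. ws \<noteq> [] \<and> set ws \<subseteq> words}"
proof (intro equalityI subsetI)
  fix xs assume xs: "xs \<in> Ob Confs"
  have sub: "set xs \<subseteq> word_op ` words" "xs \<noteq> []" using xs unfolding grpdP_sel Ob_level_1 by auto
  have "word_op (op_word x) = x \<and> op_word x \<in> words" if "x \<in> set xs" for x
    using that sub(1) by auto
  then have "xs = map word_op (map op_word xs)" "set (map op_word xs) \<subseteq> words"
    by (auto simp: map_idI)
  then show "xs \<in> map word_op ` {ws. ws \<noteq> [] \<and> set ws \<subseteq> words}" using sub(2) by blast
next
  fix xs assume "xs \<in> map word_op ` {ws. ws \<noteq> [] \<and> set ws \<subseteq> words}"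
  then show "xs \<in> Ob Confs" unfolding grpdP_sel Ob_level_1 by (auto intro!: imageI)
qed

lemma conf_mono_word_op [simp]: "conf_mono (map word_op ws) = word_mono ws"
  by (simp add: conf_mono_def o_def)

lemma conf_mono_append: "conf_mono (xs @ ys) = conf_mono xs + conf_mono ys"
  by (simp add: conf_mono_def)

lemma conf_mono_eq_iff:
  assumes "xs \<in> Ob Confs" "ys \<in> Ob Confs"
  shows "conf_mono xs = conf_mono ys \<longleftrightarrow> mset xs = mset ys"
proof -
  obtain us ws where "xs = map word_op us" "ys = map word_op ws" using assms unfolding Ob_Confs by blast
  moreover have "mset vs = image_mset op_word (mset (map word_op vs))" for vs
    by (simp add: multiset.map_comp o_def)
  ultimately show ?thesis
    unfolding conf_mono_def by (simp only: word_mono_eq_iff mset_map) metis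
qed

lemma word_mono_eq_zero_iff: "word_mono ws = 0 \<longleftrightarrow> ws = []"
  using word_mono_eq_iff[of ws "[]"] by simp

text \<open>Names an isomorphism class by its monomial, with no choice of representative.\<close>

definition conf_class :: "mono \<Rightarrow> sym_tree list set" where
  "conf_class m = {xs \<in> Ob Confs. conf_mono xs = m}"

lemma iso_class_conf:
  assumes "xs \<in> Ob Confs"
  shows "iso_class Confs xs = conf_class (conf_mono xs)"
proof -
  have "y \<in> iso_class Confs xs \<longleftrightarrow> y \<in> Ob Confs \<and> mset xs = mset y" for y
    by (rule SymX.pi0_S1_iff[OF SymX.S1.iso_class_in_pi0[OF assms] SymX.S1.in_iso_class[OF assms]])
  moreover have "y \<in> conf_class (conf_mono xs) \<longleftrightarrow> y \<in> Ob Confs \<and> mset xs = mset y" for y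
    using conf_mono_eq_iff[OF assms, of y] unfolding conf_class_def mem_Collect_eq
    by (cases "y \<in> Ob Confs") auto
  ultimately show ?thesis by (simp only: set_eq_iff simp_thms)
qed

text \<open>Configurations are nonempty tuples, so the monomial 1, whose exponent function is zero,
  corresponds to the adjoined unit and not to a class.\<close>

definition basis_map :: "mono \<Rightarrow> sym_tree list set option" where
  "basis_map m = (if m = 0 then None else Some (conf_class m))"

definition basis_map_inv :: "sym_tree list set option \<Rightarrow> mono" where
  "basis_map_inv p = (case p of None \<Rightarrow> 0 | Some C \<Rightarrow> conf_mono (rep C))"

lemma monomial_cases:
  assumes "m \<in> monomials"
  obtains "m = 0" | C where "C \<in> pi0 Confs" "m = conf_mono (rep C)" "basis_map m = Some C"
proof -
  obtain ws where ws: "m = word_mono ws" by (rule word_mono_surj)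
  show thesis
  proof (cases "ws = []")
    case False
    have "set ws \<subseteq> words" using assms ws word_mono_monomials by simp
    then have ob: "map word_op ws \<in> Ob Confs" using False unfolding Ob_Confs by blast
    let ?C = "iso_class Confs (map word_op ws)"
    have C: "?C \<in> pi0 Confs" by (rule SymX.S1.iso_class_in_pi0[OF ob])
    have "rep ?C \<in> conf_class m" using SymX.S1.rep_in[OF C] iso_class_conf[OF ob] ws by simp
    then have "m = conf_mono (rep ?C)" by (simp add: conf_class_def)
    moreover have "basis_map m = Some ?C"
      using iso_class_conf[OF ob] False by (simp add: basis_map_def ws word_mono_eq_zero_iff)
    ultimately show thesis using that(2) C by blast
  qed (use that(1) ws in simp)
qed

lemma basis_map_conf:
  assumes "xs \<in> Ob Confs"
  shows "basis_map (conf_mono xs) = Some (iso_class Confs xs)" "conf_mono xs \<noteq> 0" "conf_mono xs \<in> monomials"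
proof -
  obtain ws where ws: "xs = map word_op ws" "ws \<noteq> []" "set ws \<subseteq> words" using assms unfolding Ob_Confs by blast
  then show 1: "conf_mono xs \<noteq> 0" "conf_mono xs \<in> monomials"
    by (simp_all add: word_mono_eq_zero_iff word_mono_monomials)
  show "basis_map (conf_mono xs) = Some (iso_class Confs xs)"
    using 1 by (simp add: basis_map_def iso_class_conf[OF assms])
qed

definition iso_map :: "(mono \<Rightarrow>\<^sub>0 rat) \<Rightarrow> (sym_tree list set option \<Rightarrow>\<^sub>0 rat)" where
  "iso_map = lin_ext (\<lambda>m. single (basis_map m) 1)"

lemma iso_map_single [simp]: "iso_map (single m c) = single (basis_map m) c"
  by (simp add: iso_map_def)

lemma iso_map_add: "iso_map (u + v) = iso_map u + iso_map v"
  by (simp add: iso_map_def lin_ext_add)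

abbreviation "Inc \<equiv> incidence_bialgebra SymX"

lemma basis_Inc: "basis Inc = insert None (Some ` pi0 Confs)"
  unfolding incidence_bialgebra_def bialg.select_convs lev_SymX ..

lemma basis_Pleth: "basis plethystic_bialgebra = monomials"
  by (simp add: plethystic_bialgebra_def)

lemma basis_map_in: "m \<in> monomials \<Longrightarrow> basis_map m \<in> basis Inc"
  by (erule monomial_cases) (simp_all add: basis_Inc, simp add: basis_map_def)

lemma basis_map_inv_in: "p \<in> basis Inc \<Longrightarrow> basis_map_inv p \<in> monomials"
  using basis_map_conf(3)[OF SymX.S1.rep_ob]
  by (auto simp: basis_Inc basis_map_inv_def) (simp add: monomials_def)

lemma basis_map_inv_basis_map: "m \<in> monomials \<Longrightarrow> basis_map_inv (basis_map m) = m"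
  by (erule monomial_cases) (simp_all add: basis_map_inv_def, simp add: basis_map_def)

lemma basis_map_basis_map_inv: "p \<in> basis Inc \<Longrightarrow> basis_map (basis_map_inv p) = p"
  using basis_map_conf(1)[OF SymX.S1.rep_ob] SymX.S1.pi0_eq_iso_class[OF _ SymX.S1.rep_in]
  by (auto simp: basis_Inc basis_map_inv_def) (simp add: basis_map_def)

section \<open>Bijectivity\<close>

lemma lin_ext_carrier:
  assumes "\<And>b. b \<in> basis A \<Longrightarrow> f b \<in> basis B" "v \<in> carrier A"
  shows "lin_ext (\<lambda>b. single (f b) 1) v \<in> carrier B"
  using assms keys_lin_ext[of "\<lambda>b. single (f b) 1" v] unfolding carrier_def by fastforce

lemma lin_ext_inverse:
  assumes "\<And>b. b \<in> keys v \<Longrightarrow> g (f b) = b"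
  shows "lin_ext (\<lambda>b. single (g b) 1) (lin_ext (\<lambda>b. single (f b) 1) v) = v"
  by (rule additive_eqI[where v = v and g = "\<lambda>v. v"]) (simp_all add: lin_ext_add assms)

lemma bij_iso_map: "bij_betw iso_map (carrier plethystic_bialgebra) (carrier Inc)"
proof (rule bij_betw_byWitness[where f' = "lin_ext (\<lambda>b. single (basis_map_inv b) 1)"])
  let ?inv = "lin_ext (\<lambda>b. single (basis_map_inv b) 1) :: _ \<Rightarrow> mono \<Rightarrow>\<^sub>0 rat"
  show "\<forall>a\<in>carrier plethystic_bialgebra. ?inv (iso_map a) = a"
    unfolding iso_map_def
    by (intro ballI lin_ext_inverse basis_map_inv_basis_map) (auto simp: carrier_def basis_Pleth)
  show "\<forall>a'\<in>carrier Inc. iso_map (?inv a') = a'"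
    unfolding iso_map_def
    by (intro ballI lin_ext_inverse basis_map_basis_map_inv) (auto simp: carrier_def)
  show "iso_map ` carrier plethystic_bialgebra \<subseteq> carrier Inc"
    unfolding iso_map_def
    by (rule image_subsetI, rule lin_ext_carrier[where A = plethystic_bialgebra])
       (simp_all add: basis_map_in basis_Pleth)
  show "?inv ` carrier Inc \<subseteq> carrier plethystic_bialgebra"
    by (rule image_subsetI, rule lin_ext_carrier[where A = Inc])
       (simp_all add: basis_map_inv_in basis_Pleth)
qed

section \<open>Multiplication\<close>

lemma basis_map_add:
  assumes "m \<in> monomials" "n \<in> monomials"
  shows "basis_map (m + n) = juxt SymX (basis_map m) (basis_map n)"
proof (cases rule: monomial_cases[OF assms(1)])
  case 1
  then show ?thesis by (simp add: juxt_def basis_map_def[of 0])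
next
  case C: (2 C)
  show ?thesis
  proof (cases rule: monomial_cases[OF assms(2)])
    case 1
    then show ?thesis using C by (simp add: juxt_def basis_map_def[of 0])
  next
    case D: (2 D)
    have "rep C @ rep D \<in> Ob Confs"
      using SymX.S1.rep_ob[OF C(1)] SymX.S1.rep_ob[OF D(1)] by (auto simp: grpdP_sel)
    from basis_map_conf(1)[OF this] show ?thesis
      unfolding C(3) D(3) juxt_def lev_SymX by (simp add: conf_mono_append C(2) D(2))
  qed
qed

lemma iso_map_mult:
  assumes u: "u \<in> carrier plethystic_bialgebra" and v: "v \<in> carrier plethystic_bialgebra"
  shows "iso_map (mult plethystic_bialgebra u v) = mult Inc (iso_map u) (iso_map v)"
proof -
  \<comment> \<open>The multiplication of \<open>Inc\<close>. It is additive in the first argument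
    as a linear extension and in the second by \<open>J2\<close>, so the claim reduces to two basis
    elements.\<close>
  let ?J = "\<lambda>u' v'. lin_ext (\<lambda>p. lin_ext (\<lambda>q. single (juxt SymX p q) (1 :: rat)) v') u'"
  have J2: "?J u' (v' + v'') = ?J u' v' + ?J u' v''" for u' v' v''
    by (rule additive_eqI[where v = u']) (simp_all add: lin_ext_add smul_add)
  have "iso_map (u * v) = ?J (iso_map u) (iso_map v)"
  proof (rule additive_eqI[where v = u])
    fix m c assume m: "m \<in> keys u"
    show "iso_map (single m c * v) = ?J (iso_map (single m c)) (iso_map v)"
    proof (rule additive_eqI[where v = v])
      fix n d assume n: "n \<in> keys v"
      show "iso_map (single m c * single n d) =
          ?J (iso_map (single m c)) (iso_map (single n d))"
      proof -
        have "m \<in> monomials" "n \<in> monomials" using m n u v by (auto simp: carrier_def basis_Pleth)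
        from basis_map_add[OF this] show ?thesis by (simp add: mult_single)
      qed
    qed (simp_all add: distrib_left iso_map_add J2 lin_ext_add smul_add)
  qed (simp_all add: distrib_right iso_map_add lin_ext_add)
  then show ?thesis by (simp add: plethystic_bialgebra_def incidence_bialgebra_def)
qed

section \<open>Comultiplication\<close>

lemma leaves_word_trees:
  "conf_mono (on_ob (face SymX 2 2) (map word_tree cs)) = sum_list (map (\<lambda>t. word_mono (fst t)) cs)"
proof -
  have 1: "on_ob (face SymX 2 2) (map word_tree cs) = map word_op (concat (map fst cs))"
    by (induction cs)
       (auto simp: SymX_sel compF_def muP_def mapP_def pr1_def ungraftF_def word_tree_def)
  have 2: "word_mono (concat (map fst cs)) = sum_list (map (\<lambda>t. word_mono (fst t)) cs)"
    by (induction cs) simp_all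
  show ?thesis unfolding 1 conf_mono_word_op 2 ..
qed

text \<open>Each tree keeps its single root here, whereas the last face flattens the leaves of all
  trees into one configuration; for both faces the monomials of the trees add up.\<close>

lemma roots_word_trees:
  "conf_mono (on_ob (face SymX 2 0) (map word_tree cs)) = sum_list (map (\<lambda>t. word_mono [snd t]) cs)"
proof -
  have 1: "on_ob (face SymX 2 0) (map word_tree cs) = map word_op (map snd cs)"
    by (induction cs)
       (auto simp: SymX_sel compF_def mapP_def pr2_def opF_def ungraftF_def word_tree_def, simp add: word_op_def)
  have 2: "word_mono (map snd cs) = sum_list (map (\<lambda>t. word_mono [snd t]) cs)"
    by (induction cs) simp_all
  show ?thesis unfolding 1 conf_mono_word_op 2 ..
qed

lemma inj_word_tree: "inj word_tree"
proof (rule injI)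
  fix s t assume "word_tree s = word_tree t"
  moreover obtain \<xi>s \<eta> \<xi>s' \<eta>' where "s = (\<xi>s, \<eta>)" "t = (\<xi>s', \<eta>')" by (cases s; cases t)
  ultimately have e: "map word_op \<xi>s = map word_op \<xi>s'" "unop (word_op \<eta>) = unop (word_op \<eta>')"
    and st: "s = (\<xi>s, \<eta>)" "t = (\<xi>s', \<eta>')"
    by (simp_all add: word_tree_def)
  have "\<xi>s = \<xi>s'" using arg_cong[OF e(1), of "map op_word"] by (simp add: o_def)
  moreover have "op_word (word_op \<eta>) = op_word (word_op \<eta>')" unfolding op_word_def e(2) ..
  ultimately show "s = t" using st by simp
qed

text \<open>Composition acts on each tree of a tuple separately and the words are given in order, so
  the strict fibre is a product of sets of trees.\<close>

lemma trees_over: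
  assumes "set ws \<subseteq> words" "ws \<noteq> []"
  shows "{xs \<in> Ob (grpdP Sr T2). map (on_ob composeF) xs = map word_op ws} =
    map word_tree ` listset (map word_trees ws)"
proof -
  \<comment> \<open>Only the entries are required to lie in \<open>T2\<close>, because tuples in the
    groupoid are nonempty while the induction starts at the empty list.\<close>
  have *: "xs \<in> map word_tree ` listset (map word_trees us) \<longleftrightarrow>
      set xs \<subseteq> Ob T2 \<and> map (on_ob composeF) xs = map word_op us" if "set us \<subseteq> words" for xs us
    using that
  proof (induction us arbitrary: xs)
    case (Cons w us)
    have w: "{t \<in> Ob T2. on_ob composeF t = word_op w} = word_tree ` word_trees w"
      using Cons.prems by (intro composite_fibre) simp
    have "xs \<in> map word_tree ` listset (map word_trees (w # us)) \<longleftrightarrow>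
        (\<exists>t ts. xs = t # ts \<and> t \<in> word_tree ` word_trees w \<and> ts \<in> map word_tree ` listset (map word_trees us))"
      unfolding list.map listset_Cons_eq by (auto simp: image_iff)
    also have "\<dots> \<longleftrightarrow> set xs \<subseteq> Ob T2 \<and> map (on_ob composeF) xs = map word_op (w # us)"
      using Cons.IH Cons.prems unfolding w[symmetric] by (cases xs) auto
    finally show ?case .
  qed auto
  show ?thesis
  proof (rule set_eqI)
    fix xs
    have "xs \<noteq> []" if "map (on_ob composeF) xs = map word_op ws" using that assms(2) by auto
    then show "xs \<in> {xs \<in> Ob (grpdP Sr T2). map (on_ob composeF) xs = map word_op ws} \<longleftrightarrow>
        xs \<in> map word_tree ` listset (map word_trees ws)"
      unfolding *[OF assms(1)] grpdP_sel mem_Collect_eq by blast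
  qed
qed

text \<open>Arrow counts of words and trees are products of factorials, so the weight of a tuple
  factors into the coefficients of the \<open>tree_term\<close> of each tree.\<close>

lemma weight_word_trees:
  assumes "cs \<in> listset (map word_trees ws)"
  shows "of_nat (prod_list (map (indeg T1) (map word_op ws))) /
      of_nat (prod_list (map (indeg T2) (map word_tree cs))) =
    prod_list (map (\<lambda>(\<xi>s, \<eta>). word_fact (graft_word \<eta> \<xi>s) /
      (prod_list (map word_fact \<xi>s) * word_fact \<eta>)) cs)"
  using assms
proof (induction ws arbitrary: cs)
  case (Cons w ws)
  then obtain t ts where cs: "cs = t # ts" and t: "t \<in> word_trees w" and ts: "ts \<in> listset (map word_trees ws)"
    by (auto simp: set_Cons_def)
  obtain \<xi>s \<eta> where e: "t = (\<xi>s, \<eta>)" by (cases t)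
  have f: "of_nat (prod_list (map fact u)) = word_fact u" for u :: "nat list"
    by (induction u) (simp_all add: word_fact_def)
  have g: "of_nat (prod_list (map (\<lambda>\<xi>. prod_list (map fact \<xi>)) us)) = prod_list (map word_fact us)"
    for us :: "nat list list"
    by (induction us) (simp_all add: f)
  have w: "graft_word \<eta> \<xi>s = w" "\<eta> \<in> words" "set \<xi>s \<subseteq> words" "length \<xi>s = length \<eta>"
    using t by (simp_all add: e word_trees_def)
  have "of_nat (indeg T1 (word_op w)) = word_fact w"
    using indeg_level_1[OF graft_word_words[OF t[unfolded e]]] f by simp
  moreover have "of_nat (indeg T2 (word_tree t)) = prod_list (map word_fact \<xi>s) * word_fact \<eta>"
    unfolding e indeg_level_2[OF w(2-4)] of_nat_mult f g ..
  ultimately show ?case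
    using Cons.IH[OF ts] unfolding cs list.map prod_list.Cons of_nat_mult
    by (simp only: times_divide_times_eq[symmetric]) (simp add: e w(1))
qed simp

lemma prod_tree_terms:
  "prod_list (map tree_term cs) = single
    (sum_list (map (\<lambda>t. word_mono (fst t)) cs), sum_list (map (\<lambda>t. word_mono [snd t]) cs))
    (prod_list (map (\<lambda>(\<xi>s, \<eta>). word_fact (graft_word \<eta> \<xi>s) /
      (prod_list (map word_fact \<xi>s) * word_fact \<eta>)) cs))"
proof (induction cs)
  case Nil
  show ?case by (simp add: zero_prod_def flip: single_one)
next
  case (Cons t cs)
  then show ?case by (cases t) (simp add: tree_term_def mult_single)
qed

lemma tensor_single: "tensor (single a c) (single b d) = single (a, b) (c * d)"
  by (cases "c = 0"; cases "d = 0") (simp_all add: tensor_def)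

lemma tensor_map_add: "tensor_map \<phi> (u + v) = tensor_map \<phi> u + tensor_map \<phi> v"
  unfolding tensor_map_def by (rule lin_ext_add)

lemma tensor_map_single:
  "tensor_map iso_map (single (m, n) c) = single (basis_map m, basis_map n) c"
  by (simp add: tensor_map_def tensor_single)

lemma comult_mono:
  "lin_ext (\<lambda>m. \<Prod>w\<in>keys m. pleth_comult_gen w ^ lookup m w) (single (word_mono ws) 1) =
    (\<Sum>cs\<in>listset (map word_trees ws). prod_list (map tree_term cs))"
proof -
  have "(\<Prod>w\<in>keys (word_mono ws). pleth_comult_gen w ^ lookup (word_mono ws) w) =
      prod_list (map pleth_comult_gen ws)"
    using mono_prod_word_mono[of pleth_comult_gen ws] unfolding mono_prod_def .
  also have "map pleth_comult_gen ws = map (sum tree_term) (map word_trees ws)"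
    by (simp add: pleth_comult_gen_eq)
  also have "prod_list \<dots> = (\<Sum>cs\<in>listset (map word_trees ws). prod_list (map tree_term cs))"
    by (rule prod_list_sum_listset) (auto simp: finite_word_trees)
  finally show ?thesis by simp
qed

text \<open>On a basis element both sides become the same sum over choices of one tree over each
  word: the incidence side by \<open>comult_sum\<close> and \<open>trees_over\<close>, the
  polynomial side by \<open>comult_mono\<close>.\<close>

lemma iso_map_comult:
  assumes v: "v \<in> carrier plethystic_bialgebra"
  shows "comult Inc (iso_map v) = tensor_map iso_map (comult plethystic_bialgebra v)"
proof (rule additive_eqI[where v = v])
  show "comult Inc (iso_map (u + u')) = comult Inc (iso_map u) + comult Inc (iso_map u')" for u u'
    by (simp add: incidence_bialgebra_def iso_map_add lin_ext_add)
  show "tensor_map iso_map (comult plethystic_bialgebra (u + u')) =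
      tensor_map iso_map (comult plethystic_bialgebra u) + tensor_map iso_map (comult plethystic_bialgebra u')" for u u'
    by (simp add: plethystic_bialgebra_def lin_ext_add tensor_map_add)
next
  fix m c assume "m \<in> keys v"
  then have m: "m \<in> monomials" using v by (auto simp: carrier_def basis_Pleth)
  have red: "comult Inc (single p c) = smul c (comult Inc (single p 1))"
    "comult plethystic_bialgebra (single m c) = smul c (comult plethystic_bialgebra (single m 1))"
    for p by (simp_all add: incidence_bialgebra_def plethystic_bialgebra_def)
  have "comult Inc (single (basis_map m) 1) =
      tensor_map iso_map (comult plethystic_bialgebra (single m 1))"
  proof (cases rule: monomial_cases[OF m])
    case 1
    then show ?thesis
      by (simp add: incidence_bialgebra_def plethystic_bialgebra_def basis_map_def)
         (simp add: tensor_map_def iso_map_def tensor_single basis_map_def zero_prod_def flip: single_one)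
  next
    case C: (2 C)
    \<comment> \<open>The representative fixes an order of the words, which the monomial forgets;
      both expansions are made along this one list.\<close>
    obtain ws where ws: "rep C = map word_op ws" "ws \<noteq> []" "set ws \<subseteq> words"
      using SymX.S1.rep_ob[OF C(1)] unfolding Ob_Confs by blast
    let ?L = "listset (map word_trees ws)"
    let ?w = "\<lambda>cs. prod_list (map (\<lambda>(\<xi>s, \<eta>). word_fact (graft_word \<eta> \<xi>s) /
      (prod_list (map word_fact \<xi>s) * word_fact \<eta>)) cs)"
    let ?l = "\<lambda>cs. sum_list (map (\<lambda>t. word_mono (fst t)) cs)" and ?r = "\<lambda>cs. sum_list (map (\<lambda>t. word_mono [snd t]) cs)"
    have "comult Inc (single (basis_map m) 1) =
        (\<Sum>xs\<in>map word_tree ` ?L. single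
          (Some (iso_class Confs (on_ob (face SymX 2 2) xs)), Some (iso_class Confs (on_ob (face SymX 2 0) xs)))
          (of_nat (prod_list (map (indeg T1) (map word_op ws))) / of_nat (prod_list (map (indeg T2) xs))))"
      unfolding C(3) trees_over[OF ws(3,2), symmetric]
      using SymX.comult_sum[OF C(1)] unfolding ws(1) by (simp add: incidence_bialgebra_def)
    also have "\<dots> = (\<Sum>cs\<in>?L. single (basis_map (?l cs), basis_map (?r cs)) (?w cs))"
    proof (subst sum.reindex)
      show "inj_on (map word_tree) ?L" using inj_mapI[OF inj_word_tree] by (rule inj_on_subset) simp
      have "single (Some (iso_class Confs (on_ob (face SymX 2 2) (map word_tree cs))),
            Some (iso_class Confs (on_ob (face SymX 2 0) (map word_tree cs))))
          (of_nat (prod_list (map (indeg T1) (map word_op ws))) / of_nat (prod_list (map (indeg T2) (map word_tree cs)))) =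
        single (basis_map (?l cs), basis_map (?r cs)) (?w cs)" if cs: "cs \<in> ?L" for cs
      proof -
        have ob: "map word_tree cs \<in> Ob (grpdP Sr T2)" using cs trees_over[OF ws(3,2)] by blast
        show ?thesis
          unfolding weight_word_trees[OF cs] basis_map_conf(1)[OF functor_ob[OF SymX.d2 ob], symmetric]
            basis_map_conf(1)[OF functor_ob[OF SymX.d0 ob], symmetric] leaves_word_trees roots_word_trees ..
      qed
      then show "sum ((\<lambda>xs. single
          (Some (iso_class Confs (on_ob (face SymX 2 2) xs)), Some (iso_class Confs (on_ob (face SymX 2 0) xs)))
          (of_nat (prod_list (map (indeg T1) (map word_op ws))) / of_nat (prod_list (map (indeg T2) xs)))) \<circ> map word_tree) ?L =
        (\<Sum>cs\<in>?L. single (basis_map (?l cs), basis_map (?r cs)) (?w cs))"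
        unfolding o_def by (rule sum.cong[OF refl])
    qed
    also have "\<dots> = tensor_map iso_map (\<Sum>cs\<in>?L. prod_list (map tree_term cs))"
      unfolding additive_sum[of "tensor_map iso_map", OF tensor_map_add] prod_tree_terms tensor_map_single ..
    also have "(\<Sum>cs\<in>?L. prod_list (map tree_term cs)) = comult plethystic_bialgebra (single m 1)"
      unfolding C(2) ws(1) conf_mono_word_op by (simp add: plethystic_bialgebra_def comult_mono del: lin_ext_single)
    finally show ?thesis .
  qed
  then show "comult Inc (iso_map (single m c)) =
      tensor_map iso_map (comult plethystic_bialgebra (single m c))"
    unfolding iso_map_single red unfolding tensor_map_def by (simp add: lin_ext_smul)
qed

section \<open>Counit\<close>

lemma identity_word: "on_ob identityF t = word_op [1]"
  by (simp add: identityF_def compF_def opF_def SymT_def T_op_def T_operad_def T_cat_def Sym_def etaP_def word_op_def)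

text \<open>The only identity operation is the one-letter word 1, which is also the only word where
  the series x_1 has a nonzero coordinate. This word has trivial automorphism group, so both sides
  are 1 or both are 0.\<close>

lemma hcard_counit:
  assumes ws: "ws \<noteq> []" "set ws \<subseteq> words"
  shows "hcard (counit_fibre SymX (map word_op ws)) = prod_list (map (\<lambda>w. coord w (series_var 1)) ws)"
proof -
  have ob: "map word_op ws \<in> Ob Confs" using ws unfolding Ob_Confs by blast
  have T0: "Ob T0 = {Col ()}" unfolding level_0 by (auto simp: relabel_def colF_def)
  have i0: "indeg T0 (Col ()) = 1" by (rule indeg_level_0) (simp add: T0)
  let ?Y = "{xs \<in> Ob (grpdP Sr T0). map (on_ob identityF) xs = map word_op ws}"
  have coord: "coord w (series_var 1) = (if w = [1] then 1 else 0)" for w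
    by (simp add: coord_def series_var_def word_fact_def)
  \<comment> \<open>There is a single colour, so a tuple of identity operations has exactly one
    strict preimage and any other tuple has none.\<close>
  have Y: "xs \<in> ?Y \<longleftrightarrow> xs = replicate (length ws) (Col ()) \<and> (\<forall>w\<in>set ws. w = [1])" for xs
  proof -
    have inj: "word_op [1] = word_op w \<longleftrightarrow> w = [1]" for w by (metis op_word_word_op)
    have "xs \<in> ?Y \<longleftrightarrow> (\<forall>x\<in>set xs. x = Col ()) \<and> length xs = length ws \<and> (\<forall>i<length ws. ws ! i = [1])"
      using ws(1) unfolding grpdP_sel T0 mem_Collect_eq list_eq_iff[of _ "map word_op ws"]
      by (auto simp: identity_word inj simp del: One_nat_def)
    moreover have "xs = replicate (length ws) (Col ()) \<longleftrightarrow> (\<forall>x\<in>set xs. x = Col ()) \<and> length xs = length ws"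
      using replicate_eqI[of xs "length ws" "Col ()"] by auto
    ultimately show ?thesis unfolding all_set_conv_all_nth[of ws] by blast
  qed
  have h: "hcard (counit_fibre SymX (map word_op ws)) = (\<Sum>xs\<in>?Y.
      of_nat (prod_list (map (indeg T1) (map word_op ws))) / of_nat (prod_list (map (indeg T0) xs)))"
    by (rule SymX.counit_fibre_hfinite_hcard(2)[OF ob])
  show ?thesis
  proof (cases "\<forall>w\<in>set ws. w = [1]")
    case True
    then have Y1: "?Y = {replicate (length ws) (Col ())}" using Y by blast
    have "indeg T1 (word_op w) = 1" if "w \<in> set ws" for w
    proof -
      have "w = [1]" "w \<in> words" using True that ws(2) by auto
      then show ?thesis using indeg_level_1[of w] by simp
    qed
    then have "prod_list (map (indeg T1) (map word_op ws)) = 1"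
      by (induction ws) auto
    moreover have "prod_list (map (\<lambda>w. coord w (series_var 1)) ws) = 1"
      using True unfolding coord by (induction ws) auto
    ultimately show ?thesis unfolding h Y1 by (simp add: i0)
  next
    case False
    then have Y0: "?Y = {}" using Y by blast
    have "prod_list (map (\<lambda>w. coord w (series_var 1)) ws) = 0"
      using False unfolding coord by (induction ws) auto
    then show ?thesis unfolding h Y0 by simp
  qed
qed

lemma iso_map_counit:
  assumes v: "v \<in> carrier plethystic_bialgebra"
  shows "counit Inc (iso_map v) = counit plethystic_bialgebra v"
proof (rule additive_eqI[where v = v])
  show "counit Inc (iso_map (u + u')) = counit Inc (iso_map u) + counit Inc (iso_map u')" for u u'
    unfolding iso_map_add incidence_bialgebra_def bialg.select_convs
    by (rule sum_keys_additive) (simp add: algebra_simps)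
  show "counit plethystic_bialgebra (u + u') = counit plethystic_bialgebra u + counit plethystic_bialgebra u'" for u u'
    by (simp add: plethystic_bialgebra_def eval_poly_add)
next
  fix m c assume "m \<in> keys v"
  then have m: "m \<in> monomials" using v by (auto simp: carrier_def basis_Pleth)
  show "counit Inc (iso_map (single m c)) = counit plethystic_bialgebra (single m c)"
  proof (cases rule: monomial_cases[OF m])
    case 1
    then show ?thesis
      by (simp add: incidence_bialgebra_def plethystic_bialgebra_def basis_map_def eval_poly_def eval_mono_def)
  next
    case C: (2 C)
    obtain ws where ws: "rep C = map word_op ws" "ws \<noteq> []" "set ws \<subseteq> words"
      using SymX.S1.rep_ob[OF C(1)] unfolding Ob_Confs by blast
    have mw: "m = word_mono ws" using C(2) ws(1) by simp
    show ?thesis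
      unfolding iso_map_single C(3)
      by (simp add: incidence_bialgebra_def plethystic_bialgebra_def eval_poly_def ws(1)
          hcard_counit[OF ws(2,3)]) (simp add: mw eval_mono_word_mono)
  qed
qed

theorem theorem5p5:
  shows "locally_finite (bar Sr Mr (T_op Mr Sr Sym)) \<and>
    (\<exists>\<phi>. bialg_iso plethystic_bialgebra (incidence_bialgebra (bar Sr Mr (T_op Mr Sr Sym))) \<phi>)"
proof -
  have X: "bar Sr Mr (T_op Mr Sr Sym) = SymX" by (simp add: SymX_def SymT_def)
  have "iso_map (unit_el plethystic_bialgebra) = unit_el Inc"
    by (simp add: plethystic_bialgebra_def incidence_bialgebra_def basis_map_def flip: single_one)
  moreover have "iso_map (smul c v) = smul c (iso_map v)" for c v
    by (simp add: iso_map_def lin_ext_smul)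
  ultimately have "bialg_iso plethystic_bialgebra Inc iso_map"
    unfolding bialg_iso_def
    using bij_iso_map iso_map_add iso_map_mult iso_map_comult iso_map_counit by blast
  then show ?thesis unfolding X using SymX.locally_finite by blast
qed

end
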